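(* Let $k$ be a field of characteristic $2$, let $E=E_{c^2}$ be an elliptic curve over $k$ in $\mathbf{Z}/4\mathbf{Z}$-normal form $$(X_0+X_1+X_2+X_3)^2=c^2X_0X_2=c^2X_1X_3,\qquad \mathrm{O}=(1:0:0:1),$$ and let $P=(t_0:t_1:t_2:t_3)$ be a fixed point in $E(k)$. The Kummer-oriented curve $\mathscr{K}(\Delta_P)$ in $\mathscr{K}^2=\mathbb{P}^1\times\mathbb{P}^1$, with coordinate functions $((U_0,U_1),(V_0,V_1))$, has defining equation $$t_0^2(U_0V_1+U_1V_0)^2+t_1^2(U_0V_0+U_1V_1)^2=c^2t_0t_1U_0U_1V_0V_1.$$ If $P$ is not a $2$-torsion point, the morphism $\kappa:E\to\mathscr{K}(\Delta_P)$ defined by $Q\mapsto(\overline{Q},\overline{Q-P})$ is an isomorphism, given by $$\pi_1\circ\kappa(X_0:X_1:X_2:X_3)=(U_0:U_1)=\begin{cases}(X_0:X_1),\\(X_3:X_2),\end{cases}$$ $$\pi_2\circ\kappa(X_0:X_1:X_2:X_3)=(V_0:V_1)=\begin{cases}(t_0X_0+t_2X_2:t_3X_1+t_1X_3),\\(t_1X_1+t_3X_3:t_2X_0+t_0X_2),\end{cases}$$ with inverse $\kappa^{-1}$ determined by $$\pi_1\circ\kappa^{-1}((U_0:U_1),(V_0:V_1))=(U_0:U_1),$$ $$\pi_2\circ\kappa^{-1}((U_0:U_1),(V_0:V_1))=\begin{cases}(t_1U_0V_0+t_2U_1V_1:t_0U_0V_1+t_3U_1V_0),\\(t_3U_0V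_1+t_0U_1V_0:t_2U_0V_0+t_1U_1V_1).\end{cases}$$
   Context: $\mathscr{K}=E/\{[\pm1]\}$ is identified with $\mathbb{P}^1$ via the covering $E\to\mathbb{P}^1$, $(X_0:X_1:X_2:X_3)\mapsto (X_0:X_1)=(X_3:X_2)$; $\overline{Q}$ denotes the image of $Q\in E$ in $\mathscr{K}$. Here $[-1](X_0:X_1:X_2:X_3)=(X_3:X_2:X_1:X_0)$. For $P\in E(k)$, $\Delta_P=\{(Q,R)\in E\times E\mid Q-R=P\}$, and $\mathscr{K}(\Delta_P)$ is the image of $\Delta_P$ in $\mathscr{K}\times\mathscr{K}$ (the Kummer-oriented curve). In $\pi_i\circ\kappa$, the maps $\pi_1,\pi_2$ are the two projections of $\mathscr{K}^2=\mathbb{P}^1\times\mathbb{P}^1$. In $\pi_i\circ\kappa^{-1}$, they are the morphisms $E\to\mathbb{P}^1$ given by $\pi_1(X)=(X_0:X_1)=(X_3:X_2)$ and $\pi_2(X)=(X_0:X_3)=(X_1:X_2)$; the point of $E$ is recovered from $\pi_1=(A_0:A_1)$, $\pi_2=(B_0:B_1)$ by the skew-Segre embedding $(A_0B_0:A_1B_0:A_1B_1:A_0B_1)$. A morphism written with a brace and several tuples means: each tuple defines the morphism on the open complement of the common zeros of its entries, the tuples agree on overlaps, and these open sets cover the curve.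
   Formalization: For P=(0:0:1:1) the printed equation reads 0=0, so it is asserted only when (t_0,t_1) is not (0,0), and also with (t_3,t_2) in place of (t_0,t_1) when that pair is nonzero; for 2-torsion P, where the polynomial is a square, it defines the curve as a zero locus. *)

theory Defs
  imports "HOL-Algebra.Algebraic_Closure_Type"
begin

text \<open>
  Varieties are sets of geometric points over an algebraically closed field. A point of
  projective $n$-space is the set of all its homogeneous coordinate vectors, and a coordinate
  vector is a list of length $n+1$. A point of a product of two projective spaces is a pair.
\<close>

definition nonzero :: "'a::field list \<Rightarrow> bool" where
  "nonzero x \<longleftrightarrow> (\<exists>a \<in> set x. a \<noteq> 0)"

definition pt :: "'a::field list \<Rightarrow> 'a list set" where
  "pt x = {map (\<lambda>a. s * a) x | s. s \<noteq> 0}"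

definition proj_space :: "nat \<Rightarrow> 'a::field list set set" where
  "proj_space n = {pt x | x. length x = Suc n \<and> nonzero x}"

text \<open>
  Forms of degree \<open>d\<close> in \<open>n\<close> variables, and forms of bidegree \<open>(d, e)\<close> on the product of two
  projective lines, with coefficients in the subfield \<open>k\<close>. Over an infinite field a polynomial
  may be identified with its polynomial function.
\<close>

definition forms :: "'a::field set \<Rightarrow> nat \<Rightarrow> nat \<Rightarrow> ('a list \<Rightarrow> 'a) set" where
  "forms k n d =
     {\<lambda>x. \<Sum>\<alpha> | length \<alpha> = n \<and> sum_list \<alpha> = d. a \<alpha> * (\<Prod>i<n. x!i ^ \<alpha>!i) | a. \<forall>\<alpha>. a \<alpha> \<in> k}"

definition biforms :: "'a::field set \<Rightarrow> nat \<Rightarrow> nat \<Rightarrow> ('a list \<times> 'a list \<Rightarrow> 'a) set" where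
  "biforms k d e =
     {\<lambda>(u, v). \<Sum>i\<le>d. \<Sum>j\<le>e. a i j * (u!0 ^ i * u!1 ^ (d - i)) * (v!0 ^ j * v!1 ^ (e - j)) | a.
        \<forall>i j. a i j \<in> k}"

text \<open>
  \<open>given_by coords T S f\<close>: on \<open>S\<close>, every tuple in the family \<open>T\<close> defines the map \<open>f\<close> on the
  complement of the common zeros of its entries, and these complements cover \<open>S\<close>; agreement on
  overlaps is implied. Here \<open>coords Z\<close> is the set of coordinate vectors of the point \<open>Z\<close>.
\<close>

definition given_by ::
  "('p \<Rightarrow> 'x set) \<Rightarrow> ('x \<Rightarrow> 'a::field list) set \<Rightarrow> 'p set \<Rightarrow> ('p \<Rightarrow> 'a list set) \<Rightarrow> bool" where
  "given_by coords T S f \<longleftrightarrow>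
     (\<forall>Z\<in>S. \<forall>x\<in>coords Z.
        (\<exists>h\<in>T. nonzero (h x)) \<and> (\<forall>h\<in>T. nonzero (h x) \<longrightarrow> f Z = pt (h x)))"

definition coords1 :: "'a list set \<Rightarrow> 'a list set" where
  "coords1 Z = Z"

definition coords2 :: "'a list set \<times> 'a list set \<Rightarrow> ('a list \<times> 'a list) set" where
  "coords2 = (\<lambda>(p, q). p \<times> q)"

definition tuples :: "('x \<Rightarrow> 'a) set \<Rightarrow> nat \<Rightarrow> ('x \<Rightarrow> 'a list) set" where
  "tuples F m = {\<lambda>x. map (\<lambda>f. f x) fs | fs. length fs = m \<and> set fs \<subseteq> F}"

text \<open>
  Morphisms over \<open>k\<close> to projective \<open>m\<close>-space: locally given by \<open>m+1\<close> forms over \<open>k\<close> of equal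
  (bi)degree. A local description on a smaller open set may be multiplied by a form vanishing
  off that set, so it is no restriction that each tuple describes the map wherever its entries
  do not all vanish.
\<close>

definition morphism ::
  "'a::field set \<Rightarrow> nat \<Rightarrow> nat \<Rightarrow> 'a list set set \<Rightarrow> ('a list set \<Rightarrow> 'a list set) \<Rightarrow> bool" where
  "morphism k n m S f \<longleftrightarrow>
     (\<exists>T. T \<subseteq> (\<Union>d. tuples (forms k (Suc n) d) (Suc m)) \<and> given_by coords1 T S f)"

definition bimorphism ::
  "'a::field set \<Rightarrow> nat \<Rightarrow> ('a list set \<times> 'a list set) set \<Rightarrow>
     ('a list set \<times> 'a list set \<Rightarrow> 'a list set) \<Rightarrow> bool" where
  "bimorphism k m S f \<longleftrightarrow>
     (\<exists>T. T \<subseteq> (\<Union>d e. tuples (biforms k d e) (Suc m)) \<and> given_by coords2 T S f)"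

text \<open>
  Isomorphisms over \<open>k\<close> from \<open>S\<close> in projective 3-space to \<open>S'\<close> in a product of two projective
  lines.
\<close>

definition isomorphism ::
  "'a::field set \<Rightarrow> 'a list set set \<Rightarrow> ('a list set \<times> 'a list set) set \<Rightarrow>
     ('a list set \<Rightarrow> 'a list set \<times> 'a list set) \<Rightarrow> bool" where
  "isomorphism k S S' f \<longleftrightarrow>
     bij_betw f S S' \<and> morphism k 3 1 S (fst \<circ> f) \<and> morphism k 3 1 S (snd \<circ> f) \<and>
     bimorphism k 3 S' (the_inv_into S f)"

definition EC_cone :: "'a::field \<Rightarrow> 'a list set" where
  "EC_cone c = {x. length x = 4 \<and> nonzero x \<and>
     (x!0 + x!1 + x!2 + x!3)^2 = c^2 * x!0 * x!2 \<and> c^2 * x!0 * x!2 = c^2 * x!1 * x!3}"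

definition EC :: "'a::field \<Rightarrow> 'a list set set" where
  "EC c = pt ` EC_cone c"

definition EC_O :: "'a::field list set" where
  "EC_O = pt [1, 0, 0, 1]"

text \<open>
  The group law is the one transported from the divisor class group: \<open>R\<close> is the sum of \<open>P\<close> and
  \<open>Q\<close> iff the divisor \<open>(P) + (Q) - (R) - (O)\<close> is principal. Divisors of forms are computed with
  the order of vanishing in the local ring of the curve at a point. \<open>loc_dvd c Z F G\<close>: \<open>F\<close>
  divides \<open>G\<close> in the local ring at \<open>Z\<close>, after dehomogenizing. A uniformizer generates the
  maximal ideal.
\<close>

definition loc_dvd ::
  "'a::field \<Rightarrow> 'a list set \<Rightarrow> ('a list \<Rightarrow> 'a) \<Rightarrow> ('a list \<Rightarrow> 'a) \<Rightarrow> bool" where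
  "loc_dvd c Z F G \<longleftrightarrow>
     (\<exists>d e. \<exists>A\<in>forms UNIV 4 d. \<exists>B\<in>forms UNIV 4 e.
        (\<forall>x\<in>Z. B x \<noteq> 0) \<and> (\<forall>y\<in>EC_cone c. B y * G y = A y * F y))"

definition uniformizer :: "'a::field \<Rightarrow> 'a list set \<Rightarrow> ('a list \<Rightarrow> 'a) \<Rightarrow> bool" where
  "uniformizer c Z t \<longleftrightarrow>
     (\<exists>d. t \<in> forms UNIV 4 d) \<and> (\<forall>x\<in>Z. t x = 0) \<and>
     (\<forall>d. \<forall>F\<in>forms UNIV 4 d. (\<forall>x\<in>Z. F x = 0) \<longrightarrow> loc_dvd c Z t F)"

definition ord_at :: "'a::field \<Rightarrow> 'a list set \<Rightarrow> ('a list \<Rightarrow> 'a) \<Rightarrow> nat" where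
  "ord_at c Z F = (THE n. \<exists>t. uniformizer c Z t \<and>
     loc_dvd c Z (\<lambda>x. t x ^ n) F \<and> loc_dvd c Z F (\<lambda>x. t x ^ n))"

definition principal :: "'a::field \<Rightarrow> ('a list set \<Rightarrow> int) \<Rightarrow> bool" where
  "principal c D \<longleftrightarrow>
     (\<exists>d. \<exists>F\<in>forms UNIV 4 d. \<exists>G\<in>forms UNIV 4 d.
        (\<exists>y\<in>EC_cone c. F y \<noteq> 0) \<and> (\<exists>y\<in>EC_cone c. G y \<noteq> 0) \<and>
        (\<forall>Z\<in>EC c. D Z = int (ord_at c Z F) - int (ord_at c Z G)))"

definition point_div :: "'p \<Rightarrow> 'p \<Rightarrow> int" where
  "point_div P Z = (if Z = P then 1 else 0)"

definition EC_add :: "'a::field \<Rightarrow> 'a list set \<Rightarrow> 'a list set \<Rightarrow> 'a list set" where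
  "EC_add c P Q = (THE R. R \<in> EC c \<and>
     principal c (\<lambda>Z. point_div P Z + point_div Q Z - point_div R Z - point_div EC_O Z))"

definition EC_group :: "'a::field \<Rightarrow> 'a list set monoid" where
  "EC_group c = \<lparr>carrier = EC c, monoid.mult = EC_add c, one = EC_O\<rparr>"

definition glue :: "('a list \<Rightarrow> 'a::field list) set \<Rightarrow> 'a list set \<Rightarrow> 'a list set" where
  "glue T Z = (THE p. \<forall>x\<in>Z. \<forall>h\<in>T. nonzero (h x) \<longrightarrow> p = pt (h x))"

text \<open>
  \<open>proj1\<close> is the quotient by the inversion, so it identifies the Kummer curve with the
  projective line.
\<close>

definition proj1 :: "'a::field list set \<Rightarrow> 'a list set" where
  "proj1 = glue {\<lambda>x. [x!0, x!1], \<lambda>x. [x!3, x!2]}"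

definition proj2 :: "'a::field list set \<Rightarrow> 'a list set" where
  "proj2 = glue {\<lambda>x. [x!0, x!3], \<lambda>x. [x!1, x!2]}"

definition skew_segre :: "'a::field list set \<Rightarrow> 'a list set \<Rightarrow> 'a list set" where
  "skew_segre p q = (THE Z. \<forall>a\<in>p. \<forall>b\<in>q. Z = pt [a!0 * b!0, a!1 * b!0, a!1 * b!1, a!0 * b!1])"

definition Delta :: "'a::field \<Rightarrow> 'a list set \<Rightarrow> ('a list set \<times> 'a list set) set" where
  "Delta c P = {(Q, R) \<in> EC c \<times> EC c. Q \<otimes>\<^bsub>EC_group c\<^esub> (inv\<^bsub>EC_group c\<^esub> R) = P}"

definition Kummer_Delta :: "'a::field \<Rightarrow> 'a list set \<Rightarrow> ('a list set \<times> 'a list set) set" where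
  "Kummer_Delta c P = (\<lambda>(Q, R). (proj1 Q, proj1 R)) ` Delta c P"

definition kappa :: "'a::field \<Rightarrow> 'a list set \<Rightarrow> 'a list set \<Rightarrow> 'a list set \<times> 'a list set" where
  "kappa c P Q = (proj1 Q, proj1 (Q \<otimes>\<^bsub>EC_group c\<^esub> (inv\<^bsub>EC_group c\<^esub> P)))"

definition Kummer_poly :: "'a::field \<Rightarrow> 'a \<Rightarrow> 'a \<Rightarrow> 'a list \<times> 'a list \<Rightarrow> 'a" where
  "Kummer_poly c s0 s1 = (\<lambda>(u, v).
     s0^2 * (u!0 * v!1 + u!1 * v!0)^2 + s1^2 * (u!0 * v!0 + u!1 * v!1)^2
       - c^2 * s0 * s1 * u!0 * u!1 * v!0 * v!1)"

definition zero_locus :: "('a::field list \<times> 'a list \<Rightarrow> 'a) \<Rightarrow> ('a list set \<times> 'a list set) set" where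
  "zero_locus f = {(p, q). p \<in> proj_space 1 \<and> q \<in> proj_space 1 \<and> (\<forall>u\<in>p. \<forall>v\<in>q. f (u, v) = 0)}"

text \<open>
  A zero locus alone does not determine an equation (for a 2-torsion point the Kummer polynomial
  is a square): \<open>generates_ideal f S\<close> says that every form vanishing on \<open>S\<close> is a multiple of \<open>f\<close>.
\<close>

definition generates_ideal ::
  "('a::field list \<times> 'a list \<Rightarrow> 'a) \<Rightarrow> ('a list set \<times> 'a list set) set \<Rightarrow> bool" where
  "generates_ideal f S \<longleftrightarrow>
     (\<forall>d e. \<forall>G\<in>biforms UNIV d e. (\<forall>(p, q)\<in>S. \<forall>u\<in>p. \<forall>v\<in>q. G (u, v) = 0) \<longrightarrow>
        (\<exists>d' e'. \<exists>A\<in>biforms UNIV d' e'. \<forall>u v. length u = 2 \<and> length v = 2 \<longrightarrow>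
           G (u, v) = A (u, v) * f (u, v)))"

end

theory Submission
  imports Defs
begin

text \<open>
  Put \<open>x = X\<^sub>1 / X\<^sub>0\<close> and \<open>y = X\<^sub>3 / X\<^sub>0\<close>; the curve is \<open>(1 + x)\<^sup>2 (1 + y)\<^sup>2 = c\<^sup>2 x y\<close> and inversion is
  \<open>y \<mapsto> 1 / y\<close>. Every function on it is \<open>a(x) + b(x) w\<close> with \<open>w = (1 + x)\<^sup>2 y\<close> quadratic over \<open>K[x]\<close>, and
  its norm to \<open>K[x]\<close> yields irreducibility of the curve and finiteness of the order of vanishing, so
  that \<open>ord_at\<close> is a discrete valuation. A function with poles at most those of \<open>x\<close> is shown
  to be a linear polynomial in \<open>x\<close>; hence two points with linearly equivalent divisors coincide and the
  sum of two points, if it exists, is unique.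

  Sums are constructed by chords and tangents: projection from the point \<open>T = (0:1:1:0)\<close> turns the
  curve into a plane cubic with flex \<open>O\<close>. The \<open>x\<close>-coordinate of the third point on a chord gives
  \<open>x(Q + Y) = (X\<^sub>0 Y\<^sub>3 + X\<^sub>2 Y\<^sub>1 : X\<^sub>1 Y\<^sub>0 + X\<^sub>3 Y\<^sub>2)\<close>, and exchanging \<open>Q\<close> and \<open>Y\<close> gives the second form of this
  addition law. With \<open>Y = -P\<close> these are the two tuples for \<open>x(Q - P)\<close>; eliminating \<open>y(Q)\<close> gives the
  equation of the Kummer-oriented curve, and solving for \<open>y(Q)\<close> gives the inverse. Over a given \<open>x(Q)\<close> the
  two roots of that equation are \<open>x(Q - P)\<close> and \<open>x(Q + P)\<close>, which are distinct unless \<open>P\<close> or \<open>Q\<close>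
  is \<open>2\<close>-torsion.
\<close>

section \<open>Forms\<close>

text \<open>The group law is specified only through principal divisors, so any statement about a sum
  needs both the additivity of \<open>ord_at\<close> and the absence of a function with a single
  simple pole. The second fact is reduced to degree bounds for the two polynomials of the normal
  form, which replaces Riemann-Roch. Characteristic 2 shapes the arguments: the double cover x is
  ramified only over 0 and infinity, at O and T, the only points fixed by inversion. There x (or
  1/x) is not a uniformizer, so these points recur as special cases. Elsewhere the conjugate values
  of w differ by c^2 x, which replaces the usual division by 2. The norm of a linear form determines
  its divisor only up to inversion. For a chord this is repaired by noting that the form and its
  conjugate add up to a multiple of X0 + X3, so that both vanish only at fixed points, where their
  orders agree by symmetry. That the Kummer polynomial generates the ideal is a claim beyond the
  zero locus; there P not being 2-torsion enters in the form that x(P) is neither 0 nor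
  infinity.\<close>

locale subring_set =
  fixes k :: "'a::field set"
  assumes zero_mem: "0 \<in> k" and one_mem: "1 \<in> k"
    and add_mem: "a \<in> k \<Longrightarrow> b \<in> k \<Longrightarrow> a + b \<in> k"
    and mult_mem: "a \<in> k \<Longrightarrow> b \<in> k \<Longrightarrow> a * b \<in> k"

lemma subring_set_UNIV: "subring_set UNIV"
  by unfold_locales auto

lemma finite_exponents: "finite {\<alpha> :: nat list. length \<alpha> = n \<and> sum_list \<alpha> = d}"
proof (rule finite_subset)
  show "{\<alpha>. length \<alpha> = n \<and> sum_list \<alpha> = d} \<subseteq> {\<alpha>. set \<alpha> \<subseteq> {..d} \<and> length \<alpha> = n}"
    using member_le_sum_list by fastforce
  show "finite {\<alpha> :: nat list. set \<alpha> \<subseteq> {..d} \<and> length \<alpha> = n}"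
    by (rule finite_lists_length_eq) simp
qed

lemma forms_homogeneous:
  assumes "F \<in> forms k n d" "length x = n"
  shows "F (map ((*) s) x) = s ^ d * F x"
proof -
  obtain a where F: "F = (\<lambda>x. \<Sum>\<alpha> | length \<alpha> = n \<and> sum_list \<alpha> = d. a \<alpha> * (\<Prod>i<n. x!i ^ \<alpha>!i))"
    using assms(1) unfolding forms_def by auto
  have "(\<Prod>i<n. map ((*) s) x ! i ^ \<alpha>!i) = s ^ d * (\<Prod>i<n. x!i ^ \<alpha>!i)"
    if "length \<alpha> = n" "sum_list \<alpha> = d" for \<alpha>
  proof -
    have "(\<Prod>i<n. map ((*) s) x ! i ^ \<alpha>!i) = (\<Prod>i<n. s ^ \<alpha>!i * x!i ^ \<alpha>!i)"
      using assms(2) by (intro prod.cong) (auto simp: power_mult_distrib)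
    also have "\<dots> = s ^ (\<Sum>i<n. \<alpha>!i) * (\<Prod>i<n. x!i ^ \<alpha>!i)"
      by (simp add: prod.distrib power_sum)
    also have "(\<Sum>i<n. \<alpha>!i) = d"
      using that by (simp add: sum_list_sum_nth atLeast0LessThan)
    finally show ?thesis .
  qed
  then show ?thesis
    unfolding F by (auto simp: sum_distrib_left algebra_simps intro!: sum.cong)
qed

context subring_set
begin

lemma forms_zero: "(\<lambda>_. 0) \<in> forms k n d"
  unfolding forms_def using zero_mem by (auto intro!: exI[of _ "\<lambda>_. 0"])

lemma forms_add:
  assumes "F \<in> forms k n d" "G \<in> forms k n d"
  shows "(\<lambda>x. F x + G x) \<in> forms k n d"
proof -
  obtain a where F: "F = (\<lambda>x. \<Sum>\<alpha> | length \<alpha> = n \<and> sum_list \<alpha> = d. a \<alpha> * (\<Prod>i<n. x!i ^ \<alpha>!i))"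
    and a: "\<forall>\<alpha>. a \<alpha> \<in> k"
    using assms(1) unfolding forms_def by auto
  obtain b where G: "G = (\<lambda>x. \<Sum>\<alpha> | length \<alpha> = n \<and> sum_list \<alpha> = d. b \<alpha> * (\<Prod>i<n. x!i ^ \<alpha>!i))"
    and b: "\<forall>\<alpha>. b \<alpha> \<in> k"
    using assms(2) unfolding forms_def by auto
  show ?thesis
    unfolding forms_def using a b add_mem
    by (auto simp: F G algebra_simps sum.distrib intro!: exI[of _ "\<lambda>\<alpha>. a \<alpha> + b \<alpha>"])
qed

lemma forms_scale:
  assumes "F \<in> forms k n d" "s \<in> k"
  shows "(\<lambda>x. s * F x) \<in> forms k n d"
proof -
  obtain a where F: "F = (\<lambda>x. \<Sum>\<alpha> | length \<alpha> = n \<and> sum_list \<alpha> = d. a \<alpha> * (\<Prod>i<n. x!i ^ \<alpha>!i))"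
    and a: "\<forall>\<alpha>. a \<alpha> \<in> k"
    using assms(1) unfolding forms_def by auto
  show ?thesis
    unfolding forms_def using a assms(2) mult_mem
    by (auto simp: F sum_distrib_left mult.assoc intro!: exI[of _ "\<lambda>\<alpha>. s * a \<alpha>"])
qed

lemma forms_sum:
  assumes "finite A" "\<And>\<beta>. \<beta> \<in> A \<Longrightarrow> F \<beta> \<in> forms k n d"
  shows "(\<lambda>x. \<Sum>\<beta>\<in>A. F \<beta> x) \<in> forms k n d"
  using assms by (induction A rule: finite_induct) (auto intro: forms_zero forms_add)

lemma forms_monomial:
  assumes "length \<alpha> = n" "sum_list \<alpha> = d"
  shows "(\<lambda>x. \<Prod>i<n. x!i ^ \<alpha>!i) \<in> forms k n d"
proof -
  have "(\<lambda>x. \<Prod>i<n. x!i ^ \<alpha>!i) = (\<lambda>x. \<Sum>\<beta> | length \<beta> = n \<and> sum_list \<beta> = d.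
          (if \<beta> = \<alpha> then 1 else 0) * (\<Prod>i<n. x!i ^ \<beta>!i) :: 'a)"
    using assms finite_exponents by (auto simp: if_distrib[of "\<lambda>t. t * _"] sum.delta cong: if_cong)
  then show ?thesis
    unfolding forms_def using zero_mem one_mem
    by (auto intro!: exI[of _ "\<lambda>\<beta>. if \<beta> = \<alpha> then 1 else 0"])
qed

lemma forms_mult:
  assumes "F \<in> forms k n d" "G \<in> forms k n e"
  shows "(\<lambda>x. F x * G x) \<in> forms k n (d + e)"
proof -
  obtain a where F: "F = (\<lambda>x. \<Sum>\<alpha> | length \<alpha> = n \<and> sum_list \<alpha> = d. a \<alpha> * (\<Prod>i<n. x!i ^ \<alpha>!i))"
    and a: "\<forall>\<alpha>. a \<alpha> \<in> k"
    using assms(1) unfolding forms_def by auto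
  obtain b where G: "G = (\<lambda>x. \<Sum>\<alpha> | length \<alpha> = n \<and> sum_list \<alpha> = e. b \<alpha> * (\<Prod>i<n. x!i ^ \<alpha>!i))"
    and b: "\<forall>\<alpha>. b \<alpha> \<in> k"
    using assms(2) unfolding forms_def by auto
  have mon: "(\<lambda>x. (\<Prod>i<n. x!i ^ \<alpha>!i) * (\<Prod>i<n. x!i ^ \<beta>!i)) \<in> forms k n (d + e)"
    if "length \<alpha> = n" "sum_list \<alpha> = d" "length \<beta> = n" "sum_list \<beta> = e" for \<alpha> \<beta>
  proof -
    define \<gamma> where "\<gamma> = map (\<lambda>i. \<alpha>!i + \<beta>!i) [0..<n]"
    have "sum_list \<gamma> = d + e"
      using that by (auto simp: \<gamma>_def sum_list_sum_nth sum.distrib)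
    then have "(\<lambda>x. \<Prod>i<n. x!i ^ \<gamma>!i) \<in> forms k n (d + e)"
      by (intro forms_monomial) (auto simp: \<gamma>_def)
    moreover have "(\<lambda>x. \<Prod>i<n. x!i ^ \<gamma>!i) = (\<lambda>x::'a list. (\<Prod>i<n. x!i ^ \<alpha>!i) * (\<Prod>i<n. x!i ^ \<beta>!i))"
      by (auto simp: \<gamma>_def power_add prod.distrib)
    ultimately show ?thesis by simp
  qed
  have "(\<lambda>x. F x * G x) = (\<lambda>x. \<Sum>\<alpha> | length \<alpha> = n \<and> sum_list \<alpha> = d. \<Sum>\<beta> | length \<beta> = n \<and> sum_list \<beta> = e.
          (a \<alpha> * b \<beta>) * ((\<Prod>i<n. x!i ^ \<alpha>!i) * (\<Prod>i<n. x!i ^ \<beta>!i)))"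
    by (auto simp: F G sum_product algebra_simps)
  moreover have "\<dots> \<in> forms k n (d + e)"
    using a b mult_mem mon by (auto intro!: forms_sum finite_exponents forms_scale)
  ultimately show ?thesis by simp
qed

lemma forms_const: "a \<in> k \<Longrightarrow> (\<lambda>_. a) \<in> forms k n 0"
  using forms_scale[OF forms_monomial[of "replicate n 0" n 0], of a]
  by simp

lemma forms_coord:
  assumes "i < n"
  shows "(\<lambda>x. x!i) \<in> forms k n 1"
proof -
  let ?\<alpha> = "map (\<lambda>j. if j = i then 1 else 0 :: nat) [0..<n]"
  have "sum_list ?\<alpha> = 1"
    using assms by (auto simp: sum_list_sum_nth)
  moreover have "(\<Prod>j<n. x!j ^ ?\<alpha>!j) = x!i" for x :: "'a list"
  proof -
    have "(\<Prod>j<n. x!j ^ ?\<alpha>!j) = (\<Prod>j<n. if j = i then x!j else 1)"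
      by (intro prod.cong) auto
    then show ?thesis using assms by simp
  qed
  ultimately show ?thesis
    using forms_monomial[of ?\<alpha> n 1] by simp
qed

lemma forms_power:
  assumes "F \<in> forms k n d"
  shows "(\<lambda>x. F x ^ m) \<in> forms k n (m * d)"
proof (induction m)
  case 0
  then show ?case using forms_const[OF one_mem] by simp
next
  case (Suc m)
  then show ?case using forms_mult[OF assms Suc] by simp
qed

text \<open>Forms are built in the manner of Horner, by sums and by multiplication with one
  coordinate at a time. The degree is an argument of \<open>P\<close>, since the zero form occurs in
  every degree.\<close>

lemma forms_induct [consumes 1, case_names const zero add coord]:
  assumes F: "F \<in> forms k n d"
    and const: "\<And>a. a \<in> k \<Longrightarrow> P 0 (\<lambda>_. a)"
    and zero: "\<And>d. P d (\<lambda>_. 0)"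
    and add: "\<And>d f g. P d f \<Longrightarrow> P d g \<Longrightarrow> P d (\<lambda>x. f x + g x)"
    and coord: "\<And>d f i. i < n \<Longrightarrow> P d f \<Longrightarrow> P (Suc d) (\<lambda>x. x!i * f x)"
  shows "P d F"
proof -
  obtain a where F: "F = (\<lambda>x. \<Sum>\<alpha> | length \<alpha> = n \<and> sum_list \<alpha> = d. a \<alpha> * (\<Prod>i<n. x!i ^ \<alpha>!i))"
    and a: "\<forall>\<alpha>. a \<alpha> \<in> k"
    using F unfolding forms_def by auto
  have pow: "P (e + m) (\<lambda>x. x!i ^ m * f x)" if "i < n" "P e f" for i m e f
  proof (induction m)
    case (Suc m)
    then show ?case using coord[OF that(1) Suc] by (simp add: mult.assoc)
  qed (use that in simp)
  have mono: "P (\<Sum>i<m. \<alpha>!i) (\<lambda>x. b * (\<Prod>i<m. x!i ^ \<alpha>!i))" if "m \<le> n" "b \<in> k" for m \<alpha> b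
    using that
  proof (induction m)
    case (Suc m)
    then show ?case
      using pow[of m "\<Sum>i<m. \<alpha>!i" "\<lambda>x. b * (\<Prod>i<m. x!i ^ \<alpha>!i)" "\<alpha>!m"]
      by (simp add: mult_ac)
  qed (simp add: const)
  have *: "P d (\<lambda>x. \<Sum>\<alpha>\<in>A. a \<alpha> * (\<Prod>i<n. x!i ^ \<alpha>!i))"
    if "finite A" "A \<subseteq> {\<alpha>. length \<alpha> = n \<and> sum_list \<alpha> = d}" for A
    using that
  proof (induction A rule: finite_induct)
    case (insert \<alpha> A)
    have "P d (\<lambda>x. a \<alpha> * (\<Prod>i<n. x!i ^ \<alpha>!i))"
      using mono[of n "a \<alpha>" \<alpha>] a insert.prems by (auto simp: sum_list_sum_nth atLeast0LessThan)
    then show ?case using insert add by auto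
  qed (simp add: zero)
  show ?thesis unfolding F by (rule *) (auto simp: finite_exponents)
qed

end

text \<open>Local rings and divisors use forms with arbitrary coefficients; the base field enters
  only when the final tuples are shown to be defined over it.\<close>

interpretation U: subring_set UNIV
  by (rule subring_set_UNIV)

section \<open>Affine charts and normal forms\<close>

text \<open>Over a finite field the product of all X - a, plus 1, takes only the value 1 and would
  have no root.\<close>

lemma infinite_alg_closed: "infinite (UNIV :: 'a::alg_closed_field set)"
proof
  assume fin: "finite (UNIV :: 'a set)"
  define p :: "'a poly" where "p = (\<Prod>a\<in>UNIV. [:- a, 1:]) + 1"
  have "degree (\<Prod>a\<in>(UNIV :: 'a set). [:- a, 1:]) = card (UNIV :: 'a set)"
    by (simp add: degree_prod_eq_sum_degree)
  moreover have "card (UNIV :: 'a set) > 0"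
    using fin by (simp add: card_gt_0_iff)
  ultimately have "degree p > 0"
    unfolding p_def by (simp add: degree_add_eq_left)
  then obtain x where "poly p x = 0"
    using alg_closed_imp_poly_has_root by blast
  moreover have "(\<Prod>a\<in>UNIV. x - a) = 0"
    using fin by (simp add: prod_zero_iff)
  ultimately show False
    by (simp add: p_def poly_prod)
qed

lemma poly_eq_0_if_cofinitely_zero:
  fixes p :: "'a::alg_closed_field poly"
  assumes "finite A" "\<And>x. x \<notin> A \<Longrightarrow> poly p x = 0"
  shows "p = 0"
proof (rule ccontr)
  assume "p \<noteq> 0"
  then have "finite {x. poly p x = 0}" by (rule poly_roots_finite)
  moreover have "UNIV = A \<union> {x. poly p x = 0}" using assms(2) by auto
  ultimately show False using assms(1) infinite_alg_closed by (metis finite_UnI)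
qed

text \<open>The coordinates sit at the corners of a square in cyclic order. The corner i is
  normalized to 1, j and l are its neighbours and k is opposite. All eight symmetries of the square
  occur, so either neighbour may play the role of x.\<close>

definition charts :: "(nat \<times> nat \<times> nat \<times> nat) set" where
  "charts = {(0,1,2,3), (1,2,3,0), (2,3,0,1), (3,0,1,2), (0,3,2,1), (3,2,1,0), (2,1,0,3), (1,0,3,2)}"

locale char2_curve =
  fixes c :: "'a::alg_closed_field"
  assumes c_nz: "c \<noteq> 0" and char_two: "(1::'a) + 1 = 0"
begin

lemma add_self: "x + x = (0::'a)"
proof -
  have "x + x = (1 + 1) * x" by (simp only: distrib_right mult_1_left)
  then show ?thesis by (simp only: char_two mult_zero_left)
qed

lemma add_self_left: "x + (x + y) = (y::'a)"
  by (simp only: add_self add_0_left add.assoc[symmetric])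

lemma minus_self: "- x = (x::'a)"
  by (rule minus_unique) (rule add_self)

lemma diff_eq_add: "x - y = x + (y::'a)"
  by (simp only: diff_conv_add_uminus minus_self)

lemma two_eq_0: "(2::'a) = 0"
  using char_two by simp

lemma square_add: "(x + y)\<^sup>2 = x\<^sup>2 + y\<^sup>2" for x y :: 'a
  by (simp add: power2_sum two_eq_0)

lemma power4_add: "(1 + x) ^ 4 = 1 + x ^ 4" for x :: 'a
proof -
  have "(1 + x) ^ 4 = ((1 + x)\<^sup>2)\<^sup>2" by (simp flip: power_mult)
  then show ?thesis by (simp add: square_add flip: power_mult)
qed

lemma add_eq_0_iff_eq: "x + y = 0 \<longleftrightarrow> x = (y::'a)"
  by (metis add_eq_0_iff minus_self)

text \<open>Two of these rules remove all signs; the other two cancel equal summands as soon as AC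
  rewriting has made them adjacent. Expansion therefore decides polynomial identities in
  characteristic 2.\<close>

lemmas char2 = add_self add_self_left minus_self diff_eq_add

lemmas ring2 = char2 algebra_simps power2_eq_square power4_eq_xxxx power3_eq_cube

lemma coneD:
  assumes "v \<in> EC_cone c"
  shows "length v = 4" "nonzero v" "(v!0 + v!1 + v!2 + v!3)\<^sup>2 = c\<^sup>2 * v!0 * v!2" "v!0 * v!2 = v!1 * v!3"
  using assms c_nz by (auto simp: EC_cone_def)

lemma coneI:
  assumes "length v = 4" "nonzero v" "(v!0 + v!1 + v!2 + v!3)\<^sup>2 = c\<^sup>2 * v!0 * v!2" "v!0 * v!2 = v!1 * v!3"
  shows "v \<in> EC_cone c"
proof -
  have "c\<^sup>2 * v!0 * v!2 = c\<^sup>2 * v!1 * v!3"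
    using assms(4) by (simp only: mult.assoc)
  then show ?thesis using assms(1-3) unfolding EC_cone_def by blast
qed

lemma cone_scale:
  assumes "v \<in> EC_cone c" "s \<noteq> 0"
  shows "map ((*) s) v \<in> EC_cone c"
proof (rule coneI)
  note v = coneD[OF assms(1)]
  have nth: "map ((*) s) v ! n = s * v ! n" if "n < 4" for n using that v(1) by simp
  show "length (map ((*) s) v) = 4" using v(1) by simp
  show "nonzero (map ((*) s) v)" using v(2) assms(2) by (auto simp: nonzero_def)
  let ?v = "map ((*) s) v"
  have "(s * v!0 + s * v!1 + s * v!2 + s * v!3)\<^sup>2 = s\<^sup>2 * (v!0 + v!1 + v!2 + v!3)\<^sup>2"
    by (simp add: power2_eq_square algebra_simps)
  also have "\<dots> = c\<^sup>2 * (s * v!0) * (s * v!2)"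
    unfolding v(3) by (simp add: power2_eq_square mult_ac)
  finally show "(?v!0 + ?v!1 + ?v!2 + ?v!3)\<^sup>2 = c\<^sup>2 * ?v!0 * ?v!2"
    by (simp add: nth)
  have "(s * v!0) * (s * v!2) = s * s * (v!0 * v!2)" by (simp only: mult_ac)
  also have "\<dots> = (s * v!1) * (s * v!3)" unfolding v(4) by (simp only: mult_ac)
  finally show "?v!0 * ?v!2 = ?v!1 * ?v!3" by (simp add: nth)
qed

lemma chartD:
  assumes "(i,j,k,l) \<in> charts"
  shows "i < 4" "j < 4" "k < 4" "l < 4" "n < 4 \<Longrightarrow> n = i \<or> n = j \<or> n = k \<or> n = l"
    "i \<noteq> j" "i \<noteq> k" "i \<noteq> l" "j \<noteq> k" "j \<noteq> l" "k \<noteq> l"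
  using assms unfolding charts_def by auto

lemma chart_curve:
  assumes "(i,j,k,l) \<in> charts" "v \<in> EC_cone c"
  shows "(v!i + v!j + v!k + v!l)\<^sup>2 = c\<^sup>2 * v!i * v!k" "v!i * v!k = v!j * v!l"
proof -
  have sum: "v!i + v!j + v!k + v!l = v!0 + v!1 + v!2 + v!3"
    using assms(1) unfolding charts_def by (auto simp: add_ac)
  have prod: "v!i * v!k = v!0 * v!2 \<and> v!j * v!l = v!1 * v!3 \<or>
      v!i * v!k = v!1 * v!3 \<and> v!j * v!l = v!0 * v!2"
    using assms(1) unfolding charts_def by (auto simp: mult_ac)
  show "v!i * v!k = v!j * v!l"
    using prod coneD(4)[OF assms(2)] by metis
  have "v!i * v!k = v!0 * v!2"
    using prod coneD(4)[OF assms(2)] by metis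
  then show "(v!i + v!j + v!k + v!l)\<^sup>2 = c\<^sup>2 * v!i * v!k"
    unfolding sum coneD(3)[OF assms(2)] by (simp only: mult.assoc)
qed

definition aff :: "nat \<Rightarrow> 'a list set" where
  "aff i = {v \<in> EC_cone c. v!i = 1}"

lemma affD:
  assumes "(i,j,k,l) \<in> charts" "v \<in> aff i"
  shows "v \<in> EC_cone c" "v!i = 1" "v!k = v!j * v!l"
    "(1 + v!j)\<^sup>2 * (1 + v!l)\<^sup>2 = c\<^sup>2 * v!j * v!l"
proof -
  show 1: "v \<in> EC_cone c" "v!i = 1" using assms(2) by (auto simp: aff_def)
  show 2: "v!k = v!j * v!l" using chart_curve(2)[OF assms(1) 1(1)] 1(2) by simp
  have "(1 + v!j)\<^sup>2 * (1 + v!l)\<^sup>2 = (v!i + v!j + v!k + v!l)\<^sup>2"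
    unfolding 1 2 by (simp add: ring2)
  then show "(1 + v!j)\<^sup>2 * (1 + v!l)\<^sup>2 = c\<^sup>2 * v!j * v!l"
    using chart_curve(1)[OF assms(1) 1(1)] 1 2 by (simp add: mult_ac)
qed

lemma aff_ex:
  assumes ch: "(i,j,k,l) \<in> charts" and eq: "(1 + x)\<^sup>2 * (1 + y)\<^sup>2 = c\<^sup>2 * x * y"
  obtains v where "v \<in> aff i" "v!j = x" "v!l = y" "v!k = x * y"
proof -
  define v where "v = map (\<lambda>n. if n = i then 1 else if n = j then x else if n = l then y else x * y) [0..<4]"
  have len: "length v = 4" by (simp add: v_def)
  have v: "v!i = 1" "v!j = x" "v!l = y" "v!k = x * y"
    using chartD[OF ch] by (auto simp: v_def)
  have *: "(1 + x + x * y + y)\<^sup>2 = c\<^sup>2 * x * y"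
    unfolding eq[symmetric] by (simp add: ring2)
  have "v \<in> EC_cone c"
  proof -
    have "nonzero v"
      using v(1) len chartD(1)[OF ch] unfolding nonzero_def by (metis nth_mem zero_neq_one)
    moreover have "(v!0 + v!1 + v!2 + v!3)\<^sup>2 = c\<^sup>2 * v!0 * v!2 \<and> c\<^sup>2 * v!0 * v!2 = c\<^sup>2 * v!1 * v!3"
      using ch * v unfolding charts_def by (auto simp: add_ac mult_ac)
    ultimately show ?thesis using len unfolding EC_cone_def by blast
  qed
  then show ?thesis using v that by (simp add: aff_def)
qed

lemma aff_normalize:
  assumes "v \<in> EC_cone c" "v!i \<noteq> 0" "i < 4"
  shows "map ((*) (1 / v!i)) v \<in> aff i"
proof -
  have "map ((*) (1 / v!i)) v ! i = 1"
    using assms(2,3) coneD(1)[OF assms(1)] by simp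
  moreover have "map ((*) (1 / v!i)) v \<in> EC_cone c"
    using assms(2) by (intro cone_scale[OF assms(1)]) simp
  ultimately show ?thesis unfolding aff_def by blast
qed

section \<open>Regular functions on a chart\<close>

lemma form_scale:
  assumes "F \<in> forms UNIV 4 d" "v \<in> EC_cone c"
  shows "F (map ((*) s) v) = s ^ d * F v"
  using forms_homogeneous[OF assms(1) coneD(1)[OF assms(2)]] .

text \<open>Since X_i = 1 on \<open>aff i\<close>, forms of all degrees restrict to the coordinate
  ring of the chart; degrees need not be tracked, and values off the chart do not matter.\<close>

definition reg :: "nat \<Rightarrow> ('a list \<Rightarrow> 'a) \<Rightarrow> bool" where
  "reg i f \<longleftrightarrow> (\<exists>d. \<exists>F\<in>forms UNIV 4 d. \<forall>v\<in>aff i. f v = F v)"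

lemma regI: "F \<in> forms UNIV 4 d \<Longrightarrow> (\<And>v. v \<in> aff i \<Longrightarrow> f v = F v) \<Longrightarrow> reg i f"
  unfolding reg_def by blast

lemma reg_form: "F \<in> forms UNIV 4 d \<Longrightarrow> reg i F"
  by (rule regI) simp_all

lemma reg_const: "reg i (\<lambda>_. a)"
  by (rule reg_form[OF U.forms_const[OF UNIV_I]])

lemma reg_coord: "n < 4 \<Longrightarrow> reg i (\<lambda>v. v!n)"
  by (rule reg_form[OF U.forms_coord])

lemma reg_add:
  assumes "reg i f" "reg i g" "i < 4"
  shows "reg i (\<lambda>v. f v + g v)"
proof -
  obtain d F where F: "F \<in> forms UNIV 4 d" "\<forall>v\<in>aff i. f v = F v"
    using assms(1) unfolding reg_def by blast
  obtain e G where G: "G \<in> forms UNIV 4 e" "\<forall>v\<in>aff i. g v = G v"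
    using assms(2) unfolding reg_def by blast
  \<comment> \<open>Powers of X_i are 1 on the chart and bring both forms to a common
    degree.\<close>
  have p: "(\<lambda>v. v!i ^ m) \<in> forms UNIV 4 m" for m
    using U.forms_power[OF U.forms_coord[OF assms(3)], of m] by simp
  have 1: "(\<lambda>v. v!i ^ e * F v) \<in> forms UNIV 4 (e + d)"
    by (rule U.forms_mult[OF p F(1)])
  have 2: "(\<lambda>v. v!i ^ d * G v) \<in> forms UNIV 4 (e + d)"
    using U.forms_mult[OF p G(1), of d] by (simp only: add.commute)
  show ?thesis
    by (rule regI[OF U.forms_add[OF 1 2]]) (simp add: F(2) G(2), simp add: aff_def)
qed

lemma reg_mult:
  assumes "reg i f" "reg i g"
  shows "reg i (\<lambda>v. f v * g v)"
proof -
  obtain d F where F: "F \<in> forms UNIV 4 d" "\<forall>v\<in>aff i. f v = F v"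
    using assms(1) unfolding reg_def by blast
  obtain e G where G: "G \<in> forms UNIV 4 e" "\<forall>v\<in>aff i. g v = G v"
    using assms(2) unfolding reg_def by blast
  show ?thesis
    by (rule regI[OF U.forms_mult[OF F(1) G(1)]]) (simp add: F(2) G(2))
qed

lemma reg_power:
  assumes "reg i f"
  shows "reg i (\<lambda>v. f v ^ n)"
proof (induction n)
  case (Suc n)
  show ?case using reg_mult[OF assms Suc] by simp
qed (simp add: reg_const)

lemma reg_poly:
  assumes "reg i f" "i < 4"
  shows "reg i (\<lambda>v. poly p (f v))"
proof (induction p)
  case (pCons a p)
  show ?case
    using reg_add[OF reg_const[of i a] reg_mult[OF assms(1) pCons.IH] assms(2)] by simp
qed (simp add: reg_const)

text \<open>In a chart write \<open>x = v!j\<close>, \<open>y = v!l\<close>. The function \<open>w = (1 + x)\<^sup>2 * y\<close> is integral over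
  the polynomials in \<open>x\<close>, with conjugate \<open>w + c\<^sup>2 * x\<close> (its value at the inverse point).\<close>

lemma aff_w:
  assumes "(i,j,k,l) \<in> charts" "v \<in> aff i"
  shows "((1 + v!j)\<^sup>2 * v!l)\<^sup>2 = c\<^sup>2 * v!j * ((1 + v!j)\<^sup>2 * v!l) + (1 + v!j) ^ 4"
proof -
  have "((1 + v!j)\<^sup>2 * v!l)\<^sup>2 = (1 + v!j)\<^sup>2 * ((1 + v!j)\<^sup>2 * (1 + v!l)\<^sup>2) + (1 + v!j) ^ 4"
    by (simp add: ring2)
  then show ?thesis unfolding affD(4)[OF assms] by (simp add: algebra_simps)
qed

text \<open>The denominator comes from y = w / (1 + x)^2. Multiplication by y costs two powers of 1
  + x and turns (a, b) into (b (1 + x)^4, a + c^2 x b), by the quadratic equation of w.\<close>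

lemma normal_form:
  assumes ch: "(i,j,k,l) \<in> charts" and F: "F \<in> forms UNIV 4 d"
  shows "\<exists>n a b. \<forall>v\<in>aff i. (1 + v!j) ^ n * F v = poly a (v!j) + poly b (v!j) * ((1 + v!j)\<^sup>2 * v!l)"
  using F
proof (induction rule: U.forms_induct)
  case (const a)
  show ?case by (rule exI[of _ 0], rule exI[of _ "[:a:]"], rule exI[of _ 0]) simp
next
  case (zero d)
  show ?case by (rule exI[of _ 0], rule exI[of _ 0], rule exI[of _ 0]) simp
next
  case (add d f g)
  then obtain n a b m a' b' where
    1: "\<And>v. v \<in> aff i \<Longrightarrow> (1 + v!j) ^ n * f v = poly a (v!j) + poly b (v!j) * ((1 + v!j)\<^sup>2 * v!l)" and
    2: "\<And>v. v \<in> aff i \<Longrightarrow> (1 + v!j) ^ m * g v = poly a' (v!j) + poly b' (v!j) * ((1 + v!j)\<^sup>2 * v!l)"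
    by blast
  have "(1 + v!j) ^ (n + m) * (f v + g v) =
      poly ([:1,1:]^m * a + [:1,1:]^n * a') (v!j) +
      poly ([:1,1:]^m * b + [:1,1:]^n * b') (v!j) * ((1 + v!j)\<^sup>2 * v!l)" if v: "v \<in> aff i" for v
  proof -
    have "(1 + v!j) ^ (n + m) * (f v + g v) =
      (1 + v!j) ^ m * ((1 + v!j) ^ n * f v) + (1 + v!j) ^ n * ((1 + v!j) ^ m * g v)"
      by (simp add: algebra_simps power_add)
    then show ?thesis unfolding 1[OF v] 2[OF v] by (simp add: algebra_simps)
  qed
  then show ?case by blast
next
  case (coord d f n)
  then obtain m a b where
    1: "\<And>v. v \<in> aff i \<Longrightarrow> (1 + v!j) ^ m * f v = poly a (v!j) + poly b (v!j) * ((1 + v!j)\<^sup>2 * v!l)"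
    by blast
  have l: "(1 + v!j) ^ (m + 2) * (v!l * f v) = poly (b * [:1,1:]^4) (v!j) +
      poly (a + [:0,c\<^sup>2:] * b) (v!j) * ((1 + v!j)\<^sup>2 * v!l)" if v: "v \<in> aff i" for v
  proof -
    have "(1 + v!j) ^ (m + 2) * (v!l * f v) = ((1 + v!j)\<^sup>2 * v!l) * ((1 + v!j) ^ m * f v)"
      by (simp only: power_add mult_ac)
    also have "\<dots> = poly a (v!j) * ((1 + v!j)\<^sup>2 * v!l) + poly b (v!j) * ((1 + v!j)\<^sup>2 * v!l)\<^sup>2"
      unfolding 1[OF v] by (simp add: algebra_simps power2_eq_square)
    finally have "(1 + v!j) ^ (m + 2) * (v!l * f v) = poly b (v!j) * (1 + v!j) ^ 4 +
        (poly a (v!j) + c\<^sup>2 * v!j * poly b (v!j)) * ((1 + v!j)\<^sup>2 * v!l)"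
      unfolding aff_w[OF ch v] by (simp only: distrib_left distrib_right mult.assoc mult.left_commute add_ac)
    then show ?thesis by (simp add: mult_ac)
  qed
  have j: "(1 + v!j) ^ m * (v!j * f v) = poly ([:0,1:] * a) (v!j) +
      poly ([:0,1:] * b) (v!j) * ((1 + v!j)\<^sup>2 * v!l)" if v: "v \<in> aff i" for v
  proof -
    have "(1 + v!j) ^ m * (v!j * f v) = v!j * ((1 + v!j) ^ m * f v)" by (simp only: mult_ac)
    then show ?thesis unfolding 1[OF v] by (simp add: distrib_left mult_ac)
  qed
  have k: "(1 + v!j) ^ (m + 2) * (v!k * f v) = poly ([:0,1:] * (b * [:1,1:]^4)) (v!j) +
      poly ([:0,1:] * (a + [:0,c\<^sup>2:] * b)) (v!j) * ((1 + v!j)\<^sup>2 * v!l)" if v: "v \<in> aff i" for v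
  proof -
    have "(1 + v!j) ^ (m + 2) * (v!k * f v) = v!j * ((1 + v!j) ^ (m + 2) * (v!l * f v))"
      unfolding affD(3)[OF ch v] by (simp add: mult_ac)
    then show ?thesis unfolding l[OF v] by (simp add: algebra_simps)
  qed
  have i: "(1 + v!j) ^ m * (v!i * f v) = poly a (v!j) + poly b (v!j) * ((1 + v!j)\<^sup>2 * v!l)"
    if v: "v \<in> aff i" for v
    using 1[OF v] affD(2)[OF ch v] by simp
  show ?case using chartD(5)[OF ch coord.hyps] i j k l by blast
qed

text \<open>The norm of a + b w: the two conjugates of w have sum c^2 x and product (1 +
  x)^4.\<close>

definition norm_poly :: "'a poly \<Rightarrow> 'a poly \<Rightarrow> 'a poly" where
  "norm_poly a b = a\<^sup>2 + a * b * [:0, c\<^sup>2:] + b\<^sup>2 * [:1,1:] ^ 4"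

lemma poly_norm_poly: "poly (norm_poly a b) x = (poly a x)\<^sup>2 + c\<^sup>2 * x * poly a x * poly b x + (poly b x)\<^sup>2 * (1 + x) ^ 4"
  by (simp add: norm_poly_def algebra_simps)

lemma norm_poly_eq:
  assumes "(i,j,k,l) \<in> charts" "v \<in> aff i"
  defines "w \<equiv> (1 + v!j)\<^sup>2 * v!l"
  shows "poly (norm_poly a b) (v!j) =
    (poly a (v!j) + poly b (v!j) * w) * (poly a (v!j) + poly b (v!j) * (w + c\<^sup>2 * v!j))"
proof -
  have "(poly a (v!j) + poly b (v!j) * w) * (poly a (v!j) + poly b (v!j) * (w + c\<^sup>2 * v!j)) =
    (poly a (v!j))\<^sup>2 + c\<^sup>2 * v!j * poly a (v!j) * poly b (v!j) + (poly b (v!j))\<^sup>2 * (w\<^sup>2 + c\<^sup>2 * v!j * w)"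
    by (simp add: ring2)
  also have "w\<^sup>2 + c\<^sup>2 * v!j * w = (1 + v!j) ^ 4"
    unfolding aff_w[OF assms(1,2), folded w_def] by (simp add: ring2)
  finally show ?thesis by (simp add: poly_norm_poly)
qed

text \<open>Descent at x = 0: the value at 0 and the linear coefficient force the constant terms of
  a and b to vanish, and then the norm is x^2 times the norm of the pair (a / x, b / x).\<close>

lemma norm_poly_eq_0:
  assumes "norm_poly a b = 0"
  shows "a = 0 \<and> b = 0"
  using assms
proof (induction "degree a + degree b" arbitrary: a b rule: less_induct)
  case less
  obtain e a' where a: "a = pCons e a'" by (cases a)
  obtain e' b' where b: "b = pCons e' b'" by (cases b)
  have N: "(poly a x)\<^sup>2 + c\<^sup>2 * x * poly a x * poly b x + (poly b x)\<^sup>2 * (1 + x) ^ 4 = 0" for x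
    using less.prems by (simp flip: poly_norm_poly)
  have "(e + e')\<^sup>2 = 0" using N[of 0] by (simp add: a b square_add)
  then have e': "e' = e" by (simp add: add_eq_0_iff_eq)
  \<comment> \<open>\<open>M\<close> is the norm divided by x. In characteristic 2 squares have no
    linear term, so only c^2 a b survives at x = 0.\<close>
  define M where "M = [:c\<^sup>2:] * a * b + [:0,1:] * (a'\<^sup>2 + b'\<^sup>2 * ([:1,1:] ^ 4) + [:0,0,e\<^sup>2:])"
  have "M = 0"
  proof (rule poly_eq_0_if_cofinitely_zero[of "{0}"])
    fix x :: 'a assume x: "x \<notin> {0}"
    have "x * poly M x = (poly a x)\<^sup>2 + c\<^sup>2 * x * poly a x * poly b x + (poly b x)\<^sup>2 * (1 + x) ^ 4"
      by (simp add: M_def a b e' power4_add square_add power_mult_distrib) (simp add: ring2)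
    then show "poly M x = 0" using N x by simp
  qed simp
  then have "poly M 0 = 0" by simp
  then have e: "e = 0" using c_nz by (simp add: M_def a b e')
  have "norm_poly a' b' = 0"
  proof (rule poly_eq_0_if_cofinitely_zero[of "{0}"])
    fix x :: 'a assume x: "x \<notin> {0}"
    have "x\<^sup>2 * poly (norm_poly a' b') x = (poly a x)\<^sup>2 + c\<^sup>2 * x * poly a x * poly b x + (poly b x)\<^sup>2 * (1 + x) ^ 4"
      by (simp add: poly_norm_poly a b e e' power4_add square_add power_mult_distrib) (simp add: ring2)
    then show "poly (norm_poly a' b') x = 0" using N x by simp
  qed simp
  moreover have "degree a' + degree b' < degree a + degree b" if "a \<noteq> 0 \<or> b \<noteq> 0"
    using that by (auto simp: a b e e' degree_pCons_eq_if)
  ultimately have "a' = 0 \<and> b' = 0" if "a \<noteq> 0 \<or> b \<noteq> 0" using less.hyps that by blast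
  then show ?case by (auto simp: a b e e')
qed

end

section \<open>Irreducibility and local divisibility\<close>

context char2_curve
begin

text \<open>Generic points can be normalized in every chart, and x is neither 0 nor 1 there, so that
  the denominator 1 + x of the normal form is invertible.\<close>

definition generic :: "'a list \<Rightarrow> bool" where
  "generic v \<longleftrightarrow> v!0 \<noteq> 0 \<and> v!1 \<noteq> 0 \<and> v!2 \<noteq> 0 \<and> v!3 \<noteq> 0"

lemma generic_chart:
  assumes "(i,j,k,l) \<in> charts"
  shows "generic v \<longleftrightarrow> v!i \<noteq> 0 \<and> v!j \<noteq> 0 \<and> v!k \<noteq> 0 \<and> v!l \<noteq> 0"
  using assms unfolding charts_def generic_def by auto

text \<open>Dividing the curve equation by y gives (1 + x)^2 (y + 1/y) = c^2 x, which is invariant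
  under inversion and relates the two values of w.\<close>

lemma aff_conj:
  assumes ch: "(i,j,k,l) \<in> charts" and v: "v \<in> aff i" and nz: "v!l \<noteq> 0"
  obtains v' where "v' \<in> aff i" "v'!j = v!j" "v'!l = 1 / v!l"
    "(1 + v!j)\<^sup>2 * v'!l = (1 + v!j)\<^sup>2 * v!l + c\<^sup>2 * v!j"
proof -
  define y where "y = v!l"
  define x where "x = v!j"
  have y: "y \<noteq> 0" using nz by (simp add: y_def)
  have eq: "(1 + x)\<^sup>2 * (1 + y)\<^sup>2 = c\<^sup>2 * x * y"
    using affD(4)[OF ch v] by (simp add: x_def y_def)
  have y1: "(1 + 1 / y)\<^sup>2 = (1 + y)\<^sup>2 / y\<^sup>2"
    using y by (simp add: field_simps)
  have "(1 + x)\<^sup>2 * (1 + 1 / y)\<^sup>2 = c\<^sup>2 * x * y / y\<^sup>2"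
    unfolding y1 eq[symmetric] by simp
  also have "\<dots> = c\<^sup>2 * x * (1 / y)"
    using y by (simp add: power2_eq_square)
  finally obtain v' where v': "v' \<in> aff i" "v'!j = x" "v'!l = 1 / y"
    using aff_ex[OF ch] by metis
  have "y * ((1 + x)\<^sup>2 * (1 / y)) = y * ((1 + x)\<^sup>2 * y + c\<^sup>2 * x)"
  proof -
    have "y * ((1 + x)\<^sup>2 * y + c\<^sup>2 * x) = (1 + x)\<^sup>2 * y\<^sup>2 + (1 + x)\<^sup>2 * (1 + y)\<^sup>2"
      unfolding eq by (simp add: algebra_simps power2_eq_square)
    also have "\<dots> = (1 + x)\<^sup>2" by (simp add: ring2)
    finally show ?thesis using y by simp
  qed
  then have "(1 + x)\<^sup>2 * (1 / y) = (1 + x)\<^sup>2 * y + c\<^sup>2 * x"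
    using y mult_left_cancel by blast
  then show ?thesis using that v' by (simp add: x_def y_def)
qed

lemma aff_generic_ex:
  assumes ch: "(i,j,k,l) \<in> charts" and x: "x \<noteq> 0" "x \<noteq> 1"
  obtains v where "v \<in> aff i" "v!j = x" "generic v"
proof -
  have x1: "(1 + x)\<^sup>2 \<noteq> 0" using x(2) by (simp add: add_eq_0_iff_eq)
  define p where "p = [:(1 + x)\<^sup>2, c\<^sup>2 * x, (1 + x)\<^sup>2:]"
  have "degree p > 0" using x1 by (simp add: p_def)
  then obtain y where y: "poly p y = 0" using alg_closed_imp_poly_has_root by blast
  then have y0: "y \<noteq> 0" using x1 by (auto simp: p_def)
  have "(1 + x)\<^sup>2 * (1 + y)\<^sup>2 = c\<^sup>2 * x * y + poly p y"
    by (simp add: p_def ring2)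
  then obtain v where v: "v \<in> aff i" "v!j = x" "v!l = y" "v!k = x * y"
    using y aff_ex[OF ch, of x y] by auto
  then have "generic v"
    unfolding generic_chart[OF ch] using x y0 affD(2)[OF ch v(1)] by simp
  then show ?thesis using that v by blast
qed

lemma generic_aff_neq_1:
  assumes ch: "(i,j,k,l) \<in> charts" and v: "v \<in> aff i" and "generic v"
  shows "v!j \<noteq> 1"
proof
  assume "v!j = 1"
  then have "c\<^sup>2 * v!l = 0" using affD(4)[OF ch v] by (simp add: add_self)
  then show False using assms(3) c_nz unfolding generic_chart[OF ch] by simp
qed

lemma generic_scale:
  assumes "v \<in> EC_cone c" "generic v" "s \<noteq> 0"
  shows "generic (map ((*) s) v)"
  using assms coneD(1)[OF assms(1)] by (simp add: generic_def)

text \<open>The norm \<open>N(x)\<close> is a polynomial in \<open>x\<close> with infinitely many zeros if \<open>F\<close> vanishes at one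
  point over almost every \<open>x\<close>; hence it is zero and so is the normal form of \<open>F\<close>.\<close>

lemma form_zero_if_generic_zero:
  assumes F: "F \<in> forms UNIV 4 d" and zero: "\<And>v. v \<in> EC_cone c \<Longrightarrow> generic v \<Longrightarrow> F v = 0"
    and z: "z \<in> EC_cone c"
  shows "F z = 0"
proof (cases "generic z")
  case False
  have "z!0 \<noteq> 0 \<or> z!1 \<noteq> 0 \<or> z!2 \<noteq> 0 \<or> z!3 \<noteq> 0"
  proof -
    obtain n where "n < 4" "z!n \<noteq> 0"
      using coneD(1,2)[OF z] unfolding nonzero_def by (auto simp: in_set_conv_nth)
    then show ?thesis by (auto simp: less_Suc_eq numeral_eq_Suc)
  qed
  \<comment> \<open>Going around the square, a zero coordinate must be adjacent to a nonzero one. In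
    such a chart x = 0 at z, so the denominator (1 + x)^n of the normal form is 1 there.\<close>
  with False have "\<exists>(i,j,k,l)\<in>charts. z!i \<noteq> 0 \<and> z!j = 0"
    unfolding generic_def charts_def by auto
  then obtain i j k l where ch: "(i,j,k,l) \<in> charts" and ij: "z!i \<noteq> 0" "z!j = 0"
    by blast
  obtain n a b where
    nf: "\<And>v. v \<in> aff i \<Longrightarrow> (1 + v!j) ^ n * F v = poly a (v!j) + poly b (v!j) * ((1 + v!j)\<^sup>2 * v!l)"
    using normal_form[OF ch F] by blast
  have "norm_poly a b = 0"
  proof (rule poly_eq_0_if_cofinitely_zero[of "{0, 1}"])
    fix x :: 'a assume "x \<notin> {0, 1}"
    then obtain v where v: "v \<in> aff i" "v!j = x" "generic v"
      using aff_generic_ex[OF ch, of x] by auto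
    have "F v = 0" using zero v affD(1)[OF ch v(1)] by blast
    then have "poly a (v!j) + poly b (v!j) * ((1 + v!j)\<^sup>2 * v!l) = 0"
      using nf[OF v(1)] by simp
    then have "poly (norm_poly a b) (v!j) = 0"
      unfolding norm_poly_eq[OF ch v(1)] by simp
    then show "poly (norm_poly a b) x = 0" using v(2) by simp
  qed simp
  then have ab: "a = 0" "b = 0" using norm_poly_eq_0 by blast+
  let ?z = "map ((*) (1 / z!i)) z"
  have z': "?z \<in> aff i" using aff_normalize[OF z ij(1) chartD(1)[OF ch]] .
  have "?z!j = 0" using ij(2) chartD(2)[OF ch] coneD(1)[OF z] by simp
  then have "F ?z = 0" using nf[OF z'] ab by simp
  then show ?thesis
    using form_scale[OF F z, of "1 / z!i"] ij(1) by simp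
qed (use zero z in blast)

lemma form_domain:
  assumes F: "F \<in> forms UNIV 4 d" and G: "G \<in> forms UNIV 4 e"
    and zero: "\<And>v. v \<in> EC_cone c \<Longrightarrow> generic v \<Longrightarrow> F v * G v = 0"
  shows "(\<forall>v\<in>EC_cone c. F v = 0) \<or> (\<forall>v\<in>EC_cone c. G v = 0)"
proof -
  have ch: "(0,1,2,3) \<in> charts" by (simp add: charts_def)
  obtain n a b where
    nf: "\<And>v. v \<in> aff 0 \<Longrightarrow> (1 + v!1) ^ n * F v = poly a (v!1) + poly b (v!1) * ((1 + v!1)\<^sup>2 * v!3)"
    using normal_form[OF ch F] by blast
  obtain n' a' b' where
    nf': "\<And>v. v \<in> aff 0 \<Longrightarrow> (1 + v!1) ^ n' * G v = poly a' (v!1) + poly b' (v!1) * ((1 + v!1)\<^sup>2 * v!3)"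
    using normal_form[OF ch G] by blast
  have "norm_poly a b * norm_poly a' b' = 0"
  proof (rule poly_eq_0_if_cofinitely_zero[of "{0, 1}"])
    fix x :: 'a assume "x \<notin> {0, 1}"
    then obtain v where v: "v \<in> aff 0" "v!1 = x" "generic v"
      using aff_generic_ex[OF ch, of x] by auto
    have "F v = 0 \<or> G v = 0" using zero v affD(1)[OF ch v(1)] by fastforce
    then have "poly a (v!1) + poly b (v!1) * ((1 + v!1)\<^sup>2 * v!3) = 0 \<or>
        poly a' (v!1) + poly b' (v!1) * ((1 + v!1)\<^sup>2 * v!3) = 0"
      using nf[OF v(1)] nf'[OF v(1)] by auto
    then have "poly (norm_poly a b) (v!1) = 0 \<or> poly (norm_poly a' b') (v!1) = 0"
      unfolding norm_poly_eq[OF ch v(1)] by auto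
    then show "poly (norm_poly a b * norm_poly a' b') x = 0" using v(2) by auto
  qed simp
  then have "norm_poly a b = 0 \<or> norm_poly a' b' = 0" by (simp only: mult_eq_0_iff)
  then have ab: "a = 0 \<and> b = 0 \<or> a' = 0 \<and> b' = 0"
    using norm_poly_eq_0[of a b] norm_poly_eq_0[of a' b'] by blast
  \<comment> \<open>A form with zero normal form vanishes at generic points, because 1 + x is
    nonzero there, and hence on the whole curve.\<close>
  have *: "\<forall>v\<in>EC_cone c. H v = 0"
    if H: "H \<in> forms UNIV 4 m" and nf: "\<And>v. v \<in> aff 0 \<Longrightarrow> (1 + v!1) ^ n * H v = 0" for H m n
  proof
    fix z assume "z \<in> EC_cone c"
    then show "H z = 0"
    proof (rule form_zero_if_generic_zero[OF H, rotated])
      fix v assume v: "v \<in> EC_cone c" "generic v"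
      let ?v = "map ((*) (1 / v!0)) v"
      have v0: "v!0 \<noteq> 0" using v(2) by (simp add: generic_def)
      have v': "?v \<in> aff 0" using aff_normalize[OF v(1) v0] by simp
      have "generic ?v" using generic_scale[OF v] v0 by simp
      then have "?v!1 \<noteq> 1" using generic_aff_neq_1[OF ch v'] by blast
      then have "1 + ?v!1 \<noteq> 0" by (metis add_eq_0_iff_eq)
      then have "H ?v = 0" using nf[OF v'] by (metis mult_eq_0_iff power_not_zero)
      then show "H v = 0" using form_scale[OF H v(1), of "1 / v!0"] v0 by simp
    qed
  qed
  show ?thesis
    using ab
  proof
    assume "a = 0 \<and> b = 0"
    then show ?thesis using *[OF F, of n] nf by simp
  next
    assume "a' = 0 \<and> b' = 0"
    then show ?thesis using *[OF G, of n'] nf' by simp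
  qed
qed

lemma reg_domain:
  assumes "i < 4" "reg i f" "reg i g" and zero: "\<And>v. v \<in> aff i \<Longrightarrow> generic v \<Longrightarrow> f v * g v = 0"
  shows "(\<forall>v\<in>aff i. f v = 0) \<or> (\<forall>v\<in>aff i. g v = 0)"
proof -
  obtain d F where F: "F \<in> forms UNIV 4 d" "\<forall>v\<in>aff i. f v = F v"
    using assms(2) unfolding reg_def by blast
  obtain e G where G: "G \<in> forms UNIV 4 e" "\<forall>v\<in>aff i. g v = G v"
    using assms(3) unfolding reg_def by blast
  have "(\<forall>v\<in>EC_cone c. F v = 0) \<or> (\<forall>v\<in>EC_cone c. G v = 0)"
  proof (rule form_domain[OF F(1) G(1)])
    fix v assume v: "v \<in> EC_cone c" "generic v"
    let ?s = "1 / v!i"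
    have "v!0 \<noteq> 0" "v!1 \<noteq> 0" "v!2 \<noteq> 0" "v!3 \<noteq> 0" using v(2) by (auto simp: generic_def)
    then have vi: "v!i \<noteq> 0" using assms(1) by (auto simp: less_Suc_eq numeral_eq_Suc)
    have v': "map ((*) ?s) v \<in> aff i" using aff_normalize[OF v(1) vi assms(1)] .
    have "generic (map ((*) ?s) v)" using generic_scale[OF v] vi by simp
    then have "F (map ((*) ?s) v) * G (map ((*) ?s) v) = 0"
      using zero[OF v'] F(2) G(2) v' by simp
    then show "F v * G v = 0"
      unfolding form_scale[OF F(1) v(1)] form_scale[OF G(1) v(1)] using vi by simp
  qed
  then show ?thesis using F(2) G(2) by (auto simp: aff_def)
qed

lemma reg_eqI:
  assumes "i < 4" "reg i f" "reg i g" and "\<And>v. v \<in> aff i \<Longrightarrow> generic v \<Longrightarrow> f v = g v" and v: "v \<in> aff i"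
  shows "f v = g v"
proof -
  have "(\<forall>v\<in>aff i. f v + g v = 0) \<or> (\<forall>v\<in>aff i. (1::'a) = 0)"
    by (rule reg_domain[OF assms(1) reg_add[OF assms(2,3,1)] reg_const]) (simp add: assms(4) add_self)
  then show ?thesis using v by (auto simp: add_eq_0_iff_eq)
qed

lemma reg_cancel:
  assumes "i < 4" "reg i h" "reg i f" "reg i g" "u \<in> aff i" "h u \<noteq> 0"
    and "\<And>v. v \<in> aff i \<Longrightarrow> generic v \<Longrightarrow> h v * f v = h v * g v" and v: "v \<in> aff i"
  shows "f v = g v"
proof -
  have "(\<forall>v\<in>aff i. h v = 0) \<or> (\<forall>v\<in>aff i. f v + g v = 0)"
  proof (rule reg_domain[OF assms(1,2) reg_add[OF assms(3,4,1)]])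
    fix v assume "v \<in> aff i" "generic v"
    then show "h v * (f v + g v) = 0"
      using assms(7)[of v] by (simp only: distrib_left add_self)
  qed
  then show ?thesis using v assms(5,6) by (auto simp: add_eq_0_iff_eq)
qed

section \<open>Divisibility in the local ring, read in a chart\<close>

definition ldvd :: "nat \<Rightarrow> 'a list \<Rightarrow> ('a list \<Rightarrow> 'a) \<Rightarrow> ('a list \<Rightarrow> 'a) \<Rightarrow> bool" where
  "ldvd i z f g \<longleftrightarrow> (\<exists>A B. reg i A \<and> reg i B \<and> B z \<noteq> 0 \<and> (\<forall>v\<in>aff i. B v * g v = A v * f v))"

lemma ldvdI:
  assumes "reg i A" "reg i B" "B z \<noteq> 0" "\<And>v. v \<in> aff i \<Longrightarrow> B v * g v = A v * f v"
  shows "ldvd i z f g"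
  using assms unfolding ldvd_def by blast

lemma ldvd_refl: "ldvd i z f f"
  by (rule ldvdI[OF reg_const[of _ 1] reg_const[of _ 1]]) simp_all

lemma ldvd_trans:
  assumes "ldvd i z f g" "ldvd i z g h"
  shows "ldvd i z f h"
proof -
  obtain A B where 1: "reg i A" "reg i B" "B z \<noteq> 0" "\<And>v. v \<in> aff i \<Longrightarrow> B v * g v = A v * f v"
    using assms(1) unfolding ldvd_def by blast
  obtain A' B' where 2: "reg i A'" "reg i B'" "B' z \<noteq> 0" "\<And>v. v \<in> aff i \<Longrightarrow> B' v * h v = A' v * g v"
    using assms(2) unfolding ldvd_def by blast
  show ?thesis
  proof (rule ldvdI[OF reg_mult[OF 2(1) 1(1)] reg_mult[OF 1(2) 2(2)]])
    fix v assume v: "v \<in> aff i"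
    have "B v * B' v * h v = A' v * (B v * g v)"
      using 2(4)[OF v] by (simp only: mult.assoc mult.left_commute)
    then show "B v * B' v * h v = A' v * A v * f v"
      using 1(4)[OF v] by (simp only: mult.assoc)
  qed (use 1(3) 2(3) in simp)
qed

lemma ldvd_mult:
  assumes "ldvd i z f g" "ldvd i z f' g'"
  shows "ldvd i z (\<lambda>v. f v * f' v) (\<lambda>v. g v * g' v)"
proof -
  obtain A B where 1: "reg i A" "reg i B" "B z \<noteq> 0" "\<And>v. v \<in> aff i \<Longrightarrow> B v * g v = A v * f v"
    using assms(1) unfolding ldvd_def by blast
  obtain A' B' where 2: "reg i A'" "reg i B'" "B' z \<noteq> 0" "\<And>v. v \<in> aff i \<Longrightarrow> B' v * g' v = A' v * f' v"
    using assms(2) unfolding ldvd_def by blast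
  show ?thesis
  proof (rule ldvdI[OF reg_mult[OF 1(1) 2(1)] reg_mult[OF 1(2) 2(2)]])
    fix v assume v: "v \<in> aff i"
    have "B v * B' v * (g v * g' v) = (B v * g v) * (B' v * g' v)" by (simp only: mult_ac)
    then show "B v * B' v * (g v * g' v) = A v * A' v * (f v * f' v)"
      unfolding 1(4)[OF v] 2(4)[OF v] by (simp only: mult_ac)
  qed (use 1(3) 2(3) in simp)
qed

lemma pt_self: "x \<in> pt x"
  unfolding pt_def by (auto intro!: exI[of _ 1] map_idI[symmetric])

lemma ptE:
  assumes "y \<in> pt x"
  obtains s where "s \<noteq> 0" "y = map ((*) s) x"
  using assms unfolding pt_def by auto

lemma form_pt_zero_iff:
  assumes "F \<in> forms UNIV 4 d" "z \<in> EC_cone c" "x \<in> pt z"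
  shows "F x = 0 \<longleftrightarrow> F z = 0"
  using assms(3) by (rule ptE) (simp add: form_scale[OF assms(1,2)])

lemma loc_dvdI:
  assumes "A \<in> forms UNIV 4 d" "B \<in> forms UNIV 4 e" "\<forall>x\<in>Z. B x \<noteq> 0"
    "\<forall>v\<in>EC_cone c. B v * G v = A v * F v"
  shows "loc_dvd c Z F G"
  using assms unfolding loc_dvd_def by blast

lemma loc_dvd_iff_ldvd:
  assumes F: "F \<in> forms UNIV 4 d" and G: "G \<in> forms UNIV 4 e" and z: "z \<in> aff i" and i: "i < 4"
  shows "loc_dvd c (pt z) F G \<longleftrightarrow> ldvd i z F G"
proof
  assume "loc_dvd c (pt z) F G"
  then obtain m n A B where A: "A \<in> forms UNIV 4 m" and B: "B \<in> forms UNIV 4 n"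
    and "\<forall>x\<in>pt z. B x \<noteq> 0" and eq: "\<forall>y\<in>EC_cone c. B y * G y = A y * F y"
    unfolding loc_dvd_def by blast
  then have "B z \<noteq> 0" using pt_self by blast
  then show "ldvd i z F G"
    by (rule ldvdI[OF reg_form[OF A] reg_form[OF B]]) (use eq in \<open>auto simp: aff_def\<close>)
next
  assume "ldvd i z F G"
  then obtain a b where ab: "reg i a" "reg i b" "b z \<noteq> 0" "\<forall>v\<in>aff i. b v * G v = a v * F v"
    unfolding ldvd_def by blast
  obtain m A where A: "A \<in> forms UNIV 4 m" "\<forall>v\<in>aff i. a v = A v"
    using ab(1) unfolding reg_def by blast
  obtain n B where B: "B \<in> forms UNIV 4 n" "\<forall>v\<in>aff i. b v = B v"
    using ab(2) unfolding reg_def by blast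
  have zc: "z \<in> EC_cone c" "z!i = 1" using z by (auto simp: aff_def)
  have p: "(\<lambda>v. v!i ^ r) \<in> forms UNIV 4 r" for r
    using U.forms_power[OF U.forms_coord[OF i], of r] by simp
  \<comment> \<open>The exponents of X_i give both sides of the homogenized identity the same
    degree. The extra 1 makes both sides vanish on X_i = 0, where the chart gives no
    information.\<close>
  have A': "(\<lambda>v. v!i ^ (n + e + 1) * A v) \<in> forms UNIV 4 (n + e + 1 + m)"
    by (rule U.forms_mult[OF p A(1)])
  have B': "(\<lambda>v. v!i ^ (m + d + 1) * B v) \<in> forms UNIV 4 (m + d + 1 + n)"
    by (rule U.forms_mult[OF p B(1)])
  have nz: "\<forall>x\<in>pt z. x!i ^ (m + d + 1) * B x \<noteq> 0"
    using form_pt_zero_iff[OF B' zc(1)] ab(3) B(2) z zc(2) by auto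
  have "v!i ^ (m + d + 1) * B v * G v = v!i ^ (n + e + 1) * A v * F v" if v: "v \<in> EC_cone c" for v
  proof (cases "v!i = 0")
    case False
    let ?s = "v!i" and ?u = "map ((*) (1 / v!i)) v"
    have u: "?u \<in> aff i" using aff_normalize[OF v False i] .
    then have uc: "?u \<in> EC_cone c" by (simp add: aff_def)
    have v_eq: "v = map ((*) ?s) ?u" using False by (simp add: o_def)
    have eq: "B ?u * G ?u = A ?u * F ?u" using ab(4) A(2) B(2) u by metis
    have sc: "H v = ?s ^ r * H ?u" if "H \<in> forms UNIV 4 r" for H r
      by (subst v_eq, rule form_scale[OF that uc])
    have "?s ^ (m + d + 1) * B v * G v = ?s ^ (m + d + 1 + n + e) * (B ?u * G ?u)"
      unfolding sc[OF B(1)] sc[OF G] power_add by (simp only: mult_ac)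
    also have "\<dots> = ?s ^ (n + e + 1 + m + d) * (A ?u * F ?u)"
      unfolding eq by (simp only: add_ac)
    also have "\<dots> = ?s ^ (n + e + 1) * A v * F v"
      unfolding sc[OF A(1)] sc[OF F] power_add by (simp only: mult_ac)
    finally show ?thesis .
  qed simp
  then show "loc_dvd c (pt z) F G"
    by (intro loc_dvdI[OF A' B' nz] ballI)
qed

end

section \<open>Orders of vanishing\<close>

text \<open>The condition x(z) not 0 makes x - x(z) a uniformizer, since the y-derivative of the
  curve equation is c^2 x in characteristic 2. By \<open>chart_point_ex\<close> every point has such
  a chart.\<close>

locale chart_point = char2_curve c for c :: "'a::alg_closed_field" +
  fixes i j k l :: nat and z :: "'a list"
  assumes chart: "(i,j,k,l) \<in> charts" and z: "z \<in> aff i" and zj: "z!j \<noteq> 0"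
begin

lemmas idx = chartD[OF chart]
lemmas rc = reg_coord[OF idx(1)] reg_coord[OF idx(2)] reg_coord[OF idx(3)] reg_coord[OF idx(4)]
lemmas ra = reg_add[OF _ _ idx(1)]

definition t :: "'a list \<Rightarrow> 'a" where
  "t v = z!i * v!j + z!j * v!i"

lemma t_form: "t \<in> forms UNIV 4 1"
  unfolding t_def[abs_def]
  by (intro U.forms_add U.forms_scale U.forms_coord idx UNIV_I)

lemma t_reg: "reg i t" and t_power_reg: "reg i (\<lambda>v. t v ^ n)"
  using reg_form[OF t_form] reg_power by blast+

lemma zi: "z!i = 1"
  using z by (simp add: aff_def)

lemma t_aff: "v \<in> aff i \<Longrightarrow> t v = v!j + z!j"
  by (simp add: t_def aff_def zi)

lemma t_z: "t z = 0"
  by (simp add: t_aff[OF z] add_self)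

lemma t_nonzero: "\<exists>v\<in>aff i. t v \<noteq> 0"
proof -
  have "finite {0, 1, z!j}" by simp
  then obtain x where "x \<notin> {0, 1, z!j}" using infinite_alg_closed ex_new_if_finite by blast
  then obtain v where "v \<in> aff i" "v!j = x" "x \<noteq> z!j"
    using aff_generic_ex[OF chart, of x] by auto
  then show ?thesis using t_aff by (auto simp: add_eq_0_iff_eq)
qed

text \<open>Subtract the curve equations at \<open>v\<close> and at \<open>z\<close>; the coefficient of \<open>y - y\<^sub>0\<close> is a unit at \<open>z\<close>.\<close>

lemma t_dvd_y: "ldvd i z t (\<lambda>v. v!l + z!l)"
proof -
  let ?A = "\<lambda>v. t v * (1 + v!l)\<^sup>2 + c\<^sup>2 * v!l"
  let ?B = "\<lambda>v. (1 + z!j)\<^sup>2 * (v!l + z!l) + c\<^sup>2 * z!j"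
  have "reg i ?A" "reg i ?B"
    by (intro ra reg_mult reg_power reg_const rc t_reg)+
  moreover have "?B z \<noteq> 0" using c_nz zj by (simp add: add_self)
  moreover have "?B v * (v!l + z!l) = ?A v * t v" if v: "v \<in> aff i" for v
  proof -
    have "?B v * (v!l + z!l) + ?A v * t v =
        ((1 + v!j)\<^sup>2 * (1 + v!l)\<^sup>2 + c\<^sup>2 * v!j * v!l) + ((1 + z!j)\<^sup>2 * (1 + z!l)\<^sup>2 + c\<^sup>2 * z!j * z!l)"
      unfolding t_aff[OF v] by (simp add: ring2)
    also have "\<dots> = 0"
      unfolding affD(4)[OF chart v] affD(4)[OF chart z] by (simp add: add_self)
    finally show ?thesis by (simp only: add_eq_0_iff_eq)
  qed
  ultimately show ?thesis by (rule ldvdI)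
qed

text \<open>f - f(z) lies in the ideal generated by x - x(z) and y - y(z). Together with
  \<open>t_dvd_y\<close> this makes the maximal ideal of the local ring principal.\<close>

definition taylor :: "('a list \<Rightarrow> 'a) \<Rightarrow> bool" where
  "taylor f \<longleftrightarrow> (\<exists>p q. reg i p \<and> reg i q \<and> (\<forall>v\<in>aff i. f v + f z = t v * p v + (v!l + z!l) * q v))"

lemma taylorI:
  assumes "reg i p" "reg i q" "\<And>v. v \<in> aff i \<Longrightarrow> f v + f z = t v * p v + (v!l + z!l) * q v"
  shows "taylor f"
  using assms unfolding taylor_def by blast

lemma taylor_add:
  assumes "taylor f" "taylor g"
  shows "taylor (\<lambda>v. f v + g v)"
proof -
  obtain p q where 1: "reg i p" "reg i q" "\<And>v. v \<in> aff i \<Longrightarrow> f v + f z = t v * p v + (v!l + z!l) * q v"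
    using assms(1) unfolding taylor_def by blast
  obtain p' q' where 2: "reg i p'" "reg i q'" "\<And>v. v \<in> aff i \<Longrightarrow> g v + g z = t v * p' v + (v!l + z!l) * q' v"
    using assms(2) unfolding taylor_def by blast
  show ?thesis
  proof (rule taylorI[OF ra[OF 1(1) 2(1)] ra[OF 1(2) 2(2)]])
    fix v assume v: "v \<in> aff i"
    have "f v + g v + (f z + g z) = (f v + f z) + (g v + g z)" by (simp only: add_ac)
    then show "f v + g v + (f z + g z) = t v * (p v + p' v) + (v!l + z!l) * (q v + q' v)"
      unfolding 1(3)[OF v] 2(3)[OF v] by (simp only: distrib_left add_ac)
  qed
qed

lemma taylor_mult:
  assumes "taylor f" "taylor g" "reg i f"
  shows "taylor (\<lambda>v. f v * g v)"
proof -
  obtain p q where 1: "reg i p" "reg i q" "\<And>v. v \<in> aff i \<Longrightarrow> f v + f z = t v * p v + (v!l + z!l) * q v"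
    using assms(1) unfolding taylor_def by blast
  obtain p' q' where 2: "reg i p'" "reg i q'" "\<And>v. v \<in> aff i \<Longrightarrow> g v + g z = t v * p' v + (v!l + z!l) * q' v"
    using assms(2) unfolding taylor_def by blast
  show ?thesis
  proof (rule taylorI[OF ra[OF reg_mult[OF assms(3) 2(1)] reg_mult[OF reg_const 1(1)]]
        ra[OF reg_mult[OF assms(3) 2(2)] reg_mult[OF reg_const 1(2)]]])
    fix v assume v: "v \<in> aff i"
    have "f v * g v + f z * g z = f v * (g v + g z) + g z * (f v + f z)" by (simp add: ring2)
    then show "f v * g v + f z * g z =
        t v * (f v * p' v + g z * p v) + (v!l + z!l) * (f v * q' v + g z * q v)"
      unfolding 1(3)[OF v] 2(3)[OF v] by (simp add: algebra_simps)
  qed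
qed

lemma taylor_coord: "n < 4 \<Longrightarrow> taylor (\<lambda>v. v!n)"
proof -
  assume n: "n < 4"
  have ti: "taylor (\<lambda>v. v!i)"
    by (rule taylorI[OF reg_const[of _ 0] reg_const[of _ 0]]) (simp add: aff_def zi add_self)
  have tj: "taylor (\<lambda>v. v!j)"
    by (rule taylorI[OF reg_const[of _ 1] reg_const[of _ 0]]) (simp add: t_aff)
  have tl: "taylor (\<lambda>v. v!l)"
    by (rule taylorI[OF reg_const[of _ 0] reg_const[of _ 1]]) simp
  have "taylor (\<lambda>v. v!j * v!l)" by (rule taylor_mult[OF tj tl rc(2)])
  then have tk: "taylor (\<lambda>v. v!k)"
    unfolding taylor_def using affD(3)[OF chart] z by simp
  show ?thesis using idx(5)[OF n] ti tj tk tl by auto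
qed

lemma taylor_form: "F \<in> forms UNIV 4 d \<Longrightarrow> reg i F \<and> taylor F"
proof (induction rule: U.forms_induct)
  case (const a)
  have "taylor (\<lambda>_. a)"
    by (rule taylorI[OF reg_const[of _ 0] reg_const[of _ 0]]) (simp add: add_self)
  then show ?case using reg_const by blast
next
  case (zero d)
  have "taylor (\<lambda>_. 0)"
    by (rule taylorI[OF reg_const[of _ 0] reg_const[of _ 0]]) simp
  then show ?case using reg_const by blast
next
  case (add d f g)
  then show ?case using taylor_add ra by blast
next
  case (coord d f n)
  then show ?case using taylor_mult[OF taylor_coord] reg_mult reg_coord by blast
qed

lemma t_dvd:
  assumes f: "reg i f" and fz: "f z = 0"
  shows "ldvd i z t f"
proof -
  obtain d F where F: "F \<in> forms UNIV 4 d" "\<forall>v\<in>aff i. f v = F v"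
    using f unfolding reg_def by blast
  then have Fz: "F z = 0" using fz z by simp
  obtain p q where 1: "reg i p" "reg i q" "\<And>v. v \<in> aff i \<Longrightarrow> F v + F z = t v * p v + (v!l + z!l) * q v"
    using taylor_form[OF F(1)] unfolding taylor_def by blast
  obtain A B where 2: "reg i A" "reg i B" "B z \<noteq> 0" "\<And>v. v \<in> aff i \<Longrightarrow> B v * (v!l + z!l) = A v * t v"
    using t_dvd_y unfolding ldvd_def by blast
  show ?thesis
  proof (rule ldvdI[OF ra[OF reg_mult[OF 2(2) 1(1)] reg_mult[OF 2(1) 1(2)]] 2(2,3)])
    fix v assume v: "v \<in> aff i"
    have "B v * f v = B v * p v * t v + q v * (B v * (v!l + z!l))"
      using F(2) v 1(3)[OF v] Fz by (simp add: algebra_simps)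
    then show "B v * f v = (B v * p v + A v * q v) * t v"
      unfolding 2(4)[OF v] by (simp add: algebra_simps)
  qed
qed

text \<open>Multiplying f by its conjugate yields a polynomial in x. The multiplicity of x(z) as a
  root of it bounds the order of f, since the remaining factor \<open>M\<close> is a unit at
  z.\<close>

lemma dvd_t_power:
  assumes f: "reg i f" and nz: "\<exists>v\<in>aff i. f v \<noteq> 0"
  shows "\<exists>m. ldvd i z f (\<lambda>v. t v ^ m)"
proof -
  obtain d F where F: "F \<in> forms UNIV 4 d" "\<forall>v\<in>aff i. f v = F v"
    using f unfolding reg_def by blast
  obtain n a b where
    nf: "\<And>v. v \<in> aff i \<Longrightarrow> (1 + v!j) ^ n * F v = poly a (v!j) + poly b (v!j) * ((1 + v!j)\<^sup>2 * v!l)"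
    using normal_form[OF chart F(1)] by blast
  have N: "norm_poly a b \<noteq> 0"
  proof
    assume "norm_poly a b = 0"
    then have ab: "a = 0" "b = 0" using norm_poly_eq_0 by blast+
    obtain u where u: "u \<in> aff i" "f u \<noteq> 0" using nz by blast
    have "f u = 0"
    proof (rule reg_eqI[OF idx(1) f reg_const _ u(1)])
      fix v assume v: "v \<in> aff i" "generic v"
      have "1 + v!j \<noteq> 0" using generic_aff_neq_1[OF chart v] by (metis add_eq_0_iff_eq)
      then show "f v = 0" using nf[OF v(1)] F(2) v(1) ab by simp
    qed
    then show False using u(2) by simp
  qed
  define m where "m = order (z!j) (norm_poly a b)"
  obtain M where M: "norm_poly a b = [:- (z!j), 1:] ^ m * M" "\<not> [:- (z!j), 1:] dvd M"
    using order_decomp[OF N] unfolding m_def by blast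
  let ?w = "\<lambda>v. (1 + v!j)\<^sup>2 * v!l"
  let ?A = "\<lambda>v. (1 + v!j) ^ n * (poly a (v!j) + poly b (v!j) * (?w v + c\<^sup>2 * v!j))"
  have "ldvd i z f (\<lambda>v. t v ^ m)"
  proof (rule ldvdI)
    show "reg i ?A"
      by (intro ra reg_mult reg_power reg_const reg_poly rc idx)
    show "reg i (\<lambda>v. poly M (v!j))" by (intro reg_poly rc idx)
    show "poly M (z!j) \<noteq> 0" using M(2) by (simp add: poly_eq_0_iff_dvd)
    fix v assume v: "v \<in> aff i"
    have "poly M (v!j) * t v ^ m = poly (norm_poly a b) (v!j)"
      unfolding M(1) t_aff[OF v] by (simp add: minus_self add.commute)
    also have "\<dots> = ((1 + v!j) ^ n * F v) * (poly a (v!j) + poly b (v!j) * (?w v + c\<^sup>2 * v!j))"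
      unfolding nf[OF v] by (rule norm_poly_eq[OF chart v])
    finally show "poly M (v!j) * t v ^ m = ?A v * f v"
      using F(2) v by (simp add: mult_ac)
  qed
  then show ?thesis by blast
qed

lemma unit_dvd_any:
  assumes "reg i f" "reg i g" "f z \<noteq> 0"
  shows "ldvd i z f g"
  by (rule ldvdI[OF assms(2,1,3)]) (simp only: mult.commute)

text \<open>As long as f vanishes at z a factor t can be split off, and the exponent m bounds how
  often this happens.\<close>

lemma associated_t_power:
  assumes f: "reg i f" and "ldvd i z f (\<lambda>v. t v ^ m)"
  shows "\<exists>n. ldvd i z (\<lambda>v. t v ^ n) f \<and> ldvd i z f (\<lambda>v. t v ^ n)"
  using assms
proof (induction m arbitrary: f)
  case 0
  then obtain A B where "B z \<noteq> 0" "\<forall>v\<in>aff i. B v * t v ^ 0 = A v * f v"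
    unfolding ldvd_def by blast
  then have "f z \<noteq> 0" using z by (metis mult.right_neutral mult_zero_right power_0)
  then have "ldvd i z (\<lambda>v. t v ^ 0) f \<and> ldvd i z f (\<lambda>v. t v ^ 0)"
    by (intro conjI unit_dvd_any t_power_reg 0(1)) simp_all
  then show ?case by blast
next
  case (Suc m)
  show ?case
  proof (cases "f z = 0")
    case False
    then have "ldvd i z (\<lambda>v. t v ^ 0) f \<and> ldvd i z f (\<lambda>v. t v ^ 0)"
      by (intro conjI unit_dvd_any t_power_reg Suc.prems(1)) simp_all
    then show ?thesis by blast
  next
    case True
    obtain A B where 1: "reg i A" "reg i B" "B z \<noteq> 0" "\<And>v. v \<in> aff i \<Longrightarrow> B v * f v = A v * t v"
      using t_dvd[OF Suc.prems(1) True] unfolding ldvd_def by blast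
    obtain A' B' where 2: "reg i A'" "reg i B'" "B' z \<noteq> 0" "\<And>v. v \<in> aff i \<Longrightarrow> B' v * t v ^ Suc m = A' v * f v"
      using Suc.prems(2) unfolding ldvd_def by blast
    obtain u where u: "u \<in> aff i" "t u \<noteq> 0" using t_nonzero by blast
    have "ldvd i z A (\<lambda>v. t v ^ m)"
    proof (rule ldvdI[OF 2(1) reg_mult[OF 1(2) 2(2)]])
      show "B z * B' z \<noteq> 0" using 1(3) 2(3) by simp
      fix v assume v: "v \<in> aff i"
      show "B v * B' v * t v ^ m = A' v * A v"
      proof (rule reg_cancel[OF idx(1) t_reg _ _ u _ v])
        show "reg i (\<lambda>v. B v * B' v * t v ^ m)" "reg i (\<lambda>v. A' v * A v)"
          by (intro reg_mult 1 2 t_power_reg)+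
        fix v assume v: "v \<in> aff i"
        have "t v * (B v * B' v * t v ^ m) = B v * (B' v * t v ^ Suc m)" by (simp add: mult_ac)
        also have "\<dots> = A' v * (B v * f v)" unfolding 2(4)[OF v] by (simp only: mult_ac)
        finally show "t v * (B v * B' v * t v ^ m) = t v * (A' v * A v)"
          unfolding 1(4)[OF v] by (simp only: mult_ac)
      qed
    qed
    then obtain n where n: "ldvd i z (\<lambda>v. t v ^ n) A" "ldvd i z A (\<lambda>v. t v ^ n)"
      using Suc.IH[OF 1(1)] by blast
    have f1: "ldvd i z (\<lambda>v. A v * t v) f"
      by (rule ldvdI[OF reg_const[of _ 1] 1(2,3)]) (simp add: 1(4))
    have f2: "ldvd i z f (\<lambda>v. A v * t v)"
      by (rule ldvdI[OF 1(2) reg_const[of _ 1]]) (simp_all add: 1(4))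
    have "ldvd i z (\<lambda>v. t v ^ Suc n) f"
      using ldvd_trans[OF ldvd_mult[OF n(1) ldvd_refl] f1] by (simp add: mult.commute)
    moreover have "ldvd i z f (\<lambda>v. t v ^ Suc n)"
      using ldvd_trans[OF f2 ldvd_mult[OF n(2) ldvd_refl]] by (simp add: mult.commute)
    ultimately show ?thesis by blast
  qed
qed

text \<open>Otherwise cancelling t^m would exhibit the unit B as a multiple of t, which vanishes at
  z.\<close>

lemma t_power_dvd_imp_le:
  assumes "ldvd i z (\<lambda>v. t v ^ n) (\<lambda>v. t v ^ m)"
  shows "n \<le> m"
proof (rule ccontr)
  assume "\<not> n \<le> m"
  then obtain r where n: "n = m + Suc r" using less_imp_Suc_add[of m n] by auto
  obtain A B where 1: "reg i A" "reg i B" "B z \<noteq> 0" "\<And>v. v \<in> aff i \<Longrightarrow> B v * t v ^ m = A v * t v ^ n"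
    using assms unfolding ldvd_def by blast
  obtain u where u: "u \<in> aff i" "t u \<noteq> 0" using t_nonzero by blast
  have "B z = A z * t z ^ Suc r"
  proof (rule reg_cancel[OF idx(1) t_power_reg[of m] 1(2) reg_mult[OF 1(1) t_power_reg] u(1) _ _ z])
    show "t u ^ m \<noteq> 0" using u(2) by simp
    fix v assume "v \<in> aff i"
    from 1(4)[OF this] show "t v ^ m * B v = t v ^ m * (A v * t v ^ Suc r)"
      unfolding n power_add by (simp only: mult_ac)
  qed
  then show False using 1(3) t_z by simp
qed

lemma t_power_form: "(\<lambda>v. t v ^ n) \<in> forms UNIV 4 n"
  using U.forms_power[OF t_form, of n] by simp

lemma z_cone: "z \<in> EC_cone c"
  using z by (simp add: aff_def)

lemmas loc_dvd_iff = loc_dvd_iff_ldvd[OF _ _ z idx(1)]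

lemma uniformizer_t: "uniformizer c (pt z) t"
proof -
  have "loc_dvd c (pt z) t F" if F: "F \<in> forms UNIV 4 d" "\<forall>x\<in>pt z. F x = 0" for d F
  proof -
    have "F z = 0" using F(2) pt_self by blast
    then show ?thesis
      unfolding loc_dvd_iff[OF t_form F(1)] by (rule t_dvd[OF reg_form[OF F(1)]])
  qed
  moreover have "\<forall>x\<in>pt z. t x = 0"
    using form_pt_zero_iff[OF t_form z_cone] t_z by blast
  ultimately show ?thesis
    unfolding uniformizer_def using t_form by blast
qed

lemma uniformizer_associated:
  assumes "uniformizer c (pt z) s"
  shows "\<exists>d. s \<in> forms UNIV 4 d" "ldvd i z t s" "ldvd i z s t"
proof -
  obtain d where s: "s \<in> forms UNIV 4 d" using assms unfolding uniformizer_def by blast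
  then show "\<exists>d. s \<in> forms UNIV 4 d" by blast
  have "loc_dvd c (pt z) s t" "loc_dvd c (pt z) t s"
    using assms uniformizer_t s t_form unfolding uniformizer_def by blast+
  then show "ldvd i z s t" "ldvd i z t s"
    using loc_dvd_iff[OF s t_form] loc_dvd_iff[OF t_form s] by blast+
qed

lemma ldvd_power:
  assumes "ldvd i z f g"
  shows "ldvd i z (\<lambda>v. f v ^ n) (\<lambda>v. g v ^ n)"
  by (induction n) (use ldvd_mult[OF assms] in \<open>simp_all add: ldvd_refl\<close>)

text \<open>The description in \<open>ord_at\<close> is unambiguous: any two uniformizers divide
  each other, so it suffices to compare powers of t.\<close>

lemma ord_at_eqI:
  assumes F: "F \<in> forms UNIV 4 d"
    and n: "ldvd i z (\<lambda>v. t v ^ n) F" "ldvd i z F (\<lambda>v. t v ^ n)"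
  shows "ord_at c (pt z) F = n"
  unfolding ord_at_def
proof (rule the_equality)
  show "\<exists>t. uniformizer c (pt z) t \<and> loc_dvd c (pt z) (\<lambda>x. t x ^ n) F \<and> loc_dvd c (pt z) F (\<lambda>x. t x ^ n)"
    using uniformizer_t n loc_dvd_iff[OF t_power_form F] loc_dvd_iff[OF F t_power_form] by blast
next
  fix m
  assume "\<exists>t. uniformizer c (pt z) t \<and> loc_dvd c (pt z) (\<lambda>x. t x ^ m) F \<and> loc_dvd c (pt z) F (\<lambda>x. t x ^ m)"
  then obtain s where s: "uniformizer c (pt z) s"
    and d: "loc_dvd c (pt z) (\<lambda>x. s x ^ m) F" "loc_dvd c (pt z) F (\<lambda>x. s x ^ m)" by blast
  obtain e where "s \<in> forms UNIV 4 e" using uniformizer_associated(1)[OF s] by blast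
  then have sm: "(\<lambda>v. s v ^ m) \<in> forms UNIV 4 (m * e)" by (rule U.forms_power)
  have "ldvd i z (\<lambda>v. s v ^ m) F" "ldvd i z F (\<lambda>v. s v ^ m)"
    using d loc_dvd_iff[OF sm F] loc_dvd_iff[OF F sm] by blast+
  then have "ldvd i z (\<lambda>v. t v ^ m) F" "ldvd i z F (\<lambda>v. t v ^ m)"
    using uniformizer_associated(2,3)[OF s] ldvd_power ldvd_trans by blast+
  then have mn: "ldvd i z (\<lambda>v. t v ^ m) (\<lambda>v. t v ^ n)" and nm: "ldvd i z (\<lambda>v. t v ^ n) (\<lambda>v. t v ^ m)"
    using n ldvd_trans by blast+
  show "m = n"
    by (rule antisym[OF t_power_dvd_imp_le[OF mn] t_power_dvd_imp_le[OF nm]])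
qed

lemma nonzero_aff:
  assumes F: "F \<in> forms UNIV 4 d" and u: "u \<in> EC_cone c" "F u \<noteq> 0"
  shows "\<exists>v\<in>aff i. F v \<noteq> 0"
proof (rule ccontr)
  assume "\<not> ?thesis"
  then have zero: "\<forall>v\<in>aff i. F v = 0" by blast
  have "F u = 0"
  proof (rule form_zero_if_generic_zero[OF F _ u(1)])
    fix v assume v: "v \<in> EC_cone c" "generic v"
    then have vi: "v!i \<noteq> 0" unfolding generic_chart[OF chart] by blast
    then have "F (map ((*) (1 / v!i)) v) = 0"
      using zero aff_normalize[OF v(1) vi idx(1)] by blast
    then show "F v = 0" using form_scale[OF F v(1), of "1 / v!i"] vi by simp
  qed
  then show False using u(2) by simp
qed

lemma ord_at_associated:
  assumes F: "F \<in> forms UNIV 4 d" and u: "u \<in> EC_cone c" "F u \<noteq> 0"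
  shows "ldvd i z (\<lambda>v. t v ^ ord_at c (pt z) F) F" "ldvd i z F (\<lambda>v. t v ^ ord_at c (pt z) F)"
proof -
  obtain m where "ldvd i z F (\<lambda>v. t v ^ m)"
    using dvd_t_power[OF reg_form[OF F] nonzero_aff[OF F u]] by blast
  then obtain n where n: "ldvd i z (\<lambda>v. t v ^ n) F" "ldvd i z F (\<lambda>v. t v ^ n)"
    using associated_t_power[OF reg_form[OF F]] by blast
  then have "ord_at c (pt z) F = n" by (rule ord_at_eqI[OF F])
  then show "ldvd i z (\<lambda>v. t v ^ ord_at c (pt z) F) F" "ldvd i z F (\<lambda>v. t v ^ ord_at c (pt z) F)"
    using n by simp_all
qed

lemma ord_at_t: "ord_at c (pt z) t = 1"
  by (rule ord_at_eqI[OF t_form]) (simp_all add: ldvd_refl)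

end

context char2_curve
begin

lemma pt_scale: "s \<noteq> 0 \<Longrightarrow> pt (map ((*) s) x) = pt x"
proof -
  assume s: "s \<noteq> 0"
  show ?thesis
  proof (intro equalityI subsetI)
    fix y assume "y \<in> pt (map ((*) s) x)"
    then obtain r where "r \<noteq> 0" "y = map ((*) (r * s)) x" by (auto simp: pt_def mult.assoc)
    then show "y \<in> pt x" using s unfolding pt_def by (auto intro!: exI[of _ "r * s"])
  next
    fix y assume "y \<in> pt x"
    then obtain r where "r \<noteq> 0" "y = map ((*) (r / s)) (map ((*) s) x)"
      using s by (auto simp: pt_def)
    then show "y \<in> pt (map ((*) s) x)" using s unfolding pt_def by (auto intro!: exI[of _ "r / s"])
  qed
qed

text \<open>If no two adjacent coordinates were nonzero, a nonzero X0, say, would force X1 = X3 = 0,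
  then X2 = 0 from X0 X2 = X1 X3, and finally X0 = 0 from the first equation.\<close>

lemma chart_point_ex:
  assumes v: "v \<in> EC_cone c"
  obtains i j k l where "(i,j,k,l) \<in> charts" "v!i \<noteq> 0" "v!j \<noteq> 0"
proof -
  have "\<exists>(i,j,k,l)\<in>charts. v!i \<noteq> 0 \<and> v!j \<noteq> 0"
  proof (rule ccontr)
    assume *: "\<not> ?thesis"
    obtain n where "n < 4" "v!n \<noteq> 0"
      using coneD(1,2)[OF v] unfolding nonzero_def by (auto simp: in_set_conv_nth)
    then have nz: "v!0 \<noteq> 0 \<or> v!1 \<noteq> 0 \<or> v!2 \<noteq> 0 \<or> v!3 \<noteq> 0" by (auto simp: less_Suc_eq numeral_eq_Suc)
    have z: "v!0 = 0 \<or> v!1 = 0" "v!1 = 0 \<or> v!2 = 0" "v!2 = 0 \<or> v!3 = 0" "v!3 = 0 \<or> v!0 = 0"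
      using * unfolding charts_def by auto
    have "(v!0 + v!1 + v!2 + v!3)\<^sup>2 = c\<^sup>2 * v!0 * v!2" "v!0 * v!2 = v!1 * v!3"
      using coneD[OF v] by blast+
    then show False using z nz c_nz by (auto simp: add_eq_0_iff_eq)
  qed
  then show ?thesis using that by blast
qed

lemma EC_E:
  assumes "Z \<in> EC c"
  obtains v where "v \<in> EC_cone c" "Z = pt v"
  using assms unfolding EC_def by blast

lemma chart_pointI:
  assumes "(i,j,k,l) \<in> charts" "v \<in> EC_cone c" "v!i \<noteq> 0" "v!j \<noteq> 0"
  shows "chart_point c i j k l (map ((*) (1 / v!i)) v)" "pt (map ((*) (1 / v!i)) v) = pt v"
proof -
  note i = chartD[OF assms(1)]
  show "chart_point c i j k l (map ((*) (1 / v!i)) v)"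
  proof unfold_locales
    show "map ((*) (1 / v!i)) v \<in> aff i" by (rule aff_normalize[OF assms(2,3) i(1)])
    show "map ((*) (1 / v!i)) v ! j \<noteq> 0" using assms(3,4) i(2) coneD(1)[OF assms(2)] by simp
  qed (rule assms(1))
  show "pt (map ((*) (1 / v!i)) v) = pt v" using assms(3) by (intro pt_scale) simp
qed

lemma chart_point_cases:
  assumes "Z \<in> EC c"
  obtains i j k l z where "chart_point c i j k l z" "Z = pt z"
proof -
  obtain v where v: "v \<in> EC_cone c" "Z = pt v" using assms by (rule EC_E)
  obtain i j k l where "(i,j,k,l) \<in> charts" "v!i \<noteq> 0" "v!j \<noteq> 0"
    using chart_point_ex[OF v(1)] by metis
  then show ?thesis using chart_pointI[OF _ v(1)] v(2) that by metis
qed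

section \<open>The order of vanishing as a valuation\<close>

definition nzform :: "nat \<Rightarrow> ('a list \<Rightarrow> 'a) \<Rightarrow> bool" where
  "nzform d F \<longleftrightarrow> F \<in> forms UNIV 4 d \<and> (\<exists>v\<in>EC_cone c. F v \<noteq> 0)"

lemma nzform_mult:
  assumes "nzform d F" "nzform e G"
  shows "nzform (d + e) (\<lambda>v. F v * G v)"
proof -
  have F: "F \<in> forms UNIV 4 d" and G: "G \<in> forms UNIV 4 e" using assms by (auto simp: nzform_def)
  have "\<exists>v\<in>EC_cone c. F v * G v \<noteq> 0"
    using form_domain[OF F G] assms unfolding nzform_def by blast
  then show ?thesis unfolding nzform_def using U.forms_mult[OF F G] by blast
qed

lemma ord_at_mult:
  assumes "Z \<in> EC c" "nzform d F" "nzform e G"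
  shows "ord_at c Z (\<lambda>v. F v * G v) = ord_at c Z F + ord_at c Z G"
proof -
  obtain i j k l z where cp: "chart_point c i j k l z" and Z: "Z = pt z"
    using chart_point_cases[OF assms(1)] by metis
  interpret chart_point c i j k l z by (rule cp)
  obtain u where u: "u \<in> EC_cone c" "F u \<noteq> 0" using assms(2) by (auto simp: nzform_def)
  obtain w where w: "w \<in> EC_cone c" "G w \<noteq> 0" using assms(3) by (auto simp: nzform_def)
  have F: "F \<in> forms UNIV 4 d" and G: "G \<in> forms UNIV 4 e" using assms by (auto simp: nzform_def)
  show ?thesis
    unfolding Z
    by (rule ord_at_eqI[OF U.forms_mult[OF F G]])
      (use ldvd_mult[OF ord_at_associated(1)[OF F u] ord_at_associated(1)[OF G w]]
        ldvd_mult[OF ord_at_associated(2)[OF F u] ord_at_associated(2)[OF G w]] in \<open>simp_all add: power_add\<close>)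
qed

lemma ord_at_power2:
  assumes "Z \<in> EC c" "nzform d F"
  shows "ord_at c Z (\<lambda>v. (F v)\<^sup>2) = 2 * ord_at c Z F"
  using ord_at_mult[OF assms(1,2,2)] by (simp add: power2_eq_square)

lemma loc_dvd_iff_ord_le:
  assumes "Z \<in> EC c" "nzform d F" "nzform e G"
  shows "loc_dvd c Z F G \<longleftrightarrow> ord_at c Z F \<le> ord_at c Z G"
proof -
  obtain i j k l z where cp: "chart_point c i j k l z" and Z: "Z = pt z"
    using chart_point_cases[OF assms(1)] by metis
  interpret chart_point c i j k l z by (rule cp)
  obtain u where u: "u \<in> EC_cone c" "F u \<noteq> 0" using assms(2) by (auto simp: nzform_def)
  obtain w where w: "w \<in> EC_cone c" "G w \<noteq> 0" using assms(3) by (auto simp: nzform_def)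
  have F: "F \<in> forms UNIV 4 d" and G: "G \<in> forms UNIV 4 e" using assms by (auto simp: nzform_def)
  note f = ord_at_associated[OF F u] and g = ord_at_associated[OF G w]
  have mono: "ldvd i z (\<lambda>v. t v ^ m) (\<lambda>v. t v ^ n)" if "m \<le> n" for m n
    by (rule ldvdI[OF t_power_reg[of "n - m"] reg_const[of _ 1]])
      (use that in \<open>simp_all flip: power_add\<close>)
  show ?thesis
    unfolding Z loc_dvd_iff[OF F G]
    using t_power_dvd_imp_le[of "ord_at c (pt z) F" "ord_at c (pt z) G"]
      ldvd_trans[OF ldvd_trans[OF f(1) _] g(2)] ldvd_trans[OF ldvd_trans[OF f(2) mono] g(1)] by blast
qed

lemma ord_at_eq_0_iff:
  assumes z: "z \<in> EC_cone c" and F: "nzform d F"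
  shows "ord_at c (pt z) F = 0 \<longleftrightarrow> F z \<noteq> 0"
proof -
  have Z: "pt z \<in> EC c" using z by (auto simp: EC_def)
  have one: "nzform 0 (\<lambda>_. 1)" using z U.forms_const[of 1 4] by (auto simp: nzform_def)
  have F': "F \<in> forms UNIV 4 d" using F by (simp add: nzform_def)
  have "ord_at c (pt z) (\<lambda>v. 1 * 1) = ord_at c (pt z) (\<lambda>v. 1) + ord_at c (pt z) (\<lambda>v. 1)"
    by (rule ord_at_mult[OF Z one one])
  then have "ord_at c (pt z) (\<lambda>v. 1) = 0" by simp
  then have "ord_at c (pt z) F = 0 \<longleftrightarrow> loc_dvd c (pt z) F (\<lambda>_. 1)"
    unfolding loc_dvd_iff_ord_le[OF Z F one] by simp
  also have "\<dots> \<longleftrightarrow> F z \<noteq> 0"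
  proof
    assume "loc_dvd c (pt z) F (\<lambda>_. 1)"
    then obtain A B where "\<forall>x\<in>pt z. B x \<noteq> 0" "\<forall>y\<in>EC_cone c. B y * 1 = A y * F y"
      unfolding loc_dvd_def by blast
    then show "F z \<noteq> 0" using z pt_self by (metis mult_1_right mult_zero_right)
  next
    assume "F z \<noteq> 0"
    then show "loc_dvd c (pt z) F (\<lambda>_. 1)"
      using form_pt_zero_iff[OF F' z]
      by (intro loc_dvdI[OF U.forms_const[of 1] F']) auto
  qed
  finally show ?thesis .
qed

lemma ord_at_cong:
  assumes "\<And>v. v \<in> EC_cone c \<Longrightarrow> F v = G v"
  shows "ord_at c Z F = ord_at c Z G"
  unfolding ord_at_def loc_dvd_def using assms by simp

lemma ord_at_scale:
  assumes z: "z \<in> EC_cone c" and F: "nzform d F" and s: "s \<noteq> 0"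
  shows "ord_at c (pt z) (\<lambda>v. s * F v) = ord_at c (pt z) F"
proof -
  have Z: "pt z \<in> EC c" using z by (auto simp: EC_def)
  have sf: "nzform 0 (\<lambda>_. s)" using z s U.forms_const[of s 4] by (auto simp: nzform_def)
  show ?thesis using ord_at_mult[OF Z sf F] ord_at_eq_0_iff[OF z sf] s by simp
qed

lemma ord_at_uniformizer:
  assumes "(i,j,k,l) \<in> charts" "v \<in> EC_cone c" "v!i \<noteq> 0" "v!j \<noteq> 0"
  shows "ord_at c (pt v) (\<lambda>u. v!i * u!j + v!j * u!i) = 1"
proof -
  note cp = chart_pointI[OF assms]
  interpret chart_point c i j k l "map ((*) (1 / v!i)) v" by (rule cp(1))
  have t: "t = (\<lambda>u. (1 / v!i) * (v!i * u!j + v!j * u!i))"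
    using assms(3) idx(1,2) coneD(1)[OF assms(2)] by (auto simp: t_def fun_eq_iff field_simps)
  have "(\<lambda>u. v!i * u!j + v!j * u!i) \<in> forms UNIV 4 1"
    by (intro U.forms_add U.forms_scale U.forms_coord idx UNIV_I)
  moreover have "\<exists>u\<in>EC_cone c. v!i * u!j + v!j * u!i \<noteq> 0"
  proof -
    obtain u where u: "u \<in> aff i" "t u \<noteq> 0" using t_nonzero by blast
    have "t u = (1 / v!i) * (v!i * u!j + v!j * u!i)" by (simp only: t)
    then have "v!i * u!j + v!j * u!i \<noteq> 0" using u(2) by (metis mult_zero_right)
    then show ?thesis using u(1) unfolding aff_def by blast
  qed
  ultimately have "nzform 1 (\<lambda>u. v!i * u!j + v!j * u!i)" by (simp add: nzform_def)
  then have "ord_at c (pt v) t = ord_at c (pt v) (\<lambda>u. v!i * u!j + v!j * u!i)"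
    unfolding t using assms(3) by (intro ord_at_scale[OF assms(2)]) simp_all
  then show ?thesis using ord_at_t cp(2) by simp
qed

end

section \<open>Functions with poles in a fibre\<close>

lemma poly_eq_sum_atMost:
  fixes p :: "'a::field poly"
  assumes "degree p \<le> m"
  shows "poly p x = (\<Sum>i\<le>m. coeff p i * x ^ i)"
  unfolding poly_altdef using assms by (intro sum.mono_neutral_left) (auto simp: coeff_eq_0)

text \<open>Reversal of coefficients with respect to a degree bound m, needed for the change of
  chart x -> 1/x near x = infinity.\<close>

lemma reverse_poly_ex:
  fixes p :: "'a::field poly"
  assumes "\<And>i. i > m \<Longrightarrow> coeff p i = 0"
  obtains q where "poly q 0 = coeff p m" "\<And>x. x \<noteq> 0 \<Longrightarrow> poly q x = x ^ m * poly p (1 / x)"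
proof -
  define q where "q = (\<Sum>i\<le>m. monom (coeff p i) (m - i))"
  have "poly q 0 = (\<Sum>i\<le>m. if i = m then coeff p m else 0)"
    unfolding q_def poly_sum by (intro sum.cong) (auto simp: poly_monom power_0_left)
  then have "poly q 0 = coeff p m" by simp
  moreover have "poly q x = x ^ m * poly p (1 / x)" if x: "x \<noteq> 0" for x
  proof -
    have "degree p \<le> m" using assms by (meson degree_le)
    then have "poly p (1 / x) = (\<Sum>i\<le>m. coeff p i * (1 / x) ^ i)" by (rule poly_eq_sum_atMost)
    then have "x ^ m * poly p (1 / x) = (\<Sum>i\<le>m. x ^ m * (coeff p i * (1 / x) ^ i))"
      by (simp add: sum_distrib_left)
    also have "\<dots> = (\<Sum>i\<le>m. coeff p i * x ^ (m - i))"
      by (intro sum.cong refl) (use x in \<open>simp add: power_diff power_divide\<close>)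
    finally show ?thesis by (simp add: q_def poly_sum poly_monom)
  qed
  ultimately show ?thesis using that by blast
qed

context char2_curve
begin

lemma chart_0: "(0,1,2,3) \<in> charts" and chart_1: "(1,0,3,2) \<in> charts" and chart_3: "(3,2,1,0) \<in> charts"
  and chart_03: "(0,3,2,1) \<in> charts" and chart_12: "(1,2,3,0) \<in> charts"
  by (simp_all add: charts_def)

text \<open>At a point with \<open>x = 0\<close> one has \<open>y = 1\<close> and \<open>1 + y\<close> is a uniformizer whose square is
  associated to \<open>x\<close>, so \<open>1, w\<close> are independent modulo \<open>x\<close> in the local ring.\<close>

lemma divisible_at_zero:
  assumes ch: "(i,j,k,l) \<in> charts" and z: "z \<in> aff i" "z!j = 0"
    and A: "reg i A" and B: "reg i B" and Bz: "B z \<noteq> 0"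
    and eq: "\<And>v. v \<in> aff i \<Longrightarrow> B v * (poly a (v!j) + poly b (v!j) * ((1 + v!j)\<^sup>2 * v!l)) = v!j * A v"
  shows "poly a 0 = 0 \<and> poly b 0 = 0"
proof -
  note idx = chartD[OF ch]
  have "(1 + z!l)\<^sup>2 = 0" using affD(4)[OF ch z(1)] z(2) by simp
  then have zl: "z!l = 1" by (simp add: add_eq_0_iff_eq)
  have "poly a 0 + poly b 0 = 0" using eq[OF z(1)] z(2) zl Bz by simp
  then have ab: "poly a 0 = poly b 0" by (simp add: add_eq_0_iff_eq)
  obtain q0 q where q: "a + b * [:1,1:]\<^sup>2 = pCons q0 q" by (cases "a + b * [:1,1:]\<^sup>2")
  have "poly (a + b * [:1,1:]\<^sup>2) 0 = 0" using ab by (simp add: add_self)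
  then have "q0 = 0" unfolding q by simp
  have qx: "poly a x + poly b x * (1 + x)\<^sup>2 = x * poly q x" for x
  proof -
    have "poly a x + poly b x * (1 + x)\<^sup>2 = poly (a + b * [:1,1:]\<^sup>2) x" by simp
    then show ?thesis unfolding q \<open>q0 = 0\<close> by simp
  qed
  obtain x :: 'a where "x \<notin> {0, 1}" using infinite_alg_closed ex_new_if_finite by (metis finite.emptyI finite.insertI)
  then obtain u where u: "u \<in> aff i" "u!j \<noteq> 0" using aff_generic_ex[OF ch, of x] by auto
  \<comment> \<open>By the curve equation, (1 + y)(a + b w) = x (q (1 + y) + c^2 b y), where x q = a
    + b (1 + x)^2. After cancelling x only the term with b survives at z, because y = 1
    there.\<close>
  have "B z * (poly q (z!j) * (1 + z!l) + poly b (z!j) * c\<^sup>2 * z!l) = (1 + z!l) * A z"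
  proof (rule reg_cancel[OF idx(1) reg_coord[OF idx(2)] _ _ u _ z(1)])
    show "reg i (\<lambda>v. B v * (poly q (v!j) * (1 + v!l) + poly b (v!j) * c\<^sup>2 * v!l))"
      "reg i (\<lambda>v. (1 + v!l) * A v)"
      by (intro reg_mult reg_add reg_poly reg_const reg_coord A B idx)+
    fix v assume v: "v \<in> aff i"
    let ?x = "v!j" and ?y = "v!l"
    have "?x * (B v * (poly q ?x * (1 + ?y) + poly b ?x * c\<^sup>2 * ?y)) =
        B v * ((?x * poly q ?x) * (1 + ?y) + poly b ?x * (c\<^sup>2 * ?x * ?y))"
      by (simp add: algebra_simps)
    also have "\<dots> = (1 + ?y) * (B v * (poly a ?x + poly b ?x * ((1 + ?x)\<^sup>2 * ?y)))"
      unfolding qx[symmetric] affD(4)[OF ch v, symmetric] by (simp add: ring2)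
    finally show "?x * (B v * (poly q ?x * (1 + ?y) + poly b ?x * c\<^sup>2 * ?y)) = ?x * ((1 + ?y) * A v)"
      unfolding eq[OF v] by (simp only: mult_ac)
  qed
  then have "B z * (poly b 0 * c\<^sup>2) = 0" unfolding z(2) zl by (simp add: add_self)
  then show ?thesis using Bz c_nz ab by simp
qed

text \<open>The denominator is rationalized: H / G is expanded by the conjugate of the normal form
  of G, and D is the norm times the power of 1 + x coming from H.\<close>

lemma quotient_normal_form:
  assumes H: "H \<in> forms UNIV 4 d" and G: "nzform e G"
  shows "\<exists>D a b. D \<noteq> 0 \<and> (\<forall>v\<in>aff 0. poly D (v!1) * H v =
    G v * (poly a (v!1) + poly b (v!1) * ((1 + v!1)\<^sup>2 * v!3)))"
proof -
  have G': "G \<in> forms UNIV 4 e" using G by (simp add: nzform_def)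
  obtain m p q where
    H_nf: "\<And>v. v \<in> aff 0 \<Longrightarrow> (1 + v!1) ^ m * H v = poly p (v!1) + poly q (v!1) * ((1 + v!1)\<^sup>2 * v!3)"
    using normal_form[OF chart_0 H] by blast
  obtain n r s where
    G_nf: "\<And>v. v \<in> aff 0 \<Longrightarrow> (1 + v!1) ^ n * G v = poly r (v!1) + poly s (v!1) * ((1 + v!1)\<^sup>2 * v!3)"
    using normal_form[OF chart_0 G'] by blast
  have "norm_poly r s \<noteq> 0"
  proof
    assume "norm_poly r s = 0"
    then have rs: "r = 0" "s = 0" using norm_poly_eq_0 by blast+
    obtain u where u: "u \<in> EC_cone c" "G u \<noteq> 0" using G by (auto simp: nzform_def)
    have "G u = 0"
    proof (rule form_zero_if_generic_zero[OF G' _ u(1)])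
      fix v assume v: "v \<in> EC_cone c" "generic v"
      let ?v = "map ((*) (1 / v!0)) v"
      have v0: "v!0 \<noteq> 0" using v(2) by (simp add: generic_def)
      have v': "?v \<in> aff 0" using aff_normalize[OF v(1) v0] by simp
      have "generic ?v" using generic_scale[OF v] v0 by simp
      then have "1 + ?v!1 \<noteq> 0" using generic_aff_neq_1[OF chart_0 v'] by (metis add_eq_0_iff_eq)
      moreover have "(1 + ?v!1) ^ n * G ?v = 0" using G_nf[OF v'] unfolding rs by simp
      ultimately have "G ?v = 0" by (metis mult_eq_0_iff power_not_zero)
      then show "G v = 0" using form_scale[OF G' v(1), of "1 / v!0"] v0 by simp
    qed
    then show False using u(2) by simp
  qed
  then have "norm_poly r s * [:1,1:] ^ m \<noteq> 0" by simp
  moreover have "poly (norm_poly r s * [:1,1:] ^ m) (v!1) * H v =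
      G v * (poly ([:1,1:] ^ n * ((r + [:0, c\<^sup>2:] * s) * p + s * q * [:1,1:] ^ 4)) (v!1) +
             poly ([:1,1:] ^ n * (r * q + s * p)) (v!1) * ((1 + v!1)\<^sup>2 * v!3))"
    if v: "v \<in> aff 0" for v
  proof -
    define w where "w = (1 + v!1)\<^sup>2 * v!3"
    let ?x = "v!1"
    have w2: "w * w = c\<^sup>2 * ?x * w + (1 + ?x) ^ 4"
      using aff_w[OF chart_0 v] unfolding w_def by (simp add: power2_eq_square)
    have "poly (norm_poly r s * [:1,1:] ^ m) ?x * H v = poly (norm_poly r s) ?x * ((1 + ?x) ^ m * H v)"
      by (simp add: mult.assoc)
    also have "\<dots> = ((1 + ?x) ^ n * G v) * ((poly r ?x + poly s ?x * (w + c\<^sup>2 * ?x)) * (poly p ?x + poly q ?x * w))"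
      unfolding H_nf[OF v] norm_poly_eq[OF chart_0 v] G_nf[OF v] w_def by (simp only: mult_ac)
    also have "(poly r ?x + poly s ?x * (w + c\<^sup>2 * ?x)) * (poly p ?x + poly q ?x * w) =
        (poly r ?x + c\<^sup>2 * ?x * poly s ?x) * poly p ?x + (poly r ?x * poly q ?x + poly s ?x * poly p ?x) * w
        + poly s ?x * poly q ?x * (w * w + c\<^sup>2 * ?x * w)"
      by (simp add: ring2)
    also have "w * w + c\<^sup>2 * ?x * w = (1 + ?x) ^ 4" unfolding w2 by (simp add: add_self add_ac add_self_left)
    finally show ?thesis unfolding w_def by (simp add: algebra_simps)
  qed
  ultimately show ?thesis by blast
qed

text \<open>Turns local divisibility of H by G into regularity of (a + b w) / D at z; the common
  factor G is cancelled by irreducibility.\<close>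

lemma regular_quotient:
  assumes ch: "(i,j,k,l) \<in> charts" and G: "nzform e G"
    and eq: "\<And>v. v \<in> aff i \<Longrightarrow> poly D (v!j) * H v = G v * (poly a (v!j) + poly b (v!j) * ((1 + v!j)\<^sup>2 * v!l))"
    and dvd: "ldvd i z G H"
  obtains A B where "reg i A" "reg i B" "B z \<noteq> 0"
    "\<And>v. v \<in> aff i \<Longrightarrow> B v * (poly a (v!j) + poly b (v!j) * ((1 + v!j)\<^sup>2 * v!l)) = poly D (v!j) * A v"
proof -
  note idx = chartD[OF ch]
  have G': "G \<in> forms UNIV 4 e" using G by (simp add: nzform_def)
  obtain A B where AB: "reg i A" "reg i B" "B z \<noteq> 0" "\<And>v. v \<in> aff i \<Longrightarrow> B v * H v = A v * G v"
    using dvd unfolding ldvd_def by blast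
  have "\<exists>u\<in>aff i. G u \<noteq> 0"
  proof (rule ccontr)
    assume "\<not> ?thesis"
    moreover obtain u where "u \<in> EC_cone c" "G u \<noteq> 0" using G by (auto simp: nzform_def)
    moreover have "G v = 0" if v: "v \<in> EC_cone c" "generic v" "\<not> (\<exists>u\<in>aff i. G u \<noteq> 0)" for v
    proof -
      have vi: "v!i \<noteq> 0" using v(2) unfolding generic_chart[OF ch] by blast
      then have "G (map ((*) (1 / v!i)) v) = 0"
        using v(3) aff_normalize[OF v(1) vi idx(1)] by blast
      then show ?thesis using form_scale[OF G' v(1), of "1 / v!i"] vi by simp
    qed
    ultimately show False using form_zero_if_generic_zero[OF G'] by blast
  qed
  then obtain u where u: "u \<in> aff i" "G u \<noteq> 0" by blast
  show ?thesis
  proof (rule that[OF AB(1-3)])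
    fix v assume v: "v \<in> aff i"
    show "B v * (poly a (v!j) + poly b (v!j) * ((1 + v!j)\<^sup>2 * v!l)) = poly D (v!j) * A v"
    proof (rule reg_cancel[OF idx(1) reg_form[OF G'] _ _ u _ v])
      show "reg i (\<lambda>v. B v * (poly a (v!j) + poly b (v!j) * ((1 + v!j)\<^sup>2 * v!l)))"
        "reg i (\<lambda>v. poly D (v!j) * A v)"
        by (intro reg_mult reg_add reg_power reg_poly reg_const reg_coord AB idx)+
      fix v assume v: "v \<in> aff i"
      have "G v * (B v * (poly a (v!j) + poly b (v!j) * ((1 + v!j)\<^sup>2 * v!l))) = B v * (poly D (v!j) * H v)"
        unfolding eq[OF v] by (simp only: mult_ac)
      also have "\<dots> = poly D (v!j) * (B v * H v)" by (simp only: mult_ac)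
      finally show "G v * (B v * (poly a (v!j) + poly b (v!j) * ((1 + v!j)\<^sup>2 * v!l))) = G v * (poly D (v!j) * A v)"
        unfolding AB(4)[OF v] by (simp only: mult_ac)
    qed
  qed
qed

text \<open>H / X0 = H' / X3 is one function seen in two charts. The charts share x, but y becomes
  1/y, so w is replaced by its conjugate w + c^2 x and a by a + c^2 x b.\<close>

lemma quotient_in_chart_3:
  assumes H: "H \<in> forms UNIV 4 (Suc d)" and H': "H' \<in> forms UNIV 4 (Suc d)" and G: "G \<in> forms UNIV 4 d"
    and HH': "\<And>v. v \<in> EC_cone c \<Longrightarrow> H' v * v!0 = H v * v!3"
    and eq: "\<And>v. v \<in> aff 0 \<Longrightarrow> poly D (v!1) * H v = G v * (poly a (v!1) + poly b (v!1) * ((1 + v!1)\<^sup>2 * v!3))"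
    and v: "v \<in> aff 3"
  shows "poly D (v!2) * H' v =
    G v * (poly (a + [:0, c\<^sup>2:] * b) (v!2) + poly b (v!2) * ((1 + v!2)\<^sup>2 * v!0))"
proof (rule reg_eqI[OF _ _ _ _ v])
  show "reg 3 (\<lambda>v. poly D (v!2) * H' v)"
    by (intro reg_mult reg_poly reg_coord reg_form[OF H']) simp_all
  show "reg 3 (\<lambda>v. G v * (poly (a + [:0, c\<^sup>2:] * b) (v!2) + poly b (v!2) * ((1 + v!2)\<^sup>2 * v!0)))"
    by (intro reg_mult reg_add reg_power reg_poly reg_const reg_coord reg_form[OF G]) simp_all
  fix v assume v: "v \<in> aff 3" "generic v"
  have vc: "v \<in> EC_cone c" and v3: "v!3 = 1" using v(1) by (auto simp: aff_def)
  have v0: "v!0 \<noteq> 0" using v(2) by (simp add: generic_def)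
  define x y s where "x = v!2" and "y = v!0" and "s = 1 / v!0"
  have s: "s \<noteq> 0" "s * y = 1" using v0 by (simp_all add: s_def y_def)
  have v1: "v!1 = x * y" using affD(3)[OF chart_3 v(1)] by (simp add: x_def y_def)
  have cur: "(1 + x)\<^sup>2 * (1 + y)\<^sup>2 = c\<^sup>2 * x * y"
    using affD(4)[OF chart_3 v(1)] by (simp add: x_def y_def)
  let ?u = "map ((*) s) v"
  have u: "?u \<in> aff 0" unfolding s_def by (rule aff_normalize[OF vc v0]) simp
  have u1: "?u!1 = x" using coneD(1)[OF vc] v1 s(2) by (simp add: mult.commute mult.left_commute)
  have u3: "?u!3 = s" using coneD(1)[OF vc] v3 by simp
  have w: "(1 + x)\<^sup>2 * s = (1 + x)\<^sup>2 * y + c\<^sup>2 * x"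
  proof -
    have "(1 + x)\<^sup>2 * s = s * ((1 + x)\<^sup>2 * (1 + y)\<^sup>2) + (1 + x)\<^sup>2 * y * (s * y)"
      by (simp add: ring2)
    also have "\<dots> = c\<^sup>2 * x * (s * y) + (1 + x)\<^sup>2 * y * (s * y)"
      unfolding cur by (simp only: mult_ac)
    finally show ?thesis unfolding s(2) by (simp add: add.commute)
  qed
  have "poly D x * (s ^ Suc d * H v) = s ^ d * G v * (poly a x + poly b x * ((1 + x)\<^sup>2 * s))"
    using eq[OF u] unfolding u1 u3 form_scale[OF H vc] form_scale[OF G vc] .
  then have "s ^ d * (poly D x * (s * H v)) = s ^ d * (G v * (poly a x + poly b x * ((1 + x)\<^sup>2 * s)))"
    by (simp add: mult_ac)
  then have 1: "poly D x * (s * H v) = G v * (poly a x + poly b x * ((1 + x)\<^sup>2 * s))"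
    using s(1) mult_left_cancel[of "s ^ d"] by simp
  have "s * H v = s * y * H' v" using HH'[OF vc] v3 by (simp add: y_def mult_ac)
  then have "s * H v = H' v" unfolding s(2) by simp
  with 1 show "poly D (v!2) * H' v =
    G v * (poly (a + [:0, c\<^sup>2:] * b) (v!2) + poly b (v!2) * ((1 + v!2)\<^sup>2 * v!0))"
    unfolding w x_def[symmetric] y_def[symmetric] by (simp add: algebra_simps)
qed simp

text \<open>Here x becomes 1/x and y is unchanged. Since (1 + 1/x)^2 = (1 + x)^2 / x^2, the
  polynomial a needs two more powers of x than b. One of these powers is absorbed by X0 / X1 = x,
  which leaves the exponent n + 1 on the left.\<close>

lemma quotient_in_chart_1:
  assumes H: "H \<in> forms UNIV 4 (Suc d)" and G: "G \<in> forms UNIV 4 d"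
    and eq: "\<And>v. v \<in> aff 0 \<Longrightarrow> H v = G v * (poly a (v!1) + poly b (v!1) * ((1 + v!1)\<^sup>2 * v!3))"
    and a': "\<And>x. x \<noteq> 0 \<Longrightarrow> poly a' x = x ^ (n + 2) * poly a (1 / x)"
    and b': "\<And>x. x \<noteq> 0 \<Longrightarrow> poly b' x = x ^ n * poly b (1 / x)"
    and v: "v \<in> aff 1"
  shows "poly [:0, 1:] (v!0) ^ Suc n * H v = G v * (poly a' (v!0) + poly b' (v!0) * ((1 + v!0)\<^sup>2 * v!2))"
proof (rule reg_eqI[OF _ _ _ _ v])
  show "reg 1 (\<lambda>v. poly [:0, 1:] (v!0) ^ Suc n * H v)"
    by (intro reg_mult reg_power reg_poly reg_coord reg_form[OF H]) simp_all
  show "reg 1 (\<lambda>v. G v * (poly a' (v!0) + poly b' (v!0) * ((1 + v!0)\<^sup>2 * v!2)))"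
    by (intro reg_mult reg_add reg_power reg_poly reg_const reg_coord reg_form[OF G]) simp_all
  fix v assume v: "v \<in> aff 1" "generic v"
  have vc: "v \<in> EC_cone c" and v1: "v!1 = 1" using v(1) by (auto simp: aff_def)
  have v0: "v!0 \<noteq> 0" using v(2) by (simp add: generic_def)
  define x y s where "x = v!0" and "y = v!2" and "s = 1 / v!0"
  have s: "s \<noteq> 0" "s * x = 1" "s = 1 / x" and x: "x \<noteq> 0" using v0 by (simp_all add: s_def x_def)
  have v3: "v!3 = x * y" using affD(3)[OF chart_1 v(1)] by (simp add: x_def y_def)
  let ?u = "map ((*) s) v"
  have u: "?u \<in> aff 0" unfolding s_def by (rule aff_normalize[OF vc v0]) simp
  have u1: "?u!1 = s" using coneD(1)[OF vc] v1 by simp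
  have "?u!3 = s * x * y" using coneD(1)[OF vc] v3 by (simp add: mult.assoc)
  then have u3: "?u!3 = y" unfolding s(2) by simp
  have "s ^ Suc d * H v = s ^ d * G v * (poly a s + poly b s * ((1 + s)\<^sup>2 * y))"
    using eq[OF u] unfolding u1 u3 form_scale[OF H vc] form_scale[OF G vc] .
  then have "s ^ d * (s * H v) = s ^ d * (G v * (poly a s + poly b s * ((1 + s)\<^sup>2 * y)))"
    by (simp add: mult_ac)
  then have 1: "s * H v = G v * (poly a s + poly b s * ((1 + s)\<^sup>2 * y))"
    using s(1) mult_left_cancel[of "s ^ d"] by simp
  have xs: "x * (1 + s) = 1 + x" using s(2) by (simp add: algebra_simps)
  have "x ^ Suc n * H v = x ^ Suc n * (s * x) * H v" unfolding s(2) by simp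
  also have "\<dots> = x ^ (n + 2) * (s * H v)" by (simp add: power_add power2_eq_square mult_ac)
  also have "\<dots> = G v * (x ^ (n + 2) * poly a s + (x ^ n * poly b s) * ((x * (1 + s))\<^sup>2 * y))"
    unfolding 1 by (simp add: algebra_simps power_add power2_eq_square)
  finally have "x ^ Suc n * H v = G v * (x ^ (n + 2) * poly a s + (x ^ n * poly b s) * ((1 + x)\<^sup>2 * y))"
    unfolding xs .
  then have "x ^ Suc n * H v = G v * (poly a' x + poly b' x * ((1 + x)\<^sup>2 * y))"
    unfolding a'[OF x] b'[OF x] s(3) .
  then show "poly [:0, 1:] (v!0) ^ Suc n * H v = G v * (poly a' (v!0) + poly b' (v!0) * ((1 + v!0)\<^sup>2 * v!2))"
    unfolding x_def y_def by simp
qed simp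

lemma loc_dvd_imp_ldvd:
  assumes "F \<in> forms UNIV 4 d" "G \<in> forms UNIV 4 e" "i < 4" "z \<in> aff i" "\<And>Z. Z \<in> EC c \<Longrightarrow> loc_dvd c Z F G"
  shows "ldvd i z F G"
  using assms(5)[of "pt z"] loc_dvd_iff_ldvd[OF assms(1,2,4,3)] assms(4) by (auto simp: aff_def EC_def)

text \<open>A rational function \<open>H / (G X\<^sub>0)\<close> that is regular outside \<open>x = \<infinity>\<close> and has at most the poles of
  \<open>x\<close> there is a linear polynomial in \<open>x\<close>. The form \<open>H'\<close> represents the same section as \<open>H\<close> near
  the point \<open>(0:0:1:1)\<close>, where \<open>X\<^sub>0 = X\<^sub>1 = 0\<close>.\<close>

lemma sections_of_fibre:
  assumes H: "H \<in> forms UNIV 4 (Suc d)" and H': "H' \<in> forms UNIV 4 (Suc d)" and G: "nzform d G"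
    and HH': "\<And>v. v \<in> EC_cone c \<Longrightarrow> H' v * v!0 = H v * v!3"
    and dvd: "\<And>Z. Z \<in> EC c \<Longrightarrow> loc_dvd c Z G H" and dvd': "\<And>Z. Z \<in> EC c \<Longrightarrow> loc_dvd c Z G H'"
  shows "\<exists>\<alpha> \<gamma>. \<forall>v\<in>EC_cone c. H v = G v * (\<alpha> * v!0 + \<gamma> * v!1)"
proof -
  have G': "G \<in> forms UNIV 4 d" using G by (simp add: nzform_def)
  have dvd0: "ldvd 0 z G H" if "z \<in> aff 0" for z using loc_dvd_imp_ldvd[OF G' H _ that dvd] by simp
  have dvd1: "ldvd 1 z G H" if "z \<in> aff 1" for z using loc_dvd_imp_ldvd[OF G' H _ that dvd] by simp
  have dvd3: "ldvd 3 z G H'" if "z \<in> aff 3" for z using loc_dvd_imp_ldvd[OF G' H' _ that dvd'] by simp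
  let ?id = "\<lambda>D a b. \<forall>v\<in>aff 0. poly D (v!1) * H v = G v * (poly a (v!1) + poly b (v!1) * ((1 + v!1)\<^sup>2 * v!3))"
  \<comment> \<open>Regularity makes a + b w vanish wherever D does. Two conditions are needed to
    kill both a(x) and b(x): over x = 0 the single point is ramified, over x = 1 the second point
    lies outside chart 0, and over any other x there are two points with distinct w.\<close>
  have root: "poly a x = 0 \<and> poly b x = 0" if id: "?id D a b" and x: "poly D x = 0" for D a b x
  proof -
    have id': "poly D (v!1) * H v = G v * (poly a (v!1) + poly b (v!1) * ((1 + v!1)\<^sup>2 * v!3))"
      if "v \<in> aff 0" for v using id that by blast
    have at: "poly a x + poly b x * ((1 + x)\<^sup>2 * z!3) = 0" if z: "z \<in> aff 0" "z!1 = x" for z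
    proof -
      obtain A B where "B z \<noteq> 0" "\<And>v. v \<in> aff 0 \<Longrightarrow>
          B v * (poly a (v!1) + poly b (v!1) * ((1 + v!1)\<^sup>2 * v!3)) = poly D (v!1) * A v"
        using regular_quotient[OF chart_0 G id' dvd0[OF z(1)]] by metis
      from this(2)[OF z(1)] this(1) show ?thesis using x z(2) by simp
    qed
    consider "x = 0" | "x = 1" | "x \<noteq> 0" "x \<noteq> 1" by blast
    then show ?thesis
    proof cases
      case 1
      obtain z where z: "z \<in> aff 0" "z!1 = 0" using aff_ex[OF chart_0, of 0 1] add_self by auto
      obtain A B where AB: "reg 0 A" "reg 0 B" "B z \<noteq> 0" "\<And>v. v \<in> aff 0 \<Longrightarrow>
          B v * (poly a (v!1) + poly b (v!1) * ((1 + v!1)\<^sup>2 * v!3)) = poly D (v!1) * A v"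
        using regular_quotient[OF chart_0 G id' dvd0[OF z(1)]] by metis
      obtain D' where D: "D = pCons 0 D'" using x 1 by (cases D) auto
      have "poly a 0 = 0 \<and> poly b 0 = 0"
        by (rule divisible_at_zero[OF chart_0 z, of "\<lambda>v. poly D' (v!1) * A v" B])
          (use AB in \<open>simp_all add: D reg_mult reg_poly reg_coord mult_ac\<close>)
      then show ?thesis using 1 by simp
    next
      case 2
      obtain z where z: "z \<in> aff 0" "z!1 = 1" "z!3 = 0" using aff_ex[OF chart_0, of 1 0] add_self by auto
      have a: "poly a 1 = 0" using at[OF z(1)] z 2 by simp
      \<comment> \<open>The second point over x = 1 is (0:0:1:1), where X0 = 0. It is visible only
        with \<open>H'\<close> in chart 3, where a becomes a + c^2 x b.\<close>
      obtain u where u: "u \<in> aff 3" "u!2 = 1" "u!0 = 0" using aff_ex[OF chart_3, of 1 0] add_self by auto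
      obtain A B where "B u \<noteq> 0" "\<And>v. v \<in> aff 3 \<Longrightarrow>
          B v * (poly (a + [:0, c\<^sup>2:] * b) (v!2) + poly b (v!2) * ((1 + v!2)\<^sup>2 * v!0)) = poly D (v!2) * A v"
        using regular_quotient[OF chart_3 G quotient_in_chart_3[OF H H' G' HH' id'] dvd3[OF u(1)]] by metis
      from this(2)[OF u(1)] this(1) have "poly b 1 = 0" using x u 2 a c_nz by simp
      then show ?thesis using a 2 by simp
    next
      case 3
      obtain z where z: "z \<in> aff 0" "z!1 = x" "generic z" using aff_generic_ex[OF chart_0 3] by metis
      then have "z!3 \<noteq> 0" by (simp add: generic_def)
      then obtain z' where z': "z' \<in> aff 0" "z'!1 = x" "(1 + x)\<^sup>2 * z'!3 = (1 + x)\<^sup>2 * z!3 + c\<^sup>2 * x"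
        using aff_conj[OF chart_0 z(1)] z(2) by metis
      have 1: "poly a x + poly b x * ((1 + x)\<^sup>2 * z!3) = 0" using at[OF z(1,2)] .
      have "poly a x + poly b x * ((1 + x)\<^sup>2 * z!3 + c\<^sup>2 * x) = 0" using at[OF z'(1,2)] z'(3) by simp
      then have "(poly a x + poly b x * ((1 + x)\<^sup>2 * z!3)) + poly b x * (c\<^sup>2 * x) = 0"
        by (simp add: distrib_left add.assoc)
      then have "poly b x = 0" using 1 c_nz 3 by simp
      then show ?thesis using 1 by simp
    qed
  qed
  have "\<exists>a b. ?id 1 a b" if "D \<noteq> 0" "?id D a b" for D a b
    using that
  proof (induction "degree D" arbitrary: D a b)
    case 0
    then obtain e where e: "D = [:e:]" "e \<noteq> 0" by (metis degree_eq_zeroE pCons_0_0)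
    have "H v = G v * (poly (smult (1 / e) a) (v!1) + poly (smult (1 / e) b) (v!1) * ((1 + v!1)\<^sup>2 * v!3))"
      if v: "v \<in> aff 0" for v
    proof -
      have "e * H v = e * (G v * (poly (smult (1 / e) a) (v!1) + poly (smult (1 / e) b) (v!1) * ((1 + v!1)\<^sup>2 * v!3)))"
        using 0(3) v e by (simp add: distrib_left mult_ac)
      then show ?thesis using e(2) mult_left_cancel by blast
    qed
    then have "?id 1 (smult (1 / e) a) (smult (1 / e) b)" by simp
    then show ?case by blast
  next
    case (Suc n)
    obtain x where x: "poly D x = 0" using alg_closed_imp_poly_has_root[of D] Suc.hyps(2) by auto
    have "poly a x = 0" "poly b x = 0" using root[OF Suc.prems(2) x] by blast+
    then obtain a' b' D' where f: "a = [:- x, 1:] * a'" "b = [:- x, 1:] * b'" "D = [:- x, 1:] * D'"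
      using x unfolding poly_eq_0_iff_dvd by (auto elim!: dvdE)
    have D'1: "D' \<noteq> 0" using Suc.prems(1) f(3) by auto
    have "degree D = 1 + degree D'"
      unfolding f(3) using D'1 by (subst degree_mult_eq) simp_all
    then have D': "D' \<noteq> 0" "n = degree D'" using D'1 Suc.hyps(2) by simp_all
    have "finite {0, 1, x}" by simp
    then obtain x' where "x' \<notin> {0, 1, x}" using infinite_alg_closed ex_new_if_finite by blast
    then obtain u where u: "u \<in> aff 0" "u!1 + x \<noteq> 0"
      using aff_generic_ex[OF chart_0, of x'] by (auto simp: add_eq_0_iff_eq)
    have fac: "poly ([:- x, 1:] * p) (v!1) = (v!1 + x) * poly p (v!1)" for p and v :: "'a list"
      by (simp add: minus_self algebra_simps)
    have "?id D' a' b'"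
    proof
      fix v assume v: "v \<in> aff 0"
      show "poly D' (v!1) * H v = G v * (poly a' (v!1) + poly b' (v!1) * ((1 + v!1)\<^sup>2 * v!3))"
      proof (rule reg_cancel[where h = "\<lambda>v. v!1 + x", OF _ _ _ _ u _ v])
        show "reg 0 (\<lambda>v. v!1 + x)" "reg 0 (\<lambda>v. poly D' (v!1) * H v)"
          "reg 0 (\<lambda>v. G v * (poly a' (v!1) + poly b' (v!1) * ((1 + v!1)\<^sup>2 * v!3)))"
          by (intro reg_mult reg_add reg_power reg_poly reg_const reg_coord reg_form[OF H] reg_form[OF G']; simp)+
        fix v assume v: "v \<in> aff 0"
        have "(v!1 + x) * poly D' (v!1) * H v =
            G v * ((v!1 + x) * poly a' (v!1) + (v!1 + x) * poly b' (v!1) * ((1 + v!1)\<^sup>2 * v!3))"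
          using Suc.prems(2) v unfolding f fac by blast
        then show "(v!1 + x) * (poly D' (v!1) * H v) =
            (v!1 + x) * (G v * (poly a' (v!1) + poly b' (v!1) * ((1 + v!1)\<^sup>2 * v!3)))"
          by (simp only: distrib_left mult_ac)
      qed simp
    qed
    then show ?case using Suc.hyps(1)[OF D'(2,1)] by blast
  qed
  then obtain a b where id: "?id 1 a b" using quotient_normal_form[OF H G] by blast
  then have id: "H v = G v * (poly a (v!1) + poly b (v!1) * ((1 + v!1)\<^sup>2 * v!3))" if "v \<in> aff 0" for v
    using that by simp
  obtain T where T: "T \<in> aff 1" "T!0 = 0" using aff_ex[OF chart_1, of 0 1] add_self by auto
  \<comment> \<open>Behaviour at T, the only point over x = infinity. After reversal the top
    coefficients become values at 0 and the denominator a power of X0 / X1, so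
    \<open>divisible_at_zero\<close> lowers both bounds by one. At n = 0 they say that a has degree
    at most 1 and b = 0.\<close>
  have "\<forall>n. (\<forall>r>n + 1. coeff a r = 0) \<longrightarrow> (\<forall>r\<ge>n. coeff b r = 0) \<longrightarrow> (\<forall>r>1. coeff a r = 0) \<and> (\<forall>r. coeff b r = 0)"
  proof
    fix n show "(\<forall>r>n + 1. coeff a r = 0) \<longrightarrow> (\<forall>r\<ge>n. coeff b r = 0) \<longrightarrow> (\<forall>r>1. coeff a r = 0) \<and> (\<forall>r. coeff b r = 0)"
    proof (induction n)
      case (Suc n)
      show ?case
      proof (intro impI)
        assume a: "\<forall>r>Suc n + 1. coeff a r = 0" and b: "\<forall>r\<ge>Suc n. coeff b r = 0"
        obtain a' where a': "poly a' 0 = coeff a (n + 2)" "\<And>x. x \<noteq> 0 \<Longrightarrow> poly a' x = x ^ (n + 2) * poly a (1 / x)"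
          using reverse_poly_ex[of "n + 2" a] a by auto
        obtain b' where b': "poly b' 0 = coeff b n" "\<And>x. x \<noteq> 0 \<Longrightarrow> poly b' x = x ^ n * poly b (1 / x)"
          using reverse_poly_ex[of n b] b by auto
        have id1: "poly ([:0, 1:] ^ Suc n) (v!0) * H v = G v * (poly a' (v!0) + poly b' (v!0) * ((1 + v!0)\<^sup>2 * v!2))"
          if "v \<in> aff 1" for v
          using quotient_in_chart_1[OF H G' id a'(2) b'(2) that] by simp
        obtain A B where AB: "reg 1 A" "reg 1 B" "B T \<noteq> 0" "\<And>v. v \<in> aff 1 \<Longrightarrow>
            B v * (poly a' (v!0) + poly b' (v!0) * ((1 + v!0)\<^sup>2 * v!2)) = poly ([:0, 1:] ^ Suc n) (v!0) * A v"
          using regular_quotient[OF chart_1 G id1 dvd1[OF T(1)]] by metis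
        have "poly a' 0 = 0 \<and> poly b' 0 = 0"
          by (rule divisible_at_zero[OF chart_1 T, of "\<lambda>v. v!0 ^ n * A v" B])
            (use AB in \<open>simp_all add: reg_mult reg_power reg_coord mult_ac\<close>)
        then have z: "coeff a (n + 2) = 0" "coeff b n = 0" using a' b' by simp_all
        have "coeff a r = 0" if "r > n + 1" for r
          using a z(1) that by (cases "r = n + 2") auto
        moreover have "coeff b r = 0" if "r \<ge> n" for r
          using b z(2) that by (cases "r = n") auto
        ultimately show "(\<forall>r>1. coeff a r = 0) \<and> (\<forall>r. coeff b r = 0)" using Suc.IH by blast
      qed
    qed simp
  qed
  then have "(\<forall>r>1. coeff a r = 0) \<and> (\<forall>r. coeff b r = 0)"
    by (elim allE[of _ "degree a + degree b + 1"]) (auto simp: coeff_eq_0)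
  then have ab: "degree a \<le> 1" "b = 0" by (meson degree_le, simp add: poly_eq_iff)
  then have pa: "poly a x = coeff a 0 + coeff a 1 * x" for x
    using poly_eq_sum_atMost[of a 1 x] by simp
  have "H v = G v * (coeff a 0 * v!0 + coeff a 1 * v!1)" if v: "v \<in> EC_cone c" for v
  proof -
    have lin: "(\<lambda>v. coeff a 0 * v!0 + coeff a 1 * v!1) \<in> forms UNIV 4 1"
      by (intro U.forms_add U.forms_scale U.forms_coord) simp_all
    have gen: "H v = G v * (coeff a 0 * v!0 + coeff a 1 * v!1)" if v: "v \<in> EC_cone c" "generic v" for v
    proof -
      let ?s = "1 / v!0"
      have v0: "v!0 \<noteq> 0" using v(2) by (simp add: generic_def)
      have u: "map ((*) ?s) v \<in> aff 0" using aff_normalize[OF v(1) v0] by simp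
      have "?s ^ Suc d * H v = ?s ^ d * G v * (coeff a 0 + coeff a 1 * (?s * v!1))"
        using id[OF u] coneD(1)[OF v(1)] ab(2) unfolding form_scale[OF H v(1)] form_scale[OF G' v(1)] pa by simp
      then have "?s ^ d * (?s * H v) = ?s ^ d * (G v * (coeff a 0 + coeff a 1 * (?s * v!1)))"
        by (simp only: power_Suc mult_ac)
      then have "?s * H v = G v * (coeff a 0 + coeff a 1 * (?s * v!1))"
        by (rule mult_left_cancel[THEN iffD1, rotated]) (use v0 in simp)
      then show ?thesis using v0 by (simp add: field_simps)
    qed
    have "(\<lambda>v. H v + G v * (coeff a 0 * v!0 + coeff a 1 * v!1)) \<in> forms UNIV 4 (Suc d)"
      using U.forms_add[OF H] U.forms_mult[OF G' lin] by simp
    then have "H v + G v * (coeff a 0 * v!0 + coeff a 1 * v!1) = 0"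
      by (rule form_zero_if_generic_zero[OF _ _ v]) (simp add: gen add_self)
    then show ?thesis by (simp add: add_eq_0_iff_eq)
  qed
  then show ?thesis by blast
qed

end

section \<open>Fibres and linear equivalence of points\<close>

lemma proportional:
  fixes a0 a1 b0 b1 :: "'a::field"
  assumes "a0 \<noteq> 0 \<or> a1 \<noteq> 0" "b0 \<noteq> 0 \<or> b1 \<noteq> 0" "a0 * b1 = a1 * b0"
  obtains s where "s \<noteq> 0" "b0 = s * a0" "b1 = s * a1"
proof (cases "a0 = 0")
  case True
  then show ?thesis using that[of "b1 / a1"] assms by auto
next
  case False
  then have "b1 = (b0 / a0) * a1" using assms(3) by (simp add: field_simps)
  then show ?thesis using that[of "b0 / a0"] assms False by auto
qed

lemma length_4_eq: "length v = 4 \<Longrightarrow> v = [v!0, v!1, v!2, v!3]"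
  by (auto simp: numeral_eq_Suc length_Suc_conv)

definition lin :: "'a::field \<Rightarrow> 'a \<Rightarrow> 'a \<Rightarrow> 'a \<Rightarrow> 'a list \<Rightarrow> 'a" where
  "lin p q r s v = p * v!0 + q * v!1 + r * v!2 + s * v!3"

definition neg_vec :: "'a list \<Rightarrow> 'a list" where
  "neg_vec v = [v!3, v!2, v!1, v!0]"

definition neg_pt :: "'a list set \<Rightarrow> 'a list set" where
  "neg_pt Z = neg_vec ` Z"

text \<open>For (u0, u1) nonzero this says x(v) = (u0:u1), through both representations of x. It is
  void for u0 = u1 = 0, so a tuple can be used even at its common zeros.\<close>

definition lies_over :: "'a::field list \<Rightarrow> 'a \<Rightarrow> 'a \<Rightarrow> bool" where
  "lies_over v u0 u1 \<longleftrightarrow> u1 * v!0 = u0 * v!1 \<and> u1 * v!3 = u0 * v!2"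

lemma (in subring_set) forms_lin:
  assumes "p \<in> k" "q \<in> k" "r \<in> k" "s \<in> k"
  shows "lin p q r s \<in> forms k 4 1"
  unfolding lin_def[abs_def] using assms by (intro forms_add forms_scale forms_coord) simp_all

context char2_curve
begin

text \<open>A section of the skew-Segre embedding: (a0:a1) and (b0:b1) are homogeneous forms of x
  and y, and the curve equation becomes bihomogeneous.\<close>

lemma cone_param:
  assumes v: "v \<in> EC_cone c"
  obtains a0 a1 b0 b1 where "v = [a0 * b0, a1 * b0, a1 * b1, a0 * b1]"
    "a0 \<noteq> 0 \<or> a1 \<noteq> 0" "b0 \<noteq> 0 \<or> b1 \<noteq> 0" "(a0 + a1)\<^sup>2 * (b0 + b1)\<^sup>2 = c\<^sup>2 * a0 * a1 * b0 * b1"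
proof -
  note v' = coneD[OF v]
  have s: "v!0 * v!2 = v!1 * v!3" by (rule v'(4))
  have "\<exists>a0 a1 b0 b1. v!0 = a0 * b0 \<and> v!1 = a1 * b0 \<and> v!2 = a1 * b1 \<and> v!3 = a0 * b1 \<and>
      (a0 \<noteq> 0 \<or> a1 \<noteq> 0) \<and> (b0 \<noteq> 0 \<or> b1 \<noteq> 0)"
  proof -
    consider "v!0 \<noteq> 0" | "v!1 \<noteq> 0" | "v!2 \<noteq> 0" | "v!3 \<noteq> 0"
    proof -
      obtain n where "n < 4" "v!n \<noteq> 0"
        using v'(1,2) unfolding nonzero_def by (auto simp: in_set_conv_nth)
      then show ?thesis using that by (auto simp: less_Suc_eq numeral_eq_Suc)
    qed
    then show ?thesis
    proof cases
      case 1
      then show ?thesis using s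
        by (intro exI[of _ 1] exI[of _ "v!1 / v!0"] exI[of _ "v!0"] exI[of _ "v!3"]) (simp add: field_simps)
    next
      case 2
      then show ?thesis using s
        by (intro exI[of _ "v!0 / v!1"] exI[of _ 1] exI[of _ "v!1"] exI[of _ "v!2"]) (simp add: field_simps)
    next
      case 3
      then show ?thesis using s
        by (intro exI[of _ "v!3 / v!2"] exI[of _ 1] exI[of _ "v!1"] exI[of _ "v!2"]) (simp add: field_simps)
    next
      case 4
      then show ?thesis using s
        by (intro exI[of _ 1] exI[of _ "v!2 / v!3"] exI[of _ "v!0"] exI[of _ "v!3"]) (simp add: field_simps)
    qed
  qed
  then obtain a0 a1 b0 b1 where p: "v!0 = a0 * b0" "v!1 = a1 * b0" "v!2 = a1 * b1" "v!3 = a0 * b1"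
    "a0 \<noteq> 0 \<or> a1 \<noteq> 0" "b0 \<noteq> 0 \<or> b1 \<noteq> 0" by blast
  have "(a0 + a1)\<^sup>2 * (b0 + b1)\<^sup>2 = (v!0 + v!1 + v!2 + v!3)\<^sup>2"
    unfolding p by (simp add: ring2)
  also have "\<dots> = c\<^sup>2 * v!0 * v!2" by (rule v'(3))
  also have "\<dots> = c\<^sup>2 * a0 * a1 * b0 * b1" unfolding p by (simp only: mult_ac)
  finally have "(a0 + a1)\<^sup>2 * (b0 + b1)\<^sup>2 = c\<^sup>2 * a0 * a1 * b0 * b1" .
  moreover have "v = [a0 * b0, a1 * b0, a1 * b1, a0 * b1]"
    using length_4_eq[OF v'(1)] unfolding p .
  ultimately show ?thesis using that p by blast
qed

lemma param_cone:
  assumes "a0 \<noteq> 0 \<or> a1 \<noteq> 0" "b0 \<noteq> 0 \<or> b1 \<noteq> 0" "(a0 + a1)\<^sup>2 * (b0 + b1)\<^sup>2 = c\<^sup>2 * a0 * a1 * b0 * b1"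
  shows "[a0 * b0, a1 * b0, a1 * b1, a0 * b1] \<in> EC_cone c"
proof (rule coneI)
  let ?v = "[a0 * b0, a1 * b0, a1 * b1, a0 * b1]"
  show "nonzero ?v" using assms(1,2) by (auto simp: nonzero_def)
  have "(?v!0 + ?v!1 + ?v!2 + ?v!3)\<^sup>2 = (a0 + a1)\<^sup>2 * (b0 + b1)\<^sup>2"
    by (simp add: ring2)
  also have "\<dots> = c\<^sup>2 * ?v!0 * ?v!2"
    unfolding assms(3) by (simp add: mult_ac)
  finally show "(?v!0 + ?v!1 + ?v!2 + ?v!3)\<^sup>2 = c\<^sup>2 * ?v!0 * ?v!2" .
qed simp_all

lemma neg_vec_cone:
  assumes v: "v \<in> EC_cone c"
  shows "neg_vec v \<in> EC_cone c"
proof (rule coneI)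
  note v' = coneD[OF v]
  show "nonzero (neg_vec v)"
    using v'(2) length_4_eq[OF v'(1)] unfolding nonzero_def neg_vec_def
    by (metis (no_types, lifting) list.set_intros(1,2) list.simps(15) list.set(1) insert_iff empty_iff)
  show "(neg_vec v ! 0 + neg_vec v ! 1 + neg_vec v ! 2 + neg_vec v ! 3)\<^sup>2 = c\<^sup>2 * neg_vec v ! 0 * neg_vec v ! 2"
  proof -
    have "v!3 + v!2 + v!1 + v!0 = v!0 + v!1 + v!2 + v!3" by (simp only: add_ac)
    then have "(v!3 + v!2 + v!1 + v!0)\<^sup>2 = c\<^sup>2 * (v!1 * v!3)"
      using v'(3) by (simp only: v'(4)[symmetric] mult.assoc)
    then show ?thesis by (simp add: neg_vec_def mult_ac)
  qed
  show "neg_vec v ! 0 * neg_vec v ! 2 = neg_vec v ! 1 * neg_vec v ! 3"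
    using v'(4) by (simp add: neg_vec_def mult.commute)
qed (simp add: neg_vec_def)

lemma neg_vec_neg_vec: "v \<in> EC_cone c \<Longrightarrow> neg_vec (neg_vec v) = v"
  using length_4_eq[OF coneD(1)] by (simp add: neg_vec_def)

lemma neg_pt_pt:
  assumes "v \<in> EC_cone c"
  shows "neg_pt (pt v) = pt (neg_vec v)"
proof -
  have "neg_vec (map ((*) s) v) = map ((*) s) (neg_vec v)" for s
    using coneD(1)[OF assms] by (simp add: neg_vec_def)
  then have "neg_vec (map ((*) s) v) \<in> pt (neg_vec v) \<longleftrightarrow> map ((*) s) (neg_vec v) \<in> pt (neg_vec v)"
    "map ((*) s) (neg_vec v) = neg_vec (map ((*) s) v)" for s by simp_all
  then show ?thesis unfolding neg_pt_def pt_def by blast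
qed

lemma neg_pt_EC: "Z \<in> EC c \<Longrightarrow> neg_pt Z \<in> EC c"
  by (erule EC_E) (auto simp: neg_pt_pt EC_def intro: neg_vec_cone)

lemma neg_pt_neg_pt: "Z \<in> EC c \<Longrightarrow> neg_pt (neg_pt Z) = Z"
  by (erule EC_E) (simp add: neg_pt_pt neg_vec_cone neg_vec_neg_vec)

lemma pt_EC: "v \<in> EC_cone c \<Longrightarrow> pt v \<in> EC c"
  by (simp add: EC_def)

lemma pt_eq_param:
  assumes "a0 \<noteq> 0 \<or> a1 \<noteq> 0" "b0 \<noteq> 0 \<or> b1 \<noteq> 0" "a0' \<noteq> 0 \<or> a1' \<noteq> 0" "b0' \<noteq> 0 \<or> b1' \<noteq> 0"
    "a0 * a1' = a1 * a0'" "b0 * b1' = b1 * b0'"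
  shows "pt [a0 * b0, a1 * b0, a1 * b1, a0 * b1] = pt [a0' * b0', a1' * b0', a1' * b1', a0' * b1']"
proof -
  obtain r where r: "r \<noteq> 0" "a0' = r * a0" "a1' = r * a1" using proportional[OF assms(1,3,5)] .
  obtain s where s: "s \<noteq> 0" "b0' = s * b0" "b1' = s * b1" using proportional[OF assms(2,4,6)] .
  have "[a0' * b0', a1' * b0', a1' * b1', a0' * b1'] = map ((*) (r * s)) [a0 * b0, a1 * b0, a1 * b1, a0 * b1]"
    unfolding r s by (simp add: mult_ac)
  then show ?thesis using pt_scale[of "r * s" "[a0 * b0, a1 * b0, a1 * b1, a0 * b1]"] r(1) s(1) by simp
qed

lemma pt_eqD:
  assumes "pt v = pt w"
  obtains s where "s \<noteq> 0" "w = map ((*) s) v"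
proof -
  have "w \<in> pt v" using assms pt_self by simp
  then show ?thesis using that by (rule ptE)
qed

lemma over_scale:
  assumes "v \<in> EC_cone c" "s \<noteq> 0"
  shows "lies_over (map ((*) s) v) u0 u1 \<longleftrightarrow> lies_over v u0 u1"
  using coneD(1)[OF assms(1)] assms(2) by (simp add: lies_over_def mult.left_commute[of _ s])

lemma over_neg_vec: "lies_over (neg_vec v) u0 u1 \<longleftrightarrow> lies_over v u0 u1"
  by (auto simp: lies_over_def neg_vec_def)

lemma over_param:
  assumes "b0 \<noteq> 0 \<or> b1 \<noteq> 0"
  shows "lies_over [a0 * b0, a1 * b0, a1 * b1, a0 * b1] u0 u1 \<longleftrightarrow> u1 * a0 = u0 * a1"
  using assms by (auto simp: lies_over_def mult.assoc[symmetric])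

lemma over_pt_eq:
  assumes "v \<in> EC_cone c" "pt v = pt w \<or> pt v = pt (neg_vec w)" "lies_over w u0 u1" "w \<in> EC_cone c"
  shows "lies_over v u0 u1"
  using assms(2)
proof
  assume "pt v = pt w"
  then obtain s where "s \<noteq> 0" "w = map ((*) s) v" by (rule pt_eqD)
  then show ?thesis using assms over_scale by simp
next
  assume "pt v = pt (neg_vec w)"
  then obtain s where "s \<noteq> 0" "neg_vec w = map ((*) s) v" by (rule pt_eqD)
  then have "lies_over (neg_vec w) u0 u1 \<longleftrightarrow> lies_over v u0 u1" using assms over_scale by simp
  then show ?thesis using assms(3) over_neg_vec[of w u0 u1] by blast
qed

lemma same_fibre:
  assumes v: "v \<in> EC_cone c" and w: "w \<in> EC_cone c" and u: "u0 \<noteq> 0 \<or> u1 \<noteq> 0"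
    and ov: "lies_over v u0 u1" and ow: "lies_over w u0 u1"
  shows "pt v = pt w \<or> pt v = pt (neg_vec w)"
proof -
  obtain a0 a1 b0 b1 where p: "v = [a0 * b0, a1 * b0, a1 * b1, a0 * b1]"
    "a0 \<noteq> 0 \<or> a1 \<noteq> 0" "b0 \<noteq> 0 \<or> b1 \<noteq> 0" "(a0 + a1)\<^sup>2 * (b0 + b1)\<^sup>2 = c\<^sup>2 * a0 * a1 * b0 * b1"
    using v by (rule cone_param)
  obtain a0' a1' b0' b1' where q: "w = [a0' * b0', a1' * b0', a1' * b1', a0' * b1']"
    "a0' \<noteq> 0 \<or> a1' \<noteq> 0" "b0' \<noteq> 0 \<or> b1' \<noteq> 0" "(a0' + a1')\<^sup>2 * (b0' + b1')\<^sup>2 = c\<^sup>2 * a0' * a1' * b0' * b1'"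
    using w by (rule cone_param)
  have "u0 * a1 = u1 * a0" using ov unfolding p(1) over_param[OF p(3)] by simp
  then obtain r where r: "r \<noteq> 0" "a0 = r * u0" "a1 = r * u1" using proportional[OF u p(2)] by metis
  have "u0 * a1' = u1 * a0'" using ow unfolding q(1) over_param[OF q(3)] by simp
  then obtain r' where r': "r' \<noteq> 0" "a0' = r' * u0" "a1' = r' * u1" using proportional[OF u q(2)] by metis
  have aa: "a0 * a1' = a1 * a0'" unfolding r r' by (simp only: mult_ac)
  have e: "(u0 + u1)\<^sup>2 * (b0 + b1)\<^sup>2 = c\<^sup>2 * u0 * u1 * b0 * b1"
  proof -
    have "r\<^sup>2 * ((u0 + u1)\<^sup>2 * (b0 + b1)\<^sup>2) = r\<^sup>2 * (c\<^sup>2 * u0 * u1 * b0 * b1)"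
      using p(4) unfolding r by (simp add: distrib_left[symmetric] power_mult_distrib power2_eq_square mult_ac)
    then show ?thesis using r(1) by simp
  qed
  have e': "(u0 + u1)\<^sup>2 * (b0' + b1')\<^sup>2 = c\<^sup>2 * u0 * u1 * b0' * b1'"
  proof -
    have "r'\<^sup>2 * ((u0 + u1)\<^sup>2 * (b0' + b1')\<^sup>2) = r'\<^sup>2 * (c\<^sup>2 * u0 * u1 * b0' * b1')"
      using q(4) unfolding r' by (simp add: distrib_left[symmetric] power_mult_distrib power2_eq_square mult_ac)
    then show ?thesis using r'(1) by simp
  qed
  \<comment> \<open>Eliminating x from the two curve equations leaves this product; its factors say
    that the two values of y are inverse to each other or equal.\<close>
  have prod: "(b0 + b1)\<^sup>2 * (b0' * b1') + (b0' + b1')\<^sup>2 * (b0 * b1) = (b0 * b0' + b1 * b1') * (b0 * b1' + b1 * b0')"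
    by (simp add: ring2)
  have "(b0 * b0' + b1 * b1') * (b0 * b1' + b1 * b0') = 0"
  proof (cases "u0 + u1 = 0")
    case True
    then have "u0 = u1" by (simp add: add_eq_0_iff_eq)
    moreover have "c\<^sup>2 * u0 * u1 * b0 * b1 = 0" "c\<^sup>2 * u0 * u1 * b0' * b1' = 0"
      unfolding e[symmetric] e'[symmetric] True by simp_all
    ultimately have "b0 * b1 = 0" "b0' * b1' = 0" using u c_nz by auto
    then show ?thesis unfolding prod[symmetric] by (simp only: mult_zero_right add_0_left)
  next
    case False
    have "(u0 + u1)\<^sup>2 * ((b0 + b1)\<^sup>2 * (b0' * b1') + (b0' + b1')\<^sup>2 * (b0 * b1)) =
        ((u0 + u1)\<^sup>2 * (b0 + b1)\<^sup>2) * (b0' * b1') + ((u0 + u1)\<^sup>2 * (b0' + b1')\<^sup>2) * (b0 * b1)"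
      by (simp add: algebra_simps)
    also have "\<dots> = 0" unfolding e e' by (simp add: mult_ac add_self)
    finally show ?thesis using False unfolding prod by simp
  qed
  then consider "b0 * b1' = b1 * b0'" | "b0 * b0' = b1 * b1'"
    by (auto simp: add_eq_0_iff_eq)
  then show ?thesis
  proof cases
    case 1
    then show ?thesis unfolding p(1) q(1) using pt_eq_param[OF p(2,3) q(2,3) aa] by simp
  next
    case 2
    have "pt v = pt [a0' * b1', a1' * b1', a1' * b0', a0' * b0']"
      unfolding p(1) using pt_eq_param[OF p(2,3) q(2) _ aa 2] q(3) by blast
    then show ?thesis by (simp add: q(1) neg_vec_def)
  qed
qed

lemma special_points: "[1,0,0,1] \<in> EC_cone c" "[1,1,0,0] \<in> EC_cone c" "[0,1,1,0] \<in> EC_cone c" "[0,0,1,1] \<in> EC_cone c"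
  by (auto intro!: coneI simp: nonzero_def add_self)

lemma generic_ex: obtains v where "v \<in> EC_cone c" "generic v"
proof -
  have "finite {0, 1 :: 'a}" by simp
  then obtain x :: 'a where "x \<notin> {0, 1}" using infinite_alg_closed ex_new_if_finite by blast
  then obtain v where "v \<in> aff 0" "generic v" using aff_generic_ex[OF chart_0, of x] by auto
  then show ?thesis using that by (auto simp: aff_def)
qed

text \<open>The curve spans the space: the only plane through the four special points is X0 + X1 +
  X2 + X3 = 0, and it misses every point with X0 X2 nonzero.\<close>

lemma lin_nzform:
  assumes "p \<noteq> 0 \<or> q \<noteq> 0 \<or> r \<noteq> 0 \<or> s \<noteq> 0"
  shows "nzform 1 (lin p q r s)"
proof (rule ccontr)
  have "lin p q r s \<in> forms UNIV 4 1" by (rule U.forms_lin) simp_all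
  moreover assume "\<not> nzform 1 (lin p q r s)"
  ultimately have z: "\<And>v. v \<in> EC_cone c \<Longrightarrow> lin p q r s v = 0" by (auto simp: nzform_def)
  have "p + s = 0" "p + q = 0" "q + r = 0" "r + s = 0"
    using special_points[THEN z] by (simp_all add: lin_def)
  then have eq: "q = p" "r = p" "s = p" by (simp_all add: add_eq_0_iff_eq)
  obtain v where v: "v \<in> EC_cone c" "generic v" by (rule generic_ex)
  have "p * (v!0 + v!1 + v!2 + v!3) = 0"
    using z[OF v(1)] unfolding lin_def eq by (simp add: distrib_left)
  moreover have "p \<noteq> 0" using assms eq by auto
  moreover have "(v!0 + v!1 + v!2 + v!3)\<^sup>2 \<noteq> 0"
    unfolding coneD(3)[OF v(1)] using v(2) c_nz by (simp add: generic_def)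
  ultimately show False by simp
qed

lemma ord_at_lin_uniformizer:
  assumes "v \<in> EC_cone c"
  shows "v!0 \<noteq> 0 \<Longrightarrow> v!1 \<noteq> 0 \<Longrightarrow> ord_at c (pt v) (lin (v!1) (v!0) 0 0) = 1"
    "v!1 \<noteq> 0 \<Longrightarrow> v!2 \<noteq> 0 \<Longrightarrow> ord_at c (pt v) (lin 0 (v!2) (v!1) 0) = 1"
    "v!3 \<noteq> 0 \<Longrightarrow> v!2 \<noteq> 0 \<Longrightarrow> ord_at c (pt v) (lin 0 0 (v!3) (v!2)) = 1"
    "v!0 \<noteq> 0 \<Longrightarrow> v!3 \<noteq> 0 \<Longrightarrow> ord_at c (pt v) (lin (v!3) 0 0 (v!0)) = 1"
proof -
  have *: "ord_at c (pt v) F = 1"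
    if "(i,j,k,l) \<in> charts" "v!i \<noteq> 0" "v!j \<noteq> 0" "\<And>u. F u = v!i * u!j + v!j * u!i" for i j k l F
    using ord_at_uniformizer[OF that(1) assms that(2,3)]
      ord_at_cong[of F "\<lambda>u. v!i * u!j + v!j * u!i"] that(4) by simp
  show "v!0 \<noteq> 0 \<Longrightarrow> v!1 \<noteq> 0 \<Longrightarrow> ord_at c (pt v) (lin (v!1) (v!0) 0 0) = 1"
    by (rule *[OF chart_0]) (simp_all add: lin_def)
  show "v!1 \<noteq> 0 \<Longrightarrow> v!2 \<noteq> 0 \<Longrightarrow> ord_at c (pt v) (lin 0 (v!2) (v!1) 0) = 1"
    by (rule *[OF chart_12]) (simp_all add: lin_def)
  show "v!3 \<noteq> 0 \<Longrightarrow> v!2 \<noteq> 0 \<Longrightarrow> ord_at c (pt v) (lin 0 0 (v!3) (v!2)) = 1"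
    by (rule *[OF chart_3]) (simp_all add: lin_def)
  show "v!0 \<noteq> 0 \<Longrightarrow> v!3 \<noteq> 0 \<Longrightarrow> ord_at c (pt v) (lin (v!3) 0 0 (v!0)) = 1"
    by (rule *[OF chart_03]) (simp_all add: lin_def)
qed

lemma ord_at_lin_scale:
  assumes "z \<in> EC_cone c" "e \<noteq> 0" "p \<noteq> 0 \<or> q \<noteq> 0 \<or> r \<noteq> 0 \<or> s \<noteq> 0"
  shows "ord_at c (pt z) (lin (e * p) (e * q) (e * r) (e * s)) = ord_at c (pt z) (lin p q r s)"
proof -
  have "lin (e * p) (e * q) (e * r) (e * s) = (\<lambda>v. e * lin p q r s v)"
    by (simp add: lin_def fun_eq_iff distrib_left mult.assoc)
  then show ?thesis using ord_at_scale[OF assms(1) lin_nzform[OF assms(3)] assms(2)] by simp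
qed

lemma ord_at_lin_eq_0:
  assumes "z \<in> EC_cone c" "lin p q r s z \<noteq> 0"
  shows "ord_at c (pt z) (lin p q r s) = 0"
proof -
  have "p \<noteq> 0 \<or> q \<noteq> 0 \<or> r \<noteq> 0 \<or> s \<noteq> 0" using assms(2) by (auto simp: lin_def)
  then show ?thesis using ord_at_eq_0_iff[OF assms(1) lin_nzform] assms(2) by simp
qed

text \<open>At O and T the forms X0 + X3 and X1 + X2 are uniformizers. The curve equation expresses
  their squares, up to units, by X1 and X0 respectively, so these have order 2.\<close>

lemma ord_at_ramified:
  assumes z: "z \<in> EC_cone c"
  shows "z!1 = 0 \<Longrightarrow> z!2 = 0 \<Longrightarrow> ord_at c (pt z) (lin 0 1 0 0) = 2"
    "z!0 = 0 \<Longrightarrow> z!3 = 0 \<Longrightarrow> ord_at c (pt z) (lin 1 0 0 0) = 2"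
proof -
  note z' = coneD[OF z] and Z = pt_EC[OF z]
  have nz: "z!0 \<noteq> 0 \<or> z!1 \<noteq> 0 \<or> z!2 \<noteq> 0 \<or> z!3 \<noteq> 0"
    using z'(2) length_4_eq[OF z'(1)] unfolding nonzero_def by (metis empty_iff insert_iff list.set(1) list.simps(15))
  have *: "2 * ord_at c (pt z) (lin p0 p1 0 0) + 2 * ord_at c (pt z) (lin s0 s1 s2 s3) =
      2 * ord_at c (pt z) m + ord_at c (pt z) n + ord_at c (pt z) n'"
    if nzf: "nzform 1 (lin p0 p1 0 0)" "nzform 1 (lin s0 s1 s2 s3)" "nzform 1 m" "nzform 1 n" "nzform 1 n'"
      and eq: "\<And>v. v \<in> EC_cone c \<Longrightarrow> (lin p0 p1 0 0 v)\<^sup>2 * (lin s0 s1 s2 s3 v)\<^sup>2 = c\<^sup>2 * ((m v)\<^sup>2 * (n v * n' v))"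
    for p0 p1 s0 s1 s2 s3 m n n'
  proof -
    have sq: "nzform (1 + 1) (\<lambda>v. (g v)\<^sup>2)" if "nzform 1 g" for g
      using nzform_mult[OF that that] by (simp add: power2_eq_square)
    have "2 * ord_at c (pt z) (lin p0 p1 0 0) + 2 * ord_at c (pt z) (lin s0 s1 s2 s3) =
        ord_at c (pt z) (\<lambda>v. (lin p0 p1 0 0 v)\<^sup>2 * (lin s0 s1 s2 s3 v)\<^sup>2)"
      using ord_at_mult[OF Z sq[OF nzf(1)] sq[OF nzf(2)]] ord_at_power2[OF Z] nzf by simp
    also have "\<dots> = ord_at c (pt z) (\<lambda>v. c\<^sup>2 * ((m v)\<^sup>2 * (n v * n' v)))"
      by (rule ord_at_cong[OF eq])
    also have "\<dots> = ord_at c (pt z) (\<lambda>v. (m v)\<^sup>2 * (n v * n' v))"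
      using c_nz by (intro ord_at_scale[OF z nzform_mult[OF sq[OF nzf(3)] nzform_mult[OF nzf(4,5)]]]) simp
    also have "\<dots> = 2 * ord_at c (pt z) m + ord_at c (pt z) n + ord_at c (pt z) n'"
      using ord_at_mult[OF Z sq[OF nzf(3)] nzform_mult[OF nzf(4,5)]] ord_at_mult[OF Z nzf(4,5)]
        ord_at_power2[OF Z nzf(3)] by simp
    finally show ?thesis .
  qed
  have eq0: "(lin 1 1 0 0 v)\<^sup>2 * (lin 1 0 0 1 v)\<^sup>2 = c\<^sup>2 * ((lin 1 0 0 0 v)\<^sup>2 * (lin 0 1 0 0 v * lin 0 0 0 1 v))"
    "(lin 1 1 0 0 v)\<^sup>2 * (lin 0 1 1 0 v)\<^sup>2 = c\<^sup>2 * ((lin 0 1 0 0 v)\<^sup>2 * (lin 1 0 0 0 v * lin 0 0 1 0 v))"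
    if v: "v \<in> EC_cone c" for v
  proof -
    note v' = coneD(3,4)[OF v]
    have "(v!0 + v!1) * (v!0 + v!3) = v!0 * (v!0 + v!1 + v!3) + v!1 * v!3" by (simp add: algebra_simps)
    then have 1: "(v!0 + v!1) * (v!0 + v!3) = v!0 * (v!0 + v!1 + v!2 + v!3)"
      unfolding v'(2)[symmetric] by (simp add: algebra_simps)
    have "(v!0 + v!1)\<^sup>2 * (v!0 + v!3)\<^sup>2 = (v!0)\<^sup>2 * (c\<^sup>2 * (v!0 * v!2))"
      unfolding power_mult_distrib[symmetric] 1 power_mult_distrib v'(1) by (simp only: mult.assoc)
    then show "(lin 1 1 0 0 v)\<^sup>2 * (lin 1 0 0 1 v)\<^sup>2 = c\<^sup>2 * ((lin 1 0 0 0 v)\<^sup>2 * (lin 0 1 0 0 v * lin 0 0 0 1 v))"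
      unfolding v'(2) by (simp add: lin_def mult_ac)
    have "(v!0 + v!1) * (v!1 + v!2) = v!1 * (v!0 + v!1 + v!2) + v!0 * v!2" by (simp add: algebra_simps)
    then have 2: "(v!0 + v!1) * (v!1 + v!2) = v!1 * (v!0 + v!1 + v!2 + v!3)"
      unfolding v'(2) by (simp add: algebra_simps)
    have "(v!0 + v!1)\<^sup>2 * (v!1 + v!2)\<^sup>2 = (v!1)\<^sup>2 * (c\<^sup>2 * v!0 * v!2)"
      unfolding power_mult_distrib[symmetric] 2 power_mult_distrib v'(1) by (simp only: mult.assoc)
    then show "(lin 1 1 0 0 v)\<^sup>2 * (lin 0 1 1 0 v)\<^sup>2 = c\<^sup>2 * ((lin 0 1 0 0 v)\<^sup>2 * (lin 1 0 0 0 v * lin 0 0 1 0 v))"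
      by (simp add: lin_def mult_ac)
  qed
  note zero = ord_at_lin_eq_0[OF z]
  show "ord_at c (pt z) (lin 0 1 0 0) = 2" if "z!1 = 0" "z!2 = 0"
  proof -
    have "(z!0 + z!3)\<^sup>2 = 0" using z'(3) that by simp
    then have 03: "z!3 = z!0" "z!0 \<noteq> 0" using nz that by (auto simp: add_eq_0_iff_eq)
    have "ord_at c (pt z) (lin (z!0 * 1) (z!0 * 0) (z!0 * 0) (z!0 * 1)) = 1"
      using ord_at_lin_uniformizer(4)[OF z] 03 by simp
    then have "ord_at c (pt z) (lin 1 0 0 1) = 1"
      using ord_at_lin_scale[OF z 03(2), of 1 0 0 1] by simp
    moreover have "ord_at c (pt z) (lin 1 1 0 0) = 0" "ord_at c (pt z) (lin 1 0 0 0) = 0" "ord_at c (pt z) (lin 0 0 0 1) = 0"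
      using 03 that by (auto intro!: zero simp: lin_def)
    ultimately show ?thesis
      using *[OF lin_nzform[of 1 1 0 0] lin_nzform[of 1 0 0 1] lin_nzform[of 1 0 0 0] lin_nzform[of 0 1 0 0] lin_nzform[of 0 0 0 1] eq0(1)] by simp
  qed
  show "ord_at c (pt z) (lin 1 0 0 0) = 2" if "z!0 = 0" "z!3 = 0"
  proof -
    have "(z!1 + z!2)\<^sup>2 = 0" using z'(3) that by simp
    then have 12: "z!2 = z!1" "z!1 \<noteq> 0" using nz that by (auto simp: add_eq_0_iff_eq)
    have "ord_at c (pt z) (lin (z!1 * 0) (z!1 * 1) (z!1 * 1) (z!1 * 0)) = 1"
      using ord_at_lin_uniformizer(2)[OF z] 12 by simp
    then have "ord_at c (pt z) (lin 0 1 1 0) = 1"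
      using ord_at_lin_scale[OF z 12(2), of 0 1 1 0] by simp
    moreover have "ord_at c (pt z) (lin 1 1 0 0) = 0" "ord_at c (pt z) (lin 0 1 0 0) = 0" "ord_at c (pt z) (lin 0 0 1 0) = 0"
      using 12 that by (auto intro!: zero simp: lin_def)
    ultimately show ?thesis
      using *[OF lin_nzform[of 1 1 0 0] lin_nzform[of 0 1 1 0] lin_nzform[of 0 1 0 0] lin_nzform[of 1 0 0 0] lin_nzform[of 0 0 1 0] eq0(2)] by simp
  qed
qed

text \<open>The linear form \<open>u\<^sub>1 X\<^sub>0 + u\<^sub>0 X\<^sub>1\<close> cuts out the fibre of \<open>x\<close> over \<open>(u\<^sub>0:u\<^sub>1)\<close> and the divisor of
  the other factor \<open>B\<^sub>0\<close> of \<open>X\<^sub>0, X\<^sub>1\<close>, whose multiplicity is \<open>base_ord\<close>.\<close>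

definition base_ord :: "'a list \<Rightarrow> nat" where
  "base_ord z = (if z!0 = 0 \<and> z!1 = 0 then ord_at c (pt z) (lin 1 0 0 0) else 0)"

text \<open>Only q and -q lie in the fibre. If they coincide, the two indicators add up to 2, in
  accordance with the ramification of x at the fixed points of inversion.\<close>

lemma ord_at_fibre:
  assumes z: "z \<in> EC_cone c" and q: "q \<in> EC_cone c" and ov: "lies_over q u0 u1" and u: "u0 \<noteq> 0 \<or> u1 \<noteq> 0"
  shows "ord_at c (pt z) (lin u1 u0 0 0) =
    base_ord z + of_bool (pt z = pt q) + of_bool (pt z = neg_pt (pt q))"
proof -
  obtain a0 a1 b0 b1 where p: "z = [a0 * b0, a1 * b0, a1 * b1, a0 * b1]"
    "a0 \<noteq> 0 \<or> a1 \<noteq> 0" "b0 \<noteq> 0 \<or> b1 \<noteq> 0" "(a0 + a1)\<^sup>2 * (b0 + b1)\<^sup>2 = c\<^sup>2 * a0 * a1 * b0 * b1"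
    using z by (rule cone_param)
  have Z: "pt z \<in> EC c" using z by (rule pt_EC)
  note zero = ord_at_lin_eq_0[OF z]
  have on_fibre: "pt z = pt q \<or> pt z = pt (neg_vec q) \<longleftrightarrow> lies_over z u0 u1"
    using over_pt_eq[OF z _ ov q] same_fibre[OF z q u _ ov] by blast
  have ov_z: "lies_over z u0 u1 \<longleftrightarrow> u1 * a0 = u0 * a1" unfolding p(1) by (rule over_param[OF p(3)])
  have neg: "neg_pt (pt q) = pt (neg_vec q)" by (rule neg_pt_pt[OF q])
  \<comment> \<open>If b0 = 0, both X0 and X1 vanish at z. By X0 X2 = X1 X3 the form u1 X0 + u0 X1
    may be traded for u0 X2 + u1 X3, which cuts out the same fibre without the common
    factor.\<close>
  have shift: "ord_at c (pt z) (lin u1 u0 0 0) = ord_at c (pt z) (lin 0 0 u0 u1) + ord_at c (pt z) (lin 1 0 0 0)"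
    if b0: "b0 = 0"
  proof -
    have a: "a0 = a1" "b1 \<noteq> 0" "a0 \<noteq> 0" using p b0 by (auto simp: add_eq_0_iff_eq)
    have "ord_at c (pt z) (\<lambda>v. lin u1 u0 0 0 v * lin 0 0 0 1 v) = ord_at c (pt z) (\<lambda>v. lin 0 0 u0 u1 v * lin 1 0 0 0 v)"
    proof (rule ord_at_cong)
      fix v assume "v \<in> EC_cone c"
      from coneD(4)[OF this] show "lin u1 u0 0 0 v * lin 0 0 0 1 v = lin 0 0 u0 u1 v * lin 1 0 0 0 v"
        by (simp add: lin_def algebra_simps)
    qed
    moreover have "nzform 1 (lin u1 u0 0 0)" "nzform 1 (lin 0 0 u0 u1)" using u by (intro lin_nzform; blast)+
    moreover have "ord_at c (pt z) (lin 0 0 0 1) = 0" using a p(1) by (intro zero) (simp add: lin_def)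
    ultimately show ?thesis
      using ord_at_mult[OF Z _ lin_nzform[of 0 0 0 1]] ord_at_mult[OF Z _ lin_nzform[of 1 0 0 0]] by simp
  qed
  have base: "base_ord z = (if b0 = 0 then ord_at c (pt z) (lin 1 0 0 0) else 0)"
    using p(1,2) by (auto simp: base_ord_def)
  show ?thesis
  proof (cases "lies_over z u0 u1")
    case False
    then have nz: "u1 * a0 + u0 * a1 \<noteq> 0" using ov_z by (simp add: add_eq_0_iff_eq)
    have ind: "pt z \<noteq> pt q" "pt z \<noteq> neg_pt (pt q)" using False on_fibre neg by auto
    show ?thesis
    proof (cases "b0 = 0")
      case True
      have "lin 0 0 u0 u1 z = (u1 * a0 + u0 * a1) * b1" by (simp add: lin_def p(1) algebra_simps)
      then have "lin 0 0 u0 u1 z \<noteq> 0" using nz p(3) True by simp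
      then show ?thesis using shift[OF True] zero ind base True by simp
    next
      case b0: False
      have "lin u1 u0 0 0 z = (u1 * a0 + u0 * a1) * b0" by (simp add: lin_def p(1) algebra_simps)
      then have "lin u1 u0 0 0 z \<noteq> 0" using nz b0 by simp
      then show ?thesis using zero ind base b0 by simp
    qed
  next
    case True
    then have "a0 * u1 = a1 * u0" using ov_z by (simp only: mult.commute)
    then obtain s where s: "s \<noteq> 0" "u0 = s * a0" "u1 = s * a1" using proportional[OF p(2) u] by metis
    have self: "pt z = pt (neg_vec z) \<Longrightarrow> of_bool (pt z = pt q) + of_bool (pt z = neg_pt (pt q)) = (2::nat)"
      using on_fibre True neg neg_pt_pt[OF z] neg_pt_neg_pt[OF pt_EC[OF q]] by (auto simp: neg)
    have other: "pt z \<noteq> pt (neg_vec z) \<Longrightarrow> of_bool (pt z = pt q) + of_bool (pt z = neg_pt (pt q)) = (1::nat)"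
      using on_fibre True neg neg_pt_pt[OF z] neg_pt_neg_pt[OF pt_EC[OF q]] by (auto simp: neg)
    have neg_z: "neg_vec z = [a0 * b1, a1 * b1, a1 * b0, a0 * b0]" by (simp add: neg_vec_def p(1))
    consider "b0 = 0" | "b0 \<noteq> 0" "a0 = 0" | "b0 \<noteq> 0" "a1 = 0" | "b0 \<noteq> 0" "a0 \<noteq> 0" "a1 \<noteq> 0" by blast
    then show ?thesis
    proof cases
      case 1
      then have a: "a0 = a1" "b1 \<noteq> 0" "a0 \<noteq> 0" using p by (auto simp: add_eq_0_iff_eq)
      have "ord_at c (pt z) (lin (s * 0) (s * 0) (s * a0) (s * a0)) = ord_at c (pt z) (lin 0 0 a0 a0)"
        using s(1) a by (intro ord_at_lin_scale[OF z]) simp_all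
      also have "\<dots> = ord_at c (pt z) (lin (b1 * 0) (b1 * 0) (b1 * a0) (b1 * a0))"
        using a by (intro ord_at_lin_scale[OF z, symmetric]) simp_all
      also have "\<dots> = 1"
        using ord_at_lin_uniformizer(3)[OF z] a by (simp add: p(1) mult.commute)
      finally have "ord_at c (pt z) (lin 0 0 u0 u1) = 1" using s a by simp
      moreover have "pt z \<noteq> pt (neg_vec z)"
      proof
        assume "pt z = pt (neg_vec z)"
        then obtain r where "neg_vec z = map ((*) r) z" by (rule pt_eqD)
        then show False unfolding neg_z using a 1 p(1) by simp
      qed
      ultimately show ?thesis using shift[OF 1] other base 1 by simp
    next
      case 2
      then have b: "b0 = b1" using p by (auto simp: add_eq_0_iff_eq)
      have "ord_at c (pt z) (lin (u1 * 1) (u1 * 0) (u1 * 0) (u1 * 0)) = ord_at c (pt z) (lin 1 0 0 0)"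
        using u s 2 by (intro ord_at_lin_scale[OF z]) auto
      also have "\<dots> = 2" using 2 by (intro ord_at_ramified(2)[OF z]) (simp_all add: p(1))
      finally have "ord_at c (pt z) (lin u1 u0 0 0) = 2" using s 2 by simp
      moreover have "pt z = pt (neg_vec z)" unfolding neg_z unfolding p(1) b ..
      ultimately show ?thesis using self base 2 by simp
    next
      case 3
      then have b: "b0 = b1" using p by (auto simp: add_eq_0_iff_eq)
      have "ord_at c (pt z) (lin (u0 * 0) (u0 * 1) (u0 * 0) (u0 * 0)) = ord_at c (pt z) (lin 0 1 0 0)"
        using u s 3 by (intro ord_at_lin_scale[OF z]) auto
      also have "\<dots> = 2" using 3 by (intro ord_at_ramified(1)[OF z]) (simp_all add: p(1))
      finally have "ord_at c (pt z) (lin u1 u0 0 0) = 2" using s 3 by simp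
      moreover have "pt z = pt (neg_vec z)" unfolding neg_z unfolding p(1) b ..
      ultimately show ?thesis using self base 3 by simp
    next
      case 4
      have "ord_at c (pt z) (lin (s * a1) (s * a0) (s * 0) (s * 0)) = ord_at c (pt z) (lin a1 a0 0 0)"
        using s(1) 4 by (intro ord_at_lin_scale[OF z]) simp_all
      also have "\<dots> = ord_at c (pt z) (lin (b0 * a1) (b0 * a0) (b0 * 0) (b0 * 0))"
        using 4 by (intro ord_at_lin_scale[OF z, symmetric]) simp_all
      also have "\<dots> = 1"
        using ord_at_lin_uniformizer(1)[OF z] 4 by (simp add: p(1) mult.commute)
      finally have "ord_at c (pt z) (lin u1 u0 0 0) = 1" using s by simp
      moreover have "pt z \<noteq> pt (neg_vec z)"
      proof
        assume "pt z = pt (neg_vec z)"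
        then obtain r where r: "neg_vec z = map ((*) r) z" by (rule pt_eqD)
        then have "a0 * b1 = r * (a0 * b0)" "a0 * b0 = r * (a0 * b1)" unfolding neg_z unfolding p(1) by simp_all
        then have "b1 = r * b0" "b0 = r * b1" using 4 by simp_all
        then have "b1 * b1 = b0 * b0" by (metis mult.assoc mult.commute)
        then have "(b0 + b1)\<^sup>2 = 0"
          unfolding square_add unfolding power2_eq_square by (simp only: add_self)
        then have "b0 = b1" by (simp add: add_eq_0_iff_eq)
        then show False using p(4) 4 c_nz by (simp add: add_self)
      qed
      ultimately show ?thesis using other base 4 by simp
    qed
  qed
qed

lemma fibre_point_ex:
  assumes "u0 \<noteq> 0 \<or> u1 \<noteq> 0"
  obtains q where "q \<in> EC_cone c" "lies_over q u0 u1"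
proof -
  consider "u0 = 0" | "u1 = 0" | "u0 = u1" | "u0 \<noteq> 0" "u1 \<noteq> 0" "u0 \<noteq> u1" by blast
  then show ?thesis
  proof cases
    case 1 then show ?thesis using that[OF special_points(3)] by (simp add: lies_over_def)
  next
    case 2 then show ?thesis using that[OF special_points(1)] by (simp add: lies_over_def)
  next
    case 3 then show ?thesis using that[OF special_points(2)] by (simp add: lies_over_def)
  next
    case 4
    then obtain q where q: "q \<in> aff 0" "q!1 = u1 / u0" using aff_generic_ex[OF chart_0, of "u1 / u0"] by auto
    then have "lies_over q u0 u1"
      using 4 affD(2,3)[OF chart_0 q(1)] by (simp add: lies_over_def)
    then show ?thesis using that q(1) by (auto simp: aff_def)
  qed
qed

lemma over_ex:
  assumes "q \<in> EC_cone c"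
  obtains u0 u1 where "u0 \<noteq> 0 \<or> u1 \<noteq> 0" "lies_over q u0 u1"
proof -
  obtain a0 a1 b0 b1 where p: "q = [a0 * b0, a1 * b0, a1 * b1, a0 * b1]"
    "a0 \<noteq> 0 \<or> a1 \<noteq> 0" "b0 \<noteq> 0 \<or> b1 \<noteq> 0"
    using assms by (rule cone_param)
  show ?thesis
    by (rule that[of a0 a1]) (use p in \<open>simp_all add: lies_over_def mult_ac\<close>)
qed

section \<open>Principal divisors\<close>

lemma principalI:
  assumes "nzform d F" "nzform d G" "\<And>z. z \<in> EC_cone c \<Longrightarrow> D (pt z) = int (ord_at c (pt z) F) - int (ord_at c (pt z) G)"
  shows "principal c D"
proof -
  have "\<forall>Z\<in>EC c. D Z = int (ord_at c Z F) - int (ord_at c Z G)"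
    using assms(3) by (auto simp: EC_def)
  then show ?thesis using assms(1,2) unfolding principal_def nzform_def by blast
qed

lemma principalE:
  assumes "principal c D"
  obtains d F G where "nzform d F" "nzform d G" "\<forall>Z\<in>EC c. D Z = int (ord_at c Z F) - int (ord_at c Z G)"
  using assms unfolding principal_def nzform_def by blast

lemma principal_diff:
  assumes "principal c D" "principal c D'"
  shows "principal c (\<lambda>Z. D Z - D' Z)"
proof -
  obtain d F G where 1: "nzform d F" "nzform d G" "\<forall>Z\<in>EC c. D Z = int (ord_at c Z F) - int (ord_at c Z G)"
    using assms(1) by (rule principalE)
  obtain d' F' G' where 2: "nzform d' F'" "nzform d' G'" "\<forall>Z\<in>EC c. D' Z = int (ord_at c Z F') - int (ord_at c Z G')"
    using assms(2) by (rule principalE)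
  show ?thesis
  proof (rule principalI[OF nzform_mult[OF 1(1) 2(2)] nzform_mult[OF 1(2) 2(1)]])
    fix z assume "z \<in> EC_cone c"
    then have Z: "pt z \<in> EC c" by (rule pt_EC)
    show "D (pt z) - D' (pt z) = int (ord_at c (pt z) (\<lambda>v. F v * G' v)) - int (ord_at c (pt z) (\<lambda>v. G v * F' v))"
      using ord_at_mult[OF Z 1(1) 2(2)] ord_at_mult[OF Z 1(2) 2(1)] bspec[OF 1(3) Z] bspec[OF 2(3) Z] by simp
  qed
qed

text \<open>Let F / G have divisor (A) - (B). Multiplied by the form of the fibre through B it
  acquires at most the poles of x, hence is linear in x, so A and -B make up a whole fibre. Fibres
  are stable under inversion, which gives A = B.\<close>

lemma principal_two_points:
  assumes A: "A \<in> EC c" and B: "B \<in> EC c" and pr: "principal c (\<lambda>Z. point_div A Z - point_div B Z)"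
  shows "A = B"
proof -
  obtain d F G where F: "nzform d F" and G: "nzform d G"
    and "\<forall>Z\<in>EC c. point_div A Z - point_div B Z = int (ord_at c Z F) - int (ord_at c Z G)"
    using pr by (rule principalE)
  note FG = bspec[OF this(3)]
  obtain b where b: "b \<in> EC_cone c" "B = pt b" using B by (rule EC_E)
  obtain u0 u1 where u: "u0 \<noteq> 0 \<or> u1 \<noteq> 0" "lies_over b u0 u1" using over_ex[OF b(1)] .
  have L: "nzform 1 (lin u1 u0 0 0)" and L': "nzform 1 (lin 0 0 u0 u1)" using u(1) by (intro lin_nzform; blast)+
  have H: "nzform (d + 1) (\<lambda>v. F v * lin u1 u0 0 0 v)" and H': "nzform (d + 1) (\<lambda>v. F v * lin 0 0 u0 u1 v)"
    by (rule nzform_mult[OF F L], rule nzform_mult[OF F L'])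
  have dvd: "loc_dvd c Z G (\<lambda>v. F v * M v)" if Z: "Z \<in> EC c" and M: "nzform 1 M" "M b = 0" for Z M
  proof -
    have "ord_at c Z G \<le> ord_at c Z F + ord_at c Z M"
    proof (cases "Z = B")
      case True
      have "ord_at c Z M \<ge> 1" using ord_at_eq_0_iff[OF b(1) M(1)] M(2) True b(2) by simp
      then show ?thesis using FG[OF Z] by (simp add: point_div_def split: if_splits)
    next
      case False
      then show ?thesis using FG[OF Z] by (simp add: point_div_def split: if_splits)
    qed
    then show ?thesis
      unfolding loc_dvd_iff_ord_le[OF Z G nzform_mult[OF F M(1)]] ord_at_mult[OF Z F M(1)] .
  qed
  have Lb: "lin u1 u0 0 0 b = 0" "lin 0 0 u0 u1 b = 0"
    using u(2) by (simp_all add: lin_def lies_over_def add_self add.commute)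
  have "\<exists>\<alpha> \<gamma>. \<forall>v\<in>EC_cone c. F v * lin u1 u0 0 0 v = G v * (\<alpha> * v!0 + \<gamma> * v!1)"
  proof (rule sections_of_fibre[where H' = "\<lambda>v. F v * lin 0 0 u0 u1 v", OF _ _ G])
    show "(\<lambda>v. F v * lin u1 u0 0 0 v) \<in> forms UNIV 4 (Suc d)" "(\<lambda>v. F v * lin 0 0 u0 u1 v) \<in> forms UNIV 4 (Suc d)"
      using H H' by (simp_all add: nzform_def)
    show "F v * lin 0 0 u0 u1 v * v!0 = F v * lin u1 u0 0 0 v * v!3" if "v \<in> EC_cone c" for v
      using coneD(4)[OF that] by (simp add: lin_def algebra_simps)
  qed (use dvd L L' Lb in blast)+
  then obtain \<alpha> \<gamma> where eq: "\<And>v. v \<in> EC_cone c \<Longrightarrow> F v * lin u1 u0 0 0 v = G v * lin \<alpha> \<gamma> 0 0 v"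
    by (auto simp: lin_def)
  have u': "\<gamma> \<noteq> 0 \<or> \<alpha> \<noteq> 0"
  proof (rule ccontr)
    assume "\<not> ?thesis"
    then have "\<And>v. v \<in> EC_cone c \<Longrightarrow> F v * lin u1 u0 0 0 v = 0" using eq by (simp add: lin_def)
    then show False using H by (auto simp: nzform_def)
  qed
  obtain q where q: "q \<in> EC_cone c" "lies_over q \<gamma> \<alpha>" using fibre_point_ex[OF u'] .
  have M: "nzform 1 (lin \<alpha> \<gamma> 0 0)" using u' by (intro lin_nzform) blast
  \<comment> \<open>The common zeros of X0 and X1 contribute equally to both sides; what remains is
    the equality of the divisors (A) + (-B) and (q) + (-q).\<close>
  have ind: "of_bool (Z = A) + of_bool (Z = neg_pt B) = (of_bool (Z = pt q) + of_bool (Z = neg_pt (pt q)) :: nat)"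
    if Z: "Z \<in> EC c" for Z
  proof -
    obtain z where z: "z \<in> EC_cone c" "Z = pt z" using Z by (rule EC_E)
    have "ord_at c Z F + ord_at c Z (lin u1 u0 0 0) = ord_at c Z G + ord_at c Z (lin \<alpha> \<gamma> 0 0)"
      using ord_at_cong[OF eq] ord_at_mult[OF Z F L] ord_at_mult[OF Z G M] by simp
    then have nat_eq: "ord_at c Z F + (base_ord z + of_bool (Z = B) + of_bool (Z = neg_pt B)) =
        ord_at c Z G + (base_ord z + of_bool (Z = pt q) + of_bool (Z = neg_pt (pt q)))"
      using ord_at_fibre[OF z(1) b(1) u(2,1)] ord_at_fibre[OF z(1) q(1) q(2) u'] unfolding z(2) b(2) by simp
    have "of_bool (Z = A) - of_bool (Z = B) = int (ord_at c Z F) - int (ord_at c Z G)"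
      using FG[OF Z] unfolding point_div_def of_bool_def .
    then have "int (of_bool (Z = A) + of_bool (Z = neg_pt B)) = int (of_bool (Z = pt q) + of_bool (Z = neg_pt (pt q)))"
      using arg_cong[OF nat_eq, of int] unfolding of_nat_add of_nat_of_bool by linarith
    then show ?thesis by (simp only: of_nat_eq_iff)
  qed
  have Q: "pt q \<in> EC c" using q(1) by (rule pt_EC)
  have "pt q = A \<or> pt q = neg_pt B" using ind[OF Q] by (cases "pt q = A"; cases "pt q = neg_pt B") simp_all
  then show ?thesis
  proof
    assume QA: "pt q = A"
    have "neg_pt B = neg_pt A" using ind[OF neg_pt_EC[OF B]] unfolding QA by (cases "neg_pt B = neg_pt A") simp_all
    then show ?thesis using neg_pt_neg_pt[OF B] neg_pt_neg_pt[OF A] by metis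
  next
    assume QB: "pt q = neg_pt B"
    show ?thesis
      using ind[OF A] unfolding QB neg_pt_neg_pt[OF B] by (cases "A = B") simp_all
  qed
qed

end

section \<open>Divisors of chords\<close>

context char2_curve
begin

section \<open>Invariance of orders under inversion\<close>

lemma forms_neg: "F \<in> forms UNIV 4 d \<Longrightarrow> (\<lambda>v. F (neg_vec v)) \<in> forms UNIV 4 d"
  for F :: "'a list \<Rightarrow> 'a"
proof (induction rule: U.forms_induct)
  case (coord d f n)
  have "neg_vec v ! n = v ! (3 - n)" for v :: "'a list"
    using coord.hyps by (auto simp: neg_vec_def less_Suc_eq numeral_eq_Suc)
  moreover have "3 - n < 4" by simp
  ultimately show ?case
    using U.forms_mult[OF U.forms_coord[of "3 - n" 4] coord.IH] by simp
qed (auto intro: U.forms_const U.forms_zero U.forms_add)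

lemma neg_vec_pt: "z \<in> EC_cone c \<Longrightarrow> x \<in> pt (neg_vec z) \<Longrightarrow> neg_vec x \<in> pt z"
  using neg_pt_pt[OF neg_vec_cone, of z] neg_vec_neg_vec[of z] by (auto simp: neg_pt_def)

lemma loc_dvd_neg:
  assumes z: "z \<in> EC_cone c" and dvd: "loc_dvd c (pt z) F G"
  shows "loc_dvd c (pt (neg_vec z)) (\<lambda>v. F (neg_vec v)) (\<lambda>v. G (neg_vec v))"
proof -
  obtain d e A B where A: "A \<in> forms UNIV 4 d" and B: "B \<in> forms UNIV 4 e"
    and nz: "\<forall>x\<in>pt z. B x \<noteq> 0" and eq: "\<forall>y\<in>EC_cone c. B y * G y = A y * F y"
    using dvd unfolding loc_dvd_def by blast
  show ?thesis
    using nz neg_vec_pt[OF z] eq neg_vec_cone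
    by (intro loc_dvdI[OF forms_neg[OF A] forms_neg[OF B]] ballI) blast+
qed

lemma loc_dvd_cong:
  assumes "\<And>v. v \<in> EC_cone c \<Longrightarrow> F v = F' v" "\<And>v. v \<in> EC_cone c \<Longrightarrow> G v = G' v"
  shows "loc_dvd c Z F G \<longleftrightarrow> loc_dvd c Z F' G'"
  unfolding loc_dvd_def using assms by simp

lemma uniformizer_dvd:
  assumes "uniformizer c Z t" "F \<in> forms UNIV 4 d" "\<forall>x\<in>Z. F x = 0"
  shows "loc_dvd c Z t F"
  using assms unfolding uniformizer_def by blast

lemma uniformizerI:
  assumes "t \<in> forms UNIV 4 d" "\<forall>x\<in>Z. t x = 0"
    "\<And>d F. F \<in> forms UNIV 4 d \<Longrightarrow> \<forall>x\<in>Z. F x = 0 \<Longrightarrow> loc_dvd c Z t F"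
  shows "uniformizer c Z t"
  using assms unfolding uniformizer_def by blast

lemma uniformizer_neg:
  assumes z: "z \<in> EC_cone c" and t: "uniformizer c (pt z) t"
  shows "uniformizer c (pt (neg_vec z)) (\<lambda>v. t (neg_vec v))"
proof -
  obtain d where d: "t \<in> forms UNIV 4 d" using t unfolding uniformizer_def by blast
  have t0: "\<forall>x\<in>pt (neg_vec z). t (neg_vec x) = 0"
    using t neg_vec_pt[OF z] unfolding uniformizer_def by auto
  show ?thesis
  proof (rule uniformizerI[OF forms_neg[OF d] t0])
    fix e F assume F: "F \<in> forms UNIV 4 e" "\<forall>x\<in>pt (neg_vec z). F x = 0"
    have "\<forall>x\<in>pt z. F (neg_vec x) = 0"
      using F(2) neg_vec_pt[OF neg_vec_cone[OF z]] neg_vec_neg_vec[OF z] by auto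
    then have "loc_dvd c (pt z) t (\<lambda>v. F (neg_vec v))"
      by (rule uniformizer_dvd[OF t forms_neg[OF F(1)]])
    from loc_dvd_neg[OF z this] show "loc_dvd c (pt (neg_vec z)) (\<lambda>v. t (neg_vec v)) F"
      by (subst loc_dvd_cong[OF refl, of _ "\<lambda>v. F (neg_vec (neg_vec v))"]) (simp_all add: neg_vec_neg_vec)
  qed
qed

text \<open>Inversion maps local rings and uniformizers to one another. This is needed at its fixed
  points, where a linear form and its conjugate must be shown to have the same order.\<close>

lemma ord_at_neg:
  assumes z: "z \<in> EC_cone c" and F: "nzform d F"
  shows "ord_at c (pt (neg_vec z)) (\<lambda>v. F (neg_vec v)) = ord_at c (pt z) F"
proof -
  obtain i j k l z' where cp: "chart_point c i j k l z'" and Z: "pt z = pt z'"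
    using chart_point_cases[OF pt_EC[OF z]] by metis
  interpret C: chart_point c i j k l z' by (rule cp)
  obtain i' j' k' l' w where cp': "chart_point c i' j' k' l' w" and W: "pt (neg_vec z) = pt w"
    using chart_point_cases[OF pt_EC[OF neg_vec_cone[OF z]]] by metis
  interpret C': chart_point c i' j' k' l' w by (rule cp')
  have F': "F \<in> forms UNIV 4 d" using F by (simp add: nzform_def)
  obtain u where u: "u \<in> EC_cone c" "F u \<noteq> 0" using F by (auto simp: nzform_def)
  let ?n = "ord_at c (pt z) F" and ?s = "\<lambda>v. C.t (neg_vec v)"
  have "loc_dvd c (pt z) (\<lambda>v. C.t v ^ ?n) F"
    unfolding Z C.loc_dvd_iff[OF C.t_power_form F'] by (rule C.ord_at_associated(1)[OF F' u])
  from loc_dvd_neg[OF z this] have 1: "loc_dvd c (pt w) (\<lambda>v. ?s v ^ ?n) (\<lambda>v. F (neg_vec v))"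
    unfolding W .
  have "loc_dvd c (pt z) F (\<lambda>v. C.t v ^ ?n)"
    unfolding Z C.loc_dvd_iff[OF F' C.t_power_form] by (rule C.ord_at_associated(2)[OF F' u])
  from loc_dvd_neg[OF z this] have 2: "loc_dvd c (pt w) (\<lambda>v. F (neg_vec v)) (\<lambda>v. ?s v ^ ?n)"
    unfolding W .
  have s: "uniformizer c (pt w) ?s"
    unfolding W[symmetric] by (rule uniformizer_neg[OF z]) (simp add: Z C.uniformizer_t)
  have sf: "(\<lambda>v. ?s v ^ ?n) \<in> forms UNIV 4 (?n * 1)"
    by (rule U.forms_power[OF forms_neg[OF C.t_form]])
  note a = C'.uniformizer_associated(2,3)[OF s]
  have n1: "ldvd i' w (\<lambda>v. C'.t v ^ ?n) (\<lambda>v. F (neg_vec v))"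
    by (rule ldvd_trans[OF C'.ldvd_power[OF a(1)]])
      (use 1 in \<open>simp only: C'.loc_dvd_iff[OF sf forms_neg[OF F']]\<close>)
  have n2: "ldvd i' w (\<lambda>v. F (neg_vec v)) (\<lambda>v. C'.t v ^ ?n)"
    by (rule ldvd_trans[OF _ C'.ldvd_power[OF a(2)]])
      (use 2 in \<open>simp only: C'.loc_dvd_iff[OF forms_neg[OF F'] sf]\<close>)
  have "ord_at c (pt w) (\<lambda>v. F (neg_vec v)) = ?n"
    by (rule C'.ord_at_eqI[OF forms_neg[OF F'] n1 n2])
  then show ?thesis by (simp add: W)
qed

lemma neg_fixed:
  assumes z: "z \<in> EC_cone c" and "z!0 = z!3"
  shows "neg_vec z = z"
proof -
  note v = coneD[OF z]
  have "z!0 * (z!1 + z!2) = 0" unfolding distrib_left using v(4) assms(2) by (metis add_self mult.commute)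
  moreover have "z!0 = 0 \<Longrightarrow> (z!1 + z!2)\<^sup>2 = 0" using v(3) assms(2) by simp
  ultimately have "z!1 + z!2 = 0" by auto
  then have "z!1 = z!2" by (simp only: add_eq_0_iff_eq)
  then show ?thesis using length_4_eq[OF v(1)] assms(2) unfolding neg_vec_def by simp
qed

lemma lin_pt_zero_iff:
  assumes "z \<in> EC_cone c" "w \<in> EC_cone c" "pt z = pt w"
  shows "lin p q r s z = 0 \<longleftrightarrow> lin p q r s w = 0"
proof -
  have "lin p q r s \<in> forms UNIV 4 1" by (rule U.forms_lin) simp_all
  then show ?thesis using form_pt_zero_iff[OF _ assms(2), of _ 1 z] pt_self[of z] assms(3) by simp
qed

definition chord_cubic :: "'a \<Rightarrow> 'a \<Rightarrow> 'a \<Rightarrow> 'a \<Rightarrow> 'a \<Rightarrow> 'a" where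
  "chord_cubic \<alpha> \<beta> \<gamma> A0 A1 = (A0 + A1)\<^sup>2 * (\<alpha> + \<beta>)\<^sup>2 * A0 + c\<^sup>2 * A1 * (\<alpha> * A0 + \<gamma> * A1) * (\<beta> * A0 + \<gamma> * A1)"

text \<open>The planes \<open>\<alpha> X\<^sub>0 + \<beta> X\<^sub>3 + \<gamma> (X\<^sub>1 + X\<^sub>2) = 0\<close> are those through \<open>T = (0:1:1:0)\<close>. Projection from
  \<open>T\<close> maps the curve to a plane cubic with flex \<open>O\<close>, and these planes are the lines of that plane;
  the cubic form above gives the \<open>x\<close>-coordinates of the three further intersection points.\<close>

lemma chord_norm:
  assumes v: "v \<in> EC_cone c" and v_eq: "v = [a0 * b0, a1 * b0, a1 * b1, a0 * b1]"
    and cur: "(a0 + a1)\<^sup>2 * (b0 + b1)\<^sup>2 = c\<^sup>2 * a0 * a1 * b0 * b1"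
  shows "(a0 + a1)\<^sup>2 * (lin \<alpha> \<gamma> \<gamma> \<beta> v * lin \<beta> \<gamma> \<gamma> \<alpha> v) = a0 * b0 * b1 * chord_cubic \<alpha> \<beta> \<gamma> a0 a1"
proof -
  have "lin \<alpha> \<gamma> \<gamma> \<beta> v * lin \<beta> \<gamma> \<gamma> \<alpha> v =
      a0\<^sup>2 * (\<alpha> + \<beta>)\<^sup>2 * b0 * b1 + (b0 + b1)\<^sup>2 * ((\<alpha> * a0 + \<gamma> * a1) * (\<beta> * a0 + \<gamma> * a1))"
    unfolding lin_def v_eq by (simp add: ring2)
  then have "(a0 + a1)\<^sup>2 * (lin \<alpha> \<gamma> \<gamma> \<beta> v * lin \<beta> \<gamma> \<gamma> \<alpha> v) =
      (a0 + a1)\<^sup>2 * a0\<^sup>2 * (\<alpha> + \<beta>)\<^sup>2 * b0 * b1 + ((a0 + a1)\<^sup>2 * (b0 + b1)\<^sup>2) * ((\<alpha> * a0 + \<gamma> * a1) * (\<beta> * a0 + \<gamma> * a1))"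
    by (simp add: distrib_left mult_ac)
  also have "\<dots> = a0 * b0 * b1 * chord_cubic \<alpha> \<beta> \<gamma> a0 a1"
    unfolding cur chord_cubic_def by (simp add: distrib_left power2_eq_square mult_ac)
  finally show ?thesis .
qed

lemma EC_O_neg: "neg_pt EC_O = (EC_O :: 'a list set)" and EC_O_mem: "EC_O \<in> EC c"
  using neg_pt_pt[OF special_points(1)] special_points(1) by (simp_all add: EC_O_def neg_vec_def EC_def)

definition sum_div :: "'a list set \<Rightarrow> 'a list set \<Rightarrow> 'a list set \<Rightarrow> 'a list set \<Rightarrow> int" where
  "sum_div P Q R Z = point_div P Z + point_div Q Z - point_div R Z - point_div EC_O Z"

text \<open>The plane l of the chord meets the curve in q, y, T and a point s over (r0:r1). With R =
  -s, the plane G through s and R also contains O and T, so l / G has divisor (q) + (y) - (R) - (O).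
  The orders are read off from an identity between the product of l with its conjugate, the fibre
  forms and G^2.\<close>

lemma chord_principal:
  assumes q: "q \<in> EC_cone c" "q0 \<noteq> 0 \<or> q1 \<noteq> 0" "lies_over q q0 q1"
    and y: "y \<in> EC_cone c" "y0 \<noteq> 0 \<or> y1 \<noteq> 0" "lies_over y y0 y1"
    and r: "r0 \<noteq> 0 \<or> r1 \<noteq> 0" and \<alpha>\<beta>: "\<alpha> \<noteq> \<beta>"
    and cubic: "\<And>A0 A1. chord_cubic \<alpha> \<beta> \<gamma> A0 A1 = \<kappa> * (q1 * A0 + q0 * A1) * (y1 * A0 + y0 * A1) * (r1 * A0 + r0 * A1)"
    and lq: "lin \<alpha> \<gamma> \<gamma> \<beta> q = 0" and ly: "lin \<alpha> \<gamma> \<gamma> \<beta> y = 0"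
  obtains R where "R \<in> EC_cone c" "lies_over R r0 r1" "principal c (sum_div (pt q) (pt y) (pt R))"
proof -
  have "chord_cubic \<alpha> \<beta> \<gamma> 1 0 = (\<alpha> + \<beta>)\<^sup>2" by (simp add: chord_cubic_def)
  then have k: "\<kappa> \<noteq> 0" using cubic[of 1 0] \<alpha>\<beta> by (auto simp: add_eq_0_iff_eq)
  \<comment> \<open>The ratio (b0:b1) solves the equation of the plane over x = (r0:r1). For r0 = 0
    the point must be T, while the general formula could give (0:0).\<close>
  define b0 where "b0 = (if r0 = 0 then 1 else \<beta> * r0 + \<gamma> * r1)"
  define b1 where "b1 = (if r0 = 0 then 1 else \<alpha> * r0 + \<gamma> * r1)"
  define s where "s = [r0 * b0, r1 * b0, r1 * b1, r0 * b1]"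
  have b: "b0 \<noteq> 0 \<or> b1 \<noteq> 0"
  proof (cases "r0 = 0")
    case False
    then have "b0 + b1 = (\<alpha> + \<beta>) * r0" by (simp add: b0_def b1_def ring2)
    then show ?thesis using False \<alpha>\<beta> by (auto simp: add_eq_0_iff_eq)
  qed (simp add: b0_def)
  have s: "s \<in> EC_cone c"
    unfolding s_def
  proof (rule param_cone[OF r b])
    have "chord_cubic \<alpha> \<beta> \<gamma> r0 r1 = 0" unfolding cubic by (simp add: mult.commute add_self)
    then have "r0 * chord_cubic \<alpha> \<beta> \<gamma> r0 r1 = 0" by simp
    moreover have "r0 * chord_cubic \<alpha> \<beta> \<gamma> r0 r1 = (r0 + r1)\<^sup>2 * (b0 + b1)\<^sup>2 + c\<^sup>2 * r0 * r1 * b0 * b1"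
    proof (cases "r0 = 0")
      case False
      then have b': "b0 = \<beta> * r0 + \<gamma> * r1" "b1 = \<alpha> * r0 + \<gamma> * r1" by (simp_all add: b0_def b1_def)
      have sum: "b0 + b1 = (\<alpha> + \<beta>) * r0" unfolding b' by (simp add: ring2)
      show ?thesis
        unfolding chord_cubic_def sum unfolding b' by (simp add: algebra_simps power2_eq_square)
    qed (simp add: b0_def b1_def add_self)
    ultimately show "(r0 + r1)\<^sup>2 * (b0 + b1)\<^sup>2 = c\<^sup>2 * r0 * r1 * b0 * b1" by (simp only: add_eq_0_iff_eq)
  qed
  have ls: "lin \<alpha> \<gamma> \<gamma> \<beta> s = 0"
    by (cases "r0 = 0") (simp_all add: s_def lin_def b0_def b1_def ring2)
  have over_s: "lies_over s r0 r1" unfolding s_def over_param[OF b] by (rule mult.commute)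
  define R where "R = neg_vec s"
  have R: "R \<in> EC_cone c" "lies_over R r0 r1" and nR: "neg_pt (pt R) = pt s"
    using neg_vec_cone[OF s] over_s neg_pt_pt[OF neg_vec_cone[OF s]] neg_vec_neg_vec[OF s]
    by (simp_all add: R_def over_neg_vec)
  let ?l = "lin \<alpha> \<gamma> \<gamma> \<beta>" and ?ls = "lin \<beta> \<gamma> \<gamma> \<alpha>" and ?G = "lin r1 r0 r0 r1"
  let ?lam = "\<lambda>u0 u1. lin u1 u0 0 0"
  have nz: "nzform 1 ?l" "nzform 1 ?ls" "nzform 1 ?G" "nzform 1 (?lam r0 r1)" "nzform 1 (?lam q0 q1)"
    "nzform 1 (?lam y0 y1)" "nzform 1 (?lam 1 0)"
    using \<alpha>\<beta> r q(2) y(2) by (intro lin_nzform; auto)+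
  \<comment> \<open>\<open>?lam 1 0\<close> cuts out the fibre of O, which is O counted twice;
    \<open>chord_norm\<close> makes the two products agree on the curve.\<close>
  define M where "M = (\<lambda>v. c\<^sup>2 * (?l v * ?ls v * (?lam r0 r1 v * ?lam 1 0 v)))"
  define N where "N = (\<lambda>v. \<kappa> * (?lam q0 q1 v * ?lam y0 y1 v * (?G v * ?G v)))"
  have nzM: "nzform (1 + 1 + (1 + 1)) (\<lambda>v. ?l v * ?ls v * (?lam r0 r1 v * ?lam 1 0 v))"
    and nzN: "nzform (1 + 1 + (1 + 1)) (\<lambda>v. ?lam q0 q1 v * ?lam y0 y1 v * (?G v * ?G v))"
    using nz by (intro nzform_mult; simp)+
  have MN: "M v = N v" if v: "v \<in> EC_cone c" for v
  proof -
    have Mf: "M \<in> forms UNIV 4 (1 + 1 + (1 + 1))" "N \<in> forms UNIV 4 (1 + 1 + (1 + 1))"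
      unfolding M_def N_def using nzM nzN unfolding nzform_def by (intro U.forms_scale UNIV_I; blast)+
    \<comment> \<open>\<open>chord_norm\<close> carries the factor (a0 + a1)^2, so the identity is
      proved after multiplication by (X0 + X1)^2, which irreducibility allows to be
      cancelled.\<close>
    have "(\<forall>v\<in>EC_cone c. (lin 1 1 0 0 v)\<^sup>2 = 0) \<or> (\<forall>v\<in>EC_cone c. M v + N v = 0)"
    proof (rule form_domain[OF _ U.forms_add[OF Mf]])
      show "(\<lambda>v. (lin 1 1 0 0 v)\<^sup>2) \<in> forms UNIV 4 (2 * 1)"
        by (rule U.forms_power[OF U.forms_lin]) simp_all
      fix v assume v: "v \<in> EC_cone c"
      obtain a0 a1 d0 d1 where p: "v = [a0 * d0, a1 * d0, a1 * d1, a0 * d1]"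
        "(a0 + a1)\<^sup>2 * (d0 + d1)\<^sup>2 = c\<^sup>2 * a0 * a1 * d0 * d1"
        using cone_param[OF v] by metis
      have lam: "?lam u0 u1 v = d0 * (u1 * a0 + u0 * a1)" for u0 u1
        by (simp add: lin_def p(1) algebra_simps)
      have G: "?G v = (d0 + d1) * (r1 * a0 + r0 * a1)"
        by (simp add: lin_def p(1) algebra_simps)
      let ?r = "r1 * a0 + r0 * a1" and ?q = "q1 * a0 + q0 * a1" and ?y = "y1 * a0 + y0 * a1"
      have "(lin 1 1 0 0 v)\<^sup>2 * M v = d0\<^sup>2 * c\<^sup>2 * ((a0 + a1)\<^sup>2 * (?l v * ?ls v)) * (d0 * ?r * (d0 * a1))"
      proof -
        have "lin 1 1 0 0 v = d0 * (a0 + a1)" by (simp add: lin_def p(1) algebra_simps)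
        moreover have "?lam 1 0 v = d0 * a1" unfolding lam by simp
        ultimately show ?thesis unfolding M_def lam by (simp only: power_mult_distrib mult_ac)
      qed
      also have "\<dots> = \<kappa> * d0\<^sup>2 * (d0 * ?q * (d0 * ?y)) * (?r * ?r) * (c\<^sup>2 * a0 * a1 * d0 * d1)"
        unfolding chord_norm[OF v p] cubic by (simp only: mult_ac power2_eq_square)
      also have "\<dots> = (lin 1 1 0 0 v)\<^sup>2 * N v"
      proof -
        have "lin 1 1 0 0 v = d0 * (a0 + a1)" by (simp add: lin_def p(1) algebra_simps)
        then show ?thesis unfolding N_def lam G p(2)[symmetric] by (simp only: power_mult_distrib power2_eq_square mult_ac)
      qed
      finally show "(lin 1 1 0 0 v)\<^sup>2 * (M v + N v) = 0" by (simp only: distrib_left add_self)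
    qed
    moreover have "\<not> (\<forall>v\<in>EC_cone c. (lin 1 1 0 0 v)\<^sup>2 = 0)"
      using lin_nzform[of 1 1 0 0] by (auto simp: nzform_def)
    ultimately show ?thesis using v by (auto simp: add_eq_0_iff_eq)
  qed
  have "principal c (sum_div (pt q) (pt y) (pt R))"
  proof (rule principalI[OF nz(1,3)])
    fix z assume z: "z \<in> EC_cone c"
    let ?Z = "pt z"
    have Z: "?Z \<in> EC c" by (rule pt_EC[OF z])
    have fib: "ord_at c ?Z (?lam u0 u1) = base_ord z + of_bool (?Z = pt w) + of_bool (?Z = neg_pt (pt w))"
      if "w \<in> EC_cone c" "u0 \<noteq> 0 \<or> u1 \<noteq> 0" "lies_over w u0 u1" for w u0 u1
      by (rule ord_at_fibre[OF z that(1,3,2)])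
    have fR: "ord_at c ?Z (?lam r0 r1) = base_ord z + of_bool (?Z = pt R) + of_bool (?Z = neg_pt (pt R))"
      by (rule fib[OF R(1) r R(2)])
    have fO: "ord_at c ?Z (?lam 1 0) = base_ord z + of_bool (?Z = EC_O) + of_bool (?Z = EC_O)"
      using fib[OF special_points(1), of 1 0] EC_O_neg unfolding EC_O_def by (simp add: lies_over_def)
    have ord_eq: "ord_at c ?Z ?l + ord_at c ?Z ?ls + (ord_at c ?Z (?lam r0 r1) + ord_at c ?Z (?lam 1 0)) =
        ord_at c ?Z (?lam q0 q1) + ord_at c ?Z (?lam y0 y1) + 2 * ord_at c ?Z ?G"
    proof -
      have "ord_at c ?Z M = ord_at c ?Z N" by (rule ord_at_cong[OF MN])
      moreover have "ord_at c ?Z M = ord_at c ?Z (\<lambda>v. ?l v * ?ls v * (?lam r0 r1 v * ?lam 1 0 v))"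
        unfolding M_def using c_nz by (intro ord_at_scale[OF z nzM]) simp
      moreover have "ord_at c ?Z N = ord_at c ?Z (\<lambda>v. ?lam q0 q1 v * ?lam y0 y1 v * (?G v * ?G v))"
        unfolding N_def by (rule ord_at_scale[OF z nzN k])
      ultimately show ?thesis
        using ord_at_mult[OF Z nzform_mult[OF nz(1,2)] nzform_mult[OF nz(4,7)]] ord_at_mult[OF Z nz(1,2)]
          ord_at_mult[OF Z nz(4,7)] ord_at_mult[OF Z nzform_mult[OF nz(5,6)] nzform_mult[OF nz(3,3)]]
          ord_at_mult[OF Z nz(5,6)] ord_at_mult[OF Z nz(3,3)] by simp
    qed
    note eq = ord_eq[unfolded fR fO fib[OF q] fib[OF y]]
    have pd: "point_div A B = of_bool (B = A)" for A B :: "'a list set" by (simp add: point_div_def)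
    have l_at: "?l z = 0" if "?Z = pt w" "w \<in> EC_cone c" "?l w = 0" for w
      using lin_pt_zero_iff[OF z that(2,1)] that(3) by blast
    have ls_neg: "?ls z = ?l (neg_vec z)" by (simp add: lin_def neg_vec_def add_ac)
    have ls_at: "?ls z = 0" if "?Z = neg_pt (pt w)" "w \<in> EC_cone c" "?l w = 0" for w
    proof -
      have "pt (neg_vec z) = pt w"
        using that(1) neg_pt_pt[OF z] neg_pt_neg_pt[OF pt_EC[OF that(2)]] by simp
      then show ?thesis
        unfolding ls_neg using lin_pt_zero_iff[OF neg_vec_cone[OF z] that(2)] that(3) by blast
    qed
    \<comment> \<open>At a fixed point of inversion l and its conjugate have equal order and the
      identity of orders can be halved. Elsewhere at most one of them vanishes, because their sum is
      a nonzero multiple of X0 + X3.\<close>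
    show "sum_div (pt q) (pt y) (pt R) ?Z = int (ord_at c ?Z ?l) - int (ord_at c ?Z ?G)"
    proof (cases "neg_pt ?Z = ?Z")
      case True
      have "ord_at c (pt (neg_vec z)) (\<lambda>v. ?l (neg_vec v)) = ord_at c ?Z ?l"
        by (rule ord_at_neg[OF z nz(1)])
      moreover have "(\<lambda>v. ?l (neg_vec v)) = ?ls" by (simp add: lin_def neg_vec_def fun_eq_iff add_ac)
      ultimately have "ord_at c ?Z ?ls = ord_at c ?Z ?l" using True neg_pt_pt[OF z] by simp
      moreover have flip: "?Z = neg_pt W \<longleftrightarrow> ?Z = W" if "W \<in> EC c" for W
        using True neg_pt_neg_pt[OF that] by auto
      ultimately have "int (2 * ord_at c ?Z ?l + 2 * of_bool (?Z = pt R) + 2 * of_bool (?Z = EC_O)) =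
          int (2 * of_bool (?Z = pt q) + 2 * of_bool (?Z = pt y) + 2 * ord_at c ?Z ?G)"
        using eq unfolding flip[OF pt_EC[OF q(1)]] flip[OF pt_EC[OF y(1)]] flip[OF pt_EC[OF R(1)]]
        by (intro arg_cong[of _ _ int]) linarith
      then show ?thesis unfolding sum_div_def pd of_nat_add of_nat_mult of_nat_of_bool by simp
    next
      case False
      have z03: "z!0 + z!3 \<noteq> 0"
        using False neg_fixed[OF z] neg_pt_pt[OF z] add_eq_0_iff_eq by metis
      have "?Z \<noteq> EC_O" using False EC_O_neg by metis
      have T: "neg_pt (pt [0,1,1,0]) = pt [0,1,1,0::'a]"
        using neg_pt_pt[OF special_points(3)] by (simp add: neg_vec_def)
      then have "?Z \<noteq> pt [0,1,1,0]" using False by metis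
      with T have "ord_at c ?Z (?lam 0 1) = base_ord z"
        using fib[OF special_points(3), of 0 1] by (simp add: lies_over_def)
      moreover have "ord_at c ?Z (lin 1 0 0 1) = 0"
        by (rule ord_at_lin_eq_0[OF z]) (use z03 in \<open>simp add: lin_def\<close>)
      \<comment> \<open>Away from the fixed points X0 + X3 is a unit, and X0 contributes only its
        common zeros with X1; this compares G with the fibre form of R.\<close>
      moreover have "ord_at c ?Z (\<lambda>v. ?G v * ?lam 0 1 v) = ord_at c ?Z (\<lambda>v. ?lam r0 r1 v * lin 1 0 0 1 v)"
      proof (rule ord_at_cong)
        fix v assume "v \<in> EC_cone c"
        from coneD(4)[OF this] show "?G v * ?lam 0 1 v = ?lam r0 r1 v * lin 1 0 0 1 v"
          by (simp add: lin_def algebra_simps)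
      qed
      ultimately have ordG: "ord_at c ?Z ?G = of_bool (?Z = pt R) + of_bool (?Z = neg_pt (pt R))"
        using ord_at_mult[OF Z nz(3) lin_nzform[of 1 0 0 0]] ord_at_mult[OF Z nz(4) lin_nzform[of 1 0 0 1]] fR by simp
      have not_both: "?l z \<noteq> 0 \<or> ?ls z \<noteq> 0"
      proof -
        have "?l z + ?ls z = (\<alpha> + \<beta>) * (z!0 + z!3)" by (simp add: lin_def ring2)
        then show ?thesis using z03 \<alpha>\<beta> by (auto simp: add_eq_0_iff_eq)
      qed
      show ?thesis
      proof (cases "?l z = 0")
        case True
        then have ls: "?ls z \<noteq> 0" using not_both by blast
        then have "ord_at c ?Z ?ls = 0" by (rule ord_at_lin_eq_0[OF z])
        moreover have "?Z \<noteq> neg_pt (pt q)" "?Z \<noteq> neg_pt (pt y)"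
          using ls ls_at q(1) y(1) lq ly by blast+
        moreover have "?Z \<noteq> pt R"
          using ls_at[of s] s ls nR neg_pt_neg_pt[OF pt_EC[OF R(1)]] \<open>lin \<alpha> \<gamma> \<gamma> \<beta> s = 0\<close> by metis
        ultimately have "ord_at c ?Z ?l = of_bool (?Z = pt q) + of_bool (?Z = pt y) + ord_at c ?Z ?G"
          using eq ordG \<open>?Z \<noteq> EC_O\<close> by simp
        with \<open>?Z \<noteq> pt R\<close> \<open>?Z \<noteq> EC_O\<close> show ?thesis
          by (simp add: sum_div_def pd)
      next
        case False
        then have "ord_at c ?Z ?l = 0" by (rule ord_at_lin_eq_0[OF z])
        moreover have "?Z \<noteq> pt q" "?Z \<noteq> pt y" "?Z \<noteq> neg_pt (pt R)"
          using False l_at q(1) y(1) lq ly s ls nR by metis+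
        ultimately show ?thesis
          using ordG \<open>?Z \<noteq> EC_O\<close> by (simp add: sum_div_def pd)
      qed
    qed
  qed
  then show ?thesis using that R by blast
qed

end

section \<open>The group law\<close>

context char2_curve
begin

definition pt_T :: "'a list set" where
  "pt_T = pt [0,1,1,0]"

text \<open>O and T are the only points with x = 0 or x = infinity, and also the only ones with y =
  1, that is, fixed by inversion. For all others x is a nonzero scalar and (p:r) represents
  y.\<close>

lemma nonspecial_param:
  assumes q: "q \<in> EC_cone c" and "pt q \<noteq> EC_O" "pt q \<noteq> pt_T"
  obtains x p r where "q = [p, x * p, x * r, r]" "x \<noteq> 0" "p \<noteq> r" "p \<noteq> 0 \<or> r \<noteq> 0"
    "(1 + x)\<^sup>2 * (p + r)\<^sup>2 = c\<^sup>2 * x * p * r"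
proof -
  obtain a0 a1 b0 b1 where p: "q = [a0 * b0, a1 * b0, a1 * b1, a0 * b1]"
    "a0 \<noteq> 0 \<or> a1 \<noteq> 0" "b0 \<noteq> 0 \<or> b1 \<noteq> 0" "(a0 + a1)\<^sup>2 * (b0 + b1)\<^sup>2 = c\<^sup>2 * a0 * a1 * b0 * b1"
    using q by (rule cone_param)
  have a0: "a0 \<noteq> 0"
  proof
    assume "a0 = 0"
    then have "a1 \<noteq> 0" "b0 = b1" using p by (auto simp: add_eq_0_iff_eq)
    then have "q = map ((*) (a1 * b1)) [0,1,1,0]" "a1 * b1 \<noteq> 0" using p \<open>a0 = 0\<close> by auto
    then show False using assms(3) pt_scale unfolding pt_T_def by metis
  qed
  have a1: "a1 \<noteq> 0"
  proof
    assume "a1 = 0"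
    then have "b0 = b1" using p by (auto simp: add_eq_0_iff_eq)
    then have "q = map ((*) (a0 * b1)) [1,0,0,1]" "a0 * b1 \<noteq> 0" using p \<open>a1 = 0\<close> by auto
    then show False using assms(2) pt_scale unfolding EC_O_def by metis
  qed
  have "b0 \<noteq> b1"
  proof
    assume "b0 = b1"
    then have "c\<^sup>2 * a0 * a1 * b1 * b1 = 0" using p(4) by (simp add: add_self)
    then show False using a0 a1 p(3) \<open>b0 = b1\<close> c_nz by simp
  qed
  moreover have "(1 + a1 / a0)\<^sup>2 * (a0 * b0 + a0 * b1)\<^sup>2 = c\<^sup>2 * (a1 / a0) * (a0 * b0) * (a0 * b1)"
  proof -
    have "(1 + a1 / a0) * (a0 * b0 + a0 * b1) = (a0 + a1) * (b0 + b1)"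
      using a0 by (simp add: field_simps)
    then have "(1 + a1 / a0)\<^sup>2 * (a0 * b0 + a0 * b1)\<^sup>2 = (a0 + a1)\<^sup>2 * (b0 + b1)\<^sup>2"
      by (simp only: power_mult_distrib[symmetric])
    then show ?thesis unfolding p(4) using a0 by (simp add: field_simps)
  qed
  ultimately show ?thesis
    using that[of "a0 * b0" "a1 / a0" "a0 * b1"] a0 a1 p(1,3) by simp
qed

lemma principal_zero: "principal c (\<lambda>_. 0)"
proof (rule principalI)
  show "nzform 1 (lin 1 0 0 0)" "nzform 1 (lin 1 0 0 0)" by (intro lin_nzform; simp)+
qed simp

text \<open>All fibres of x are linearly equivalent, and the fibre of O is O counted twice.\<close>

lemma principal_neg:
  assumes q: "q \<in> EC_cone c"
  shows "principal c (sum_div (pt q) (neg_pt (pt q)) EC_O)"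
proof -
  obtain u0 u1 where u: "u0 \<noteq> 0 \<or> u1 \<noteq> 0" "lies_over q u0 u1" using over_ex[OF q] .
  show ?thesis
  proof (rule principalI[of 1 "lin u1 u0 0 0" "lin 0 1 0 0"])
    show "nzform 1 (lin u1 u0 0 0)" "nzform 1 (lin 0 1 0 0)" using u(1) by (intro lin_nzform; auto)+
    fix z assume z: "z \<in> EC_cone c"
    have "ord_at c (pt z) (lin 0 1 0 0) = base_ord z + of_bool (pt z = EC_O) + of_bool (pt z = EC_O)"
      using ord_at_fibre[OF z special_points(1), of 1 0] EC_O_neg unfolding EC_O_def by (simp add: lies_over_def)
    then show "sum_div (pt q) (neg_pt (pt q)) EC_O (pt z) =
        int (ord_at c (pt z) (lin u1 u0 0 0)) - int (ord_at c (pt z) (lin 0 1 0 0))"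
      unfolding ord_at_fibre[OF z q u(2,1)] by (simp add: sum_div_def point_div_def)
  qed
qed

lemma sum_div_commute: "sum_div P Q R = sum_div Q P R"
  by (simp add: sum_div_def fun_eq_iff)

text \<open>The addition law \<open>x(Q + Y) = (X\<^sub>0 Y\<^sub>3 + X\<^sub>2 Y\<^sub>1 : X\<^sub>1 Y\<^sub>0 + X\<^sub>3 Y\<^sub>2)\<close>, in the form of an
  incidence that is void where both entries vanish.\<close>

definition sum_lies_over :: "'a list \<Rightarrow> 'a list \<Rightarrow> 'a list \<Rightarrow> bool" where
  "sum_lies_over q y R \<longleftrightarrow> lies_over R (q!0 * y!3 + q!2 * y!1) (q!1 * y!0 + q!3 * y!2)"

lemma lies_over_proportional:
  assumes "lies_over R r0 r1" "f0 = s * r0" "f1 = s * r1"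
  shows "lies_over R f0 f1"
proof -
  have "s * (r1 * R!0) = s * (r0 * R!1)" "s * (r1 * R!3) = s * (r0 * R!2)"
    using assms(1) unfolding lies_over_def by simp_all
  then show ?thesis unfolding assms(2,3) lies_over_def by (simp only: mult.assoc)
qed

lemma sum_ex_T:
  assumes q: "q \<in> EC_cone c" "pt q \<noteq> EC_O" "pt q \<noteq> pt_T"
  obtains R where "R \<in> EC_cone c" "lies_over R (q!2) (q!3)" "lies_over R (q!1) (q!0)" "principal c (sum_div (pt q) pt_T (pt R))"
proof -
  obtain x p r where p: "q = [p, x * p, x * r, r]" "x \<noteq> 0" "p \<noteq> r" "p \<noteq> 0 \<or> r \<noteq> 0"
    "(1 + x)\<^sup>2 * (p + r)\<^sup>2 = c\<^sup>2 * x * p * r"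
    using q by (rule nonspecial_param)
  \<comment> \<open>The plane contains q. It has gamma = 0 because T must count once more than as
    the centre of projection: at T the form X1 + X2 has order 1, while X0 and X3 have order
    2.\<close>
  have cubic: "chord_cubic r p 0 A0 A1 = ((p + r)\<^sup>2 / x) * (x * A0 + 1 * A1) * (1 * A0 + 0 * A1) * (1 * A0 + x * A1)" for A0 A1
  proof -
    have "x * chord_cubic r p 0 A0 A1 = A0 * (x * (A0\<^sup>2 + A1\<^sup>2) * (p + r)\<^sup>2 + (c\<^sup>2 * x * p * r) * (A0 * A1))"
      unfolding chord_cubic_def square_add by (simp add: algebra_simps power2_eq_square)
    also have "\<dots> = (p + r)\<^sup>2 * (A0 * ((x * A0 + A1) * (A0 + x * A1)))"
      unfolding p(5)[symmetric] square_add by (simp add: algebra_simps power2_eq_square)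
    finally show ?thesis using p(2) by (simp add: field_simps)
  qed
  have oq: "lies_over q 1 x" by (simp add: lies_over_def p(1))
  have oT: "lies_over [0,1,1,0] 0 1" by (simp add: lies_over_def)
  obtain R where R: "R \<in> EC_cone c" "lies_over R x 1" "principal c (sum_div (pt q) (pt [0,1,1,0]) (pt R))"
    by (rule chord_principal[OF q(1) _ oq special_points(3) _ oT _ _ cubic])
      (use p in \<open>simp_all add: lin_def add_self mult.commute\<close>)
  show ?thesis
  proof (rule that[OF R(1)])
    show "lies_over R (q!2) (q!3)" by (rule lies_over_proportional[OF R(2), of _ r]) (simp_all add: p(1) mult.commute)
    show "lies_over R (q!1) (q!0)" by (rule lies_over_proportional[OF R(2), of _ p]) (simp_all add: p(1) mult.commute)
  qed (use R(3) in \<open>simp add: pt_T_def\<close>)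
qed


lemma sum_ex_tangent:
  assumes q: "q \<in> EC_cone c" "pt q \<noteq> EC_O" "pt q \<noteq> pt_T"
  obtains R where "R \<in> EC_cone c" "sum_lies_over q q R" "principal c (sum_div (pt q) (pt q) (pt R))"
proof -
  obtain x p r where p: "q = [p, x * p, x * r, r]" "x \<noteq> 0" "p \<noteq> r" "p \<noteq> 0 \<or> r \<noteq> 0"
    "(1 + x)\<^sup>2 * (p + r)\<^sup>2 = c\<^sup>2 * x * p * r"
    using q by (rule nonspecial_param)
  have pr: "p + r \<noteq> 0" using p(3) by (simp add: add_eq_0_iff_eq)
  have "x * r\<^sup>2 + x * p\<^sup>2 = x * (p + r)\<^sup>2" unfolding square_add by (simp add: algebra_simps)
  then have ne: "x * r\<^sup>2 \<noteq> x * p\<^sup>2" using p(2) pr by (auto simp: add_self)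
  \<comment> \<open>These coefficients give the tangent plane at q through T. In characteristic 2
    the differential of the curve equation is c^2 (y dx + x dy), so the tangent direction at (x, y)
    is (x, y) itself. Accordingly x(q) is a double root of the cubic.\<close>
  have cubic: "chord_cubic (x * r\<^sup>2) (x * p\<^sup>2) (p * r) A0 A1 =
      ((p + r)\<^sup>2 / x) * (x * A0 + 1 * A1) * (x * A0 + 1 * A1) * (x * (p + r)\<^sup>2 * A0 + p * r * (1 + x)\<^sup>2 * A1)" for A0 A1
  proof -
    let ?S = "p\<^sup>2 + r\<^sup>2" and ?V = "1 + x\<^sup>2"
    have e: "?V * ?S = c\<^sup>2 * x * p * r" using p(5) unfolding square_add by simp
    have "x * chord_cubic (x * r\<^sup>2) (x * p\<^sup>2) (p * r) A0 A1 =
        x * ((A0\<^sup>2 + A1\<^sup>2) * (x * ?S)\<^sup>2 * A0) + (c\<^sup>2 * x * p * r) * A1 * (x * r * A0 + p * A1) * (x * p * A0 + r * A1)"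
      unfolding chord_cubic_def square_add by (simp add: ring2)
    also have "\<dots> = ?S * (((x * A0 + A1) * (x * A0 + A1)) * (x * ?S * A0 + p * r * ?V * A1))"
      unfolding e[symmetric] by (simp add: ring2)
    finally show ?thesis unfolding square_add using p(2) by (simp add: field_simps)
  qed
  have oq: "lies_over q 1 x" by (simp add: lies_over_def p(1))
  have lq: "lin (x * r\<^sup>2) (p * r) (p * r) (x * p\<^sup>2) q = 0"
    unfolding lin_def p(1) by (simp add: ring2)
  obtain R where R: "R \<in> EC_cone c" "lies_over R (p * r * (1 + x)\<^sup>2) (x * (p + r)\<^sup>2)" "principal c (sum_div (pt q) (pt q) (pt R))"
    by (rule chord_principal[OF q(1) _ oq q(1) _ oq _ ne cubic lq lq]) (use p(2) pr in simp_all)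
  have "sum_lies_over q q R"
    unfolding sum_lies_over_def
    by (rule lies_over_proportional[OF R(2), of _ 1]) (simp_all add: p(1) square_add ring2)
  then show ?thesis using that R by blast
qed

lemma sum_ex_chord:
  assumes q: "q \<in> EC_cone c" "pt q \<noteq> EC_O" "pt q \<noteq> pt_T" and y: "y \<in> EC_cone c" "pt y \<noteq> EC_O" "pt y \<noteq> pt_T"
    and ne: "pt q \<noteq> pt y" "pt q \<noteq> neg_pt (pt y)"
  obtains R where "R \<in> EC_cone c" "sum_lies_over q y R" "principal c (sum_div (pt q) (pt y) (pt R))"
proof -
  obtain x p r where p: "q = [p, x * p, x * r, r]" "x \<noteq> 0" "p \<noteq> r" "p \<noteq> 0 \<or> r \<noteq> 0"
    "(1 + x)\<^sup>2 * (p + r)\<^sup>2 = c\<^sup>2 * x * p * r"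
    using q by (rule nonspecial_param)
  obtain x' p' r' where p': "y = [p', x' * p', x' * r', r']" "x' \<noteq> 0" "p' \<noteq> r'" "p' \<noteq> 0 \<or> r' \<noteq> 0"
    "(1 + x')\<^sup>2 * (p' + r')\<^sup>2 = c\<^sup>2 * x' * p' * r'"
    using y by (rule nonspecial_param)
  have oq: "lies_over q 1 x" and oy: "lies_over y 1 x'" by (simp_all add: lies_over_def p(1) p'(1))
  have "x \<noteq> x'"
    using same_fibre[OF q(1) y(1) _ oq] oy ne neg_pt_pt[OF y(1)] by auto
  then have nz: "x + x' \<noteq> 0" "p + r \<noteq> 0" "p' + r' \<noteq> 0" using p(3) p'(3) by (simp_all add: add_eq_0_iff_eq)
  \<comment> \<open>Projection from T has the coordinates (X0, X3, X1 + X2); the coefficients are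
    the cross product of the images of q and y.\<close>
  define \<alpha> \<beta> \<gamma> where "\<alpha> = r * (x' * (p' + r')) + r' * (x * (p + r))"
    and "\<beta> = p * (x' * (p' + r')) + p' * (x * (p + r))" and "\<gamma> = p * r' + p' * r"
  have lq: "lin \<alpha> \<gamma> \<gamma> \<beta> q = 0" and ly: "lin \<alpha> \<gamma> \<gamma> \<beta> y = 0"
    unfolding lin_def \<alpha>_def \<beta>_def \<gamma>_def p(1) p'(1) by (simp_all add: ring2)
  have sum: "\<alpha> + \<beta> = (p + r) * (p' + r') * (x + x')"
    unfolding \<alpha>_def \<beta>_def by (simp add: ring2)
  then have ab: "\<alpha> \<noteq> \<beta>" using nz by (auto simp: add_self)
  \<comment> \<open>The third root by Vieta: the coefficients of A0^3 and A1^3 in the cubic are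
    (alpha + beta)^2 and c^2 gamma^2.\<close>
  define r0 where "r0 = c\<^sup>2 * \<gamma>\<^sup>2"
  define r1 where "r1 = (\<alpha> + \<beta>)\<^sup>2 / (x * x')"
  have r1: "r1 \<noteq> 0" "x * x' * r1 = (\<alpha> + \<beta>)\<^sup>2" using sum nz p(2) p'(2) by (simp_all add: r1_def)
  \<comment> \<open>On the plane (s:w) is proportional to (beta + gamma x : alpha + gamma x);
    inserting this into the curve equation makes the cubic vanish.\<close>
  have root: "chord_cubic \<alpha> \<beta> \<gamma> 1 x = 0"
    if v: "v = [s, x * s, x * w, w]" "s \<noteq> 0 \<or> w \<noteq> 0" "(1 + x)\<^sup>2 * (s + w)\<^sup>2 = c\<^sup>2 * x * s * w" "lin \<alpha> \<gamma> \<gamma> \<beta> v = 0"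
    for v x s w
  proof -
    have "(\<alpha> + \<gamma> * x) * s + (\<beta> + \<gamma> * x) * w = 0"
      using v(4) unfolding v(1) lin_def by (simp add: algebra_simps)
    then have "s * (\<alpha> + \<gamma> * x) = w * (\<beta> + \<gamma> * x)" by (simp only: add_eq_0_iff_eq mult.commute)
    then obtain m where m: "\<beta> + \<gamma> * x = m * s" "\<alpha> + \<gamma> * x = m * w"
    proof (cases "s = 0")
      case True
      with v(2) have "w \<noteq> 0" by simp
      moreover have "\<beta> + \<gamma> * x = 0" using \<open>s * _ = _\<close> True \<open>w \<noteq> 0\<close> by simp
      ultimately show ?thesis using that[of "(\<alpha> + \<gamma> * x) / w"] True by simp
    next
      case False
      then have "\<alpha> + \<gamma> * x = ((\<beta> + \<gamma> * x) / s) * w" using \<open>s * _ = _\<close> by (simp add: field_simps)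
      then show ?thesis using that[of "(\<beta> + \<gamma> * x) / s"] False by simp
    qed
    have "\<alpha> + \<beta> = (\<alpha> + \<gamma> * x) + (\<beta> + \<gamma> * x)" by (simp add: ring2)
    then have ab: "\<alpha> + \<beta> = m * (s + w)" unfolding m by (simp add: algebra_simps)
    have "chord_cubic \<alpha> \<beta> \<gamma> 1 x = m\<^sup>2 * ((1 + x)\<^sup>2 * (s + w)\<^sup>2) + c\<^sup>2 * x * (m * w) * (m * s)"
      unfolding chord_cubic_def ab m[symmetric] by (simp add: power_mult_distrib mult_ac)
    also have "\<dots> = 0" unfolding v(3) by (simp add: power2_eq_square mult_ac add_self)
    finally show ?thesis .
  qed
  have root1: "chord_cubic \<alpha> \<beta> \<gamma> 1 x = 0" by (rule root[OF p(1,4,5) lq])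
  have root2: "chord_cubic \<alpha> \<beta> \<gamma> 1 x' = 0" by (rule root[OF p'(1,4,5) ly])
  \<comment> \<open>The end coefficients agree by the choice of \<open>r0\<close> and
    \<open>r1\<close>, so the cubic and the product differ by A0 A1 times the linear form with
    coefficients \<open>d1\<close> and \<open>d2\<close>. It has the two distinct roots x and x' and
    is therefore zero.\<close>
  define d1 where "d1 = c\<^sup>2 * \<alpha> * \<beta> + (x + x') * r1 + x * x' * r0"
  define d2 where "d2 = (\<alpha> + \<beta>)\<^sup>2 + c\<^sup>2 * \<gamma> * (\<alpha> + \<beta>) + r1 + (x + x') * r0"
  have expand: "chord_cubic \<alpha> \<beta> \<gamma> A0 A1 = (x * A0 + A1) * (x' * A0 + A1) * (r1 * A0 + r0 * A1)
      + A0 * A1 * (d1 * A0 + d2 * A1)" for A0 A1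
  proof -
    have "(x * A0 + A1) * (x' * A0 + A1) * (r1 * A0 + r0 * A1) + A0 * A1 * (d1 * A0 + d2 * A1) =
        (x * x' * r1) * A0 ^ 3 + r0 * A1 ^ 3 + c\<^sup>2 * \<alpha> * \<beta> * A0\<^sup>2 * A1
        + ((\<alpha> + \<beta>)\<^sup>2 + c\<^sup>2 * \<gamma> * (\<alpha> + \<beta>)) * A0 * A1\<^sup>2"
      unfolding d1_def d2_def square_add by (simp add: ring2)
    also have "\<dots> = chord_cubic \<alpha> \<beta> \<gamma> A0 A1"
      unfolding r1(2) r0_def chord_cubic_def square_add by (simp add: ring2)
    finally show ?thesis by simp
  qed
  have "x * (d1 + d2 * x) = 0" using expand[of 1 x] root1 by (simp add: add_self)
  moreover have "x' * (d1 + d2 * x') = 0" using expand[of 1 x'] root2 by (simp add: add_self)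
  ultimately have e: "d1 + d2 * x = 0" "d1 + d2 * x' = 0" using p(2) p'(2) by simp_all
  have "d2 * (x + x') = (d1 + d2 * x) + (d1 + d2 * x')" by (simp add: ring2)
  then have "d2 = 0" using nz(1) unfolding e by simp
  then have "d1 = 0" using e by simp
  have cubic: "chord_cubic \<alpha> \<beta> \<gamma> A0 A1 = 1 * (x * A0 + 1 * A1) * (x' * A0 + 1 * A1) * (r1 * A0 + r0 * A1)" for A0 A1
    unfolding expand \<open>d1 = 0\<close> \<open>d2 = 0\<close> by simp
  obtain R where R: "R \<in> EC_cone c" "lies_over R r0 r1" "principal c (sum_div (pt q) (pt y) (pt R))"
    by (rule chord_principal[OF q(1) _ oq y(1) _ oy _ ab cubic lq ly]) (use r1 in simp_all)
  define f0 where "f0 = p * r' + x * r * (x' * p')"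
  define f1 where "f1 = x * p * p' + r * (x' * r')"
  \<comment> \<open>Modulo the curve equations of q and y, the ratio from Vieta reduces to the
    bilinear tuple. The factor \<open>f1 / r1\<close> used below may be zero, which is the case of a
    void incidence.\<close>
  have f: "r0 * f1 = r1 * f0"
  proof -
    let ?U = "1 + x\<^sup>2" and ?U' = "1 + x'\<^sup>2" and ?S = "p\<^sup>2 + r\<^sup>2" and ?S' = "p'\<^sup>2 + r'\<^sup>2"
    have E: "c\<^sup>2 * x * p * r = ?U * ?S" "c\<^sup>2 * x' * p' * r' = ?U' * ?S'"
      using p(5) p'(5) unfolding square_add by simp_all
    have "x * x' * (r0 * f1) = x\<^sup>2 * p ^ 3 * r' * (c\<^sup>2 * x' * p' * r') + x * x' * r * p' ^ 3 * (c\<^sup>2 * x * p * r)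
        + x'\<^sup>2 * p * r' ^ 3 * (c\<^sup>2 * x * p * r) + x * x' * r ^ 3 * p' * (c\<^sup>2 * x' * p' * r')"
      unfolding r0_def \<gamma>_def f1_def square_add by (simp add: algebra_simps power2_eq_square power3_eq_cube)
    also have "\<dots> = x\<^sup>2 * p ^ 3 * r' * (?U' * ?S') + x * x' * r * p' ^ 3 * (?U * ?S)
        + x'\<^sup>2 * p * r' ^ 3 * (?U * ?S) + x * x' * r ^ 3 * p' * (?U' * ?S')"
      unfolding E ..
    also have "\<dots> = ?S * ?S' * (x\<^sup>2 + x'\<^sup>2) * f0 +
        (x * r * r' + x' * p * p') * (?U * ?S * (x' * p' * r') + ?U' * ?S' * (x * p * r))"
      unfolding f0_def by (simp add: ring2)
    also have "?U * ?S * (x' * p' * r') + ?U' * ?S' * (x * p * r) = 0"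
      unfolding E[symmetric] by (simp add: mult_ac add_self)
    finally have "x * x' * (r0 * f1) = (\<alpha> + \<beta>)\<^sup>2 * f0"
      unfolding sum power_mult_distrib square_add by simp
    then have "x * x' * (r0 * f1) = x * x' * (r1 * f0)" unfolding r1(2)[symmetric] by (simp only: mult_ac)
    then show ?thesis using p(2) p'(2) by simp
  qed
  have "sum_lies_over q y R"
    unfolding sum_lies_over_def
    by (rule lies_over_proportional[OF R(2), of _ "f1 / r1"])
      (use f r1 in \<open>simp_all add: p(1) p'(1) f0_def f1_def field_simps\<close>)
  then show ?thesis using that R by blast
qed

lemma sum_ex:
  assumes q: "q \<in> EC_cone c" and y: "y \<in> EC_cone c"
  obtains R where "R \<in> EC_cone c" "sum_lies_over q y R" "principal c (sum_div (pt q) (pt y) (pt R))"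
proof -
  \<comment> \<open>The chord construction needs two distinct values of x other than 0 and infinity,
    which is why O, T and pairs of equal or opposite points are set apart.\<close>
  consider "pt q = EC_O" | "pt y = EC_O" | "pt q = neg_pt (pt y)"
    | "pt q \<noteq> EC_O" "pt q \<noteq> pt_T" "pt y = pt_T" | "pt y \<noteq> EC_O" "pt y \<noteq> pt_T" "pt q = pt_T"
    | "pt q \<noteq> EC_O" "pt q \<noteq> pt_T" "pt q = pt y"
    | "pt q \<noteq> EC_O" "pt q \<noteq> pt_T" "pt y \<noteq> EC_O" "pt y \<noteq> pt_T" "pt q \<noteq> pt y" "pt q \<noteq> neg_pt (pt y)"
    | "pt q = pt_T" "pt y = pt_T" by blast
  then show ?thesis
  proof cases
    case 1
    then have "pt [1,0,0,1] = pt q" by (simp add: EC_O_def)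
    then obtain s where s: "s \<noteq> 0" "q = map ((*) s) [1,0,0,1]" by (rule pt_eqD)
    have "sum_lies_over q y y"
      using coneD(4)[OF y] by (simp add: sum_lies_over_def lies_over_def s(2) mult_ac)
    moreover have "sum_div (pt q) (pt y) (pt y) = (\<lambda>_. 0)" by (simp add: sum_div_def 1 fun_eq_iff)
    ultimately show ?thesis using that[OF y] principal_zero by simp
  next
    case 2
    then have "pt [1,0,0,1] = pt y" by (simp add: EC_O_def)
    then obtain s where s: "s \<noteq> 0" "y = map ((*) s) [1,0,0,1]" by (rule pt_eqD)
    have "sum_lies_over q y q"
      using coneD(4)[OF q] by (simp add: sum_lies_over_def lies_over_def s(2) mult_ac)
    moreover have "sum_div (pt q) (pt y) (pt q) = (\<lambda>_. 0)" by (simp add: sum_div_def 2 fun_eq_iff)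
    ultimately show ?thesis using that[OF q] principal_zero by simp
  next
    case 3
    then have "pt (neg_vec q) = pt y" using neg_pt_pt[OF q] neg_pt_neg_pt[OF pt_EC[OF y]] by simp
    then obtain s where s: "s \<noteq> 0" "y = map ((*) s) (neg_vec q)" by (rule pt_eqD)
    have "sum_lies_over q y [1,0,0,1]"
      by (simp add: sum_lies_over_def lies_over_def s(2) neg_vec_def ring2)
    moreover have "pt y = neg_pt (pt q)" using 3 neg_pt_neg_pt[OF pt_EC[OF y]] by simp
    ultimately show ?thesis
      using that[OF special_points(1)] principal_neg[OF q] by (simp add: EC_O_def)
  next
    case 4
    then have "pt [0,1,1,0] = pt y" by (simp add: pt_T_def)
    then obtain s where s: "s \<noteq> 0" "y = map ((*) s) [0,1,1,0]" by (rule pt_eqD)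
    obtain R where R: "R \<in> EC_cone c" "lies_over R (q!2) (q!3)" "principal c (sum_div (pt q) pt_T (pt R))"
      using sum_ex_T[OF q 4(1,2)] by metis
    have "sum_lies_over q y R"
      unfolding sum_lies_over_def
      by (rule lies_over_proportional[OF R(2), of _ s]) (simp_all add: s(2))
    then show ?thesis using that R 4(3) by simp
  next
    case 5
    then have "pt [0,1,1,0] = pt q" by (simp add: pt_T_def)
    then obtain s where s: "s \<noteq> 0" "q = map ((*) s) [0,1,1,0]" by (rule pt_eqD)
    obtain R where R: "R \<in> EC_cone c" "lies_over R (y!1) (y!0)" "principal c (sum_div (pt y) pt_T (pt R))"
      using sum_ex_T[OF y 5(1,2)] by metis
    have "sum_lies_over q y R"
      unfolding sum_lies_over_def
      by (rule lies_over_proportional[OF R(2), of _ s]) (simp_all add: s(2))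
    then show ?thesis using that R 5(3) sum_div_commute by metis
  next
    case 6
    obtain s where s: "s \<noteq> 0" "y = map ((*) s) q" using 6(3) by (rule pt_eqD)
    obtain R where R: "R \<in> EC_cone c" "sum_lies_over q q R" "principal c (sum_div (pt q) (pt q) (pt R))"
      using sum_ex_tangent[OF q 6(1,2)] by metis
    have "sum_lies_over q y R"
      unfolding sum_lies_over_def
      by (rule lies_over_proportional[OF R(2)[unfolded sum_lies_over_def], of _ s])
        (use coneD(1)[OF q] in \<open>simp_all add: s(2) distrib_left mult_ac\<close>)
    then show ?thesis using that R 6(3) by metis
  next
    case 7
    then show ?thesis using sum_ex_chord[OF q 7(1,2) y 7(3,4,5,6)] that by metis
  next
    case 8
    have "neg_pt pt_T = pt_T"
      using neg_pt_pt[OF special_points(3)] by (simp add: pt_T_def neg_vec_def)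
    then have "pt (neg_vec q) = pt y" using neg_pt_pt[OF q] 8 by simp
    then obtain s where s: "s \<noteq> 0" "y = map ((*) s) (neg_vec q)" by (rule pt_eqD)
    have "sum_lies_over q y [1,0,0,1]"
      by (simp add: sum_lies_over_def lies_over_def s(2) neg_vec_def ring2)
    then show ?thesis
      using that[OF special_points(1)] principal_neg[OF q] 8 \<open>neg_pt pt_T = pt_T\<close> by (simp add: EC_O_def)
  qed
qed

section \<open>The group structure from divisors\<close>

lemma sum_div_unique:
  assumes "R \<in> EC c" "R' \<in> EC c" "principal c (sum_div P Q R)" "principal c (sum_div P Q R')"
  shows "R = R'"
proof -
  have "principal c (\<lambda>Z. sum_div P Q R' Z - sum_div P Q R Z)" by (rule principal_diff[OF assms(4,3)])
  moreover have "(\<lambda>Z. sum_div P Q R' Z - sum_div P Q R Z) = (\<lambda>Z. point_div R Z - point_div R' Z)"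
    by (simp add: sum_div_def fun_eq_iff)
  ultimately show ?thesis using principal_two_points[OF assms(1,2)] by simp
qed

lemma EC_add_eqI:
  assumes "R \<in> EC c" "principal c (sum_div P Q R)"
  shows "EC_add c P Q = R"
  unfolding EC_add_def
proof (rule the_equality)
  show "R \<in> EC c \<and> principal c (\<lambda>Z. point_div P Z + point_div Q Z - point_div R Z - point_div EC_O Z)"
    using assms by (simp add: sum_div_def[abs_def])
  fix R' assume "R' \<in> EC c \<and> principal c (\<lambda>Z. point_div P Z + point_div Q Z - point_div R' Z - point_div EC_O Z)"
  then show "R' = R"
    using sum_div_unique[OF _ assms(1) _ assms(2)] by (simp add: sum_div_def[abs_def])
qed

lemma EC_add_principal:
  assumes P: "P \<in> EC c" and Q: "Q \<in> EC c"
  shows "EC_add c P Q \<in> EC c" "principal c (sum_div P Q (EC_add c P Q))"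
proof -
  obtain p q where "p \<in> EC_cone c" "P = pt p" "q \<in> EC_cone c" "Q = pt q" using P Q by (auto simp: EC_def)
  then obtain R where R: "R \<in> EC c" "principal c (sum_div P Q R)" using sum_ex pt_EC by metis
  then have "EC_add c P Q = R" by (rule EC_add_eqI)
  then show "EC_add c P Q \<in> EC c" "principal c (sum_div P Q (EC_add c P Q))" using R by simp_all
qed

lemma EC_add_lies_over:
  assumes q: "q \<in> EC_cone c" and y: "y \<in> EC_cone c"
    and R: "R \<in> EC_cone c" "EC_add c (pt q) (pt y) = pt R"
  shows "sum_lies_over q y R"
proof -
  obtain R' where R': "R' \<in> EC_cone c" "sum_lies_over q y R'" "principal c (sum_div (pt q) (pt y) (pt R'))"
    using sum_ex[OF q y] .
  then have "pt R' = pt R" using EC_add_eqI[OF pt_EC[OF R'(1)] R'(3)] R(2) by simp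
  then have "pt R = pt R'" by simp
  then show ?thesis
    using over_pt_eq[OF R(1) disjI1 _ R'(1)] R'(2) unfolding sum_lies_over_def by blast
qed

text \<open>For associativity the divisor relations defining P + Q, Q + R and (P + Q) + R are
  combined; the intermediate terms cancel to the relation defining P + (Q + R), and uniqueness of
  sums identifies the results.\<close>

lemma EC_comm_group: "comm_group (EC_group c)"
proof (rule comm_groupI)
  fix P Q R assume "P \<in> carrier (EC_group c)" "Q \<in> carrier (EC_group c)" "R \<in> carrier (EC_group c)"
  then have P: "P \<in> EC c" and Q: "Q \<in> EC c" and R: "R \<in> EC c" by (simp_all add: EC_group_def)
  define U V where "U = EC_add c P Q" and "V = EC_add c Q R"
  have U: "U \<in> EC c" "principal c (sum_div P Q U)" and V: "V \<in> EC c" "principal c (sum_div Q R V)"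
    using EC_add_principal P Q R by (simp_all add: U_def V_def)
  define W where "W = EC_add c U R"
  have W: "W \<in> EC c" "principal c (sum_div U R W)" using EC_add_principal[OF U(1) R] by (simp_all add: W_def)
  have "principal c (\<lambda>Z. sum_div U R W Z - (sum_div Q R V Z - sum_div P Q U Z))"
    by (rule principal_diff[OF W(2) principal_diff[OF V(2) U(2)]])
  moreover have "(\<lambda>Z. sum_div U R W Z - (sum_div Q R V Z - sum_div P Q U Z)) = sum_div P V W"
    by (simp add: sum_div_def fun_eq_iff)
  ultimately have "EC_add c P V = W" using EC_add_eqI[OF W(1)] by simp
  then show "P \<otimes>\<^bsub>EC_group c\<^esub> Q \<otimes>\<^bsub>EC_group c\<^esub> R = P \<otimes>\<^bsub>EC_group c\<^esub> (Q \<otimes>\<^bsub>EC_group c\<^esub> R)"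
    by (simp add: EC_group_def U_def V_def W_def)
next
  fix P Q assume "P \<in> carrier (EC_group c)" "Q \<in> carrier (EC_group c)"
  then have P: "P \<in> EC c" and Q: "Q \<in> EC c" by (simp_all add: EC_group_def)
  show "P \<otimes>\<^bsub>EC_group c\<^esub> Q \<in> carrier (EC_group c)"
    using EC_add_principal[OF P Q] by (simp add: EC_group_def)
  have "EC_add c Q P = EC_add c P Q"
    using EC_add_principal[OF P Q] by (intro EC_add_eqI) (simp_all add: sum_div_commute)
  then show "P \<otimes>\<^bsub>EC_group c\<^esub> Q = Q \<otimes>\<^bsub>EC_group c\<^esub> P" by (simp add: EC_group_def)
next
  show "\<one>\<^bsub>EC_group c\<^esub> \<in> carrier (EC_group c)" using EC_O_mem by (simp add: EC_group_def)
next
  fix P assume "P \<in> carrier (EC_group c)"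
  then have P: "P \<in> EC c" by (simp add: EC_group_def)
  have "sum_div EC_O P P = (\<lambda>_. 0)" by (simp add: sum_div_def fun_eq_iff)
  then have "EC_add c EC_O P = P" using EC_add_eqI[OF P] principal_zero by simp
  then show "\<one>\<^bsub>EC_group c\<^esub> \<otimes>\<^bsub>EC_group c\<^esub> P = P" by (simp add: EC_group_def)
  obtain p where p: "p \<in> EC_cone c" "P = pt p" using P by (rule EC_E)
  have "EC_add c (neg_pt P) P = EC_O"
    using principal_neg[OF p(1)] EC_O_mem p(2) by (intro EC_add_eqI) (simp_all add: sum_div_commute)
  then show "\<exists>y\<in>carrier (EC_group c). y \<otimes>\<^bsub>EC_group c\<^esub> P = \<one>\<^bsub>EC_group c\<^esub>"
    using neg_pt_EC[OF P] by (auto simp: EC_group_def)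
qed

lemma EC_inv:
  assumes P: "P \<in> EC c"
  shows "inv\<^bsub>EC_group c\<^esub> P = neg_pt P"
proof -
  interpret comm_group "EC_group c" by (rule EC_comm_group)
  obtain p where p: "p \<in> EC_cone c" "P = pt p" using P by (rule EC_E)
  have "EC_add c (neg_pt P) P = EC_O"
    using principal_neg[OF p(1)] EC_O_mem p(2) by (intro EC_add_eqI) (simp_all add: sum_div_commute)
  then have "neg_pt P \<otimes>\<^bsub>EC_group c\<^esub> P = \<one>\<^bsub>EC_group c\<^esub>" by (simp add: EC_group_def)
  then show ?thesis
    using inv_equality P neg_pt_EC[OF P] by (simp add: EC_group_def)
qed

end

section \<open>The Kummer-oriented curve\<close>

text \<open>The analogue of \<open>lies_over\<close> for y, the second projection.\<close>

definition lies_over2 :: "'a::field list \<Rightarrow> 'a \<Rightarrow> 'a \<Rightarrow> bool" where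
  "lies_over2 v w0 w1 \<longleftrightarrow> w1 * v!0 = w0 * v!3 \<and> w1 * v!1 = w0 * v!2"

context char2_curve
begin

section \<open>The two projections and the skew-Segre embedding\<close>

lemma nonzero_pair: "nonzero [a, b] \<longleftrightarrow> a \<noteq> 0 \<or> b \<noteq> 0"
  by (simp add: nonzero_def)

lemma pt_pair_eq_iff:
  fixes u0 u1 v0 v1 :: 'a
  assumes "u0 \<noteq> 0 \<or> u1 \<noteq> 0" "v0 \<noteq> 0 \<or> v1 \<noteq> 0"
  shows "pt [u0, u1] = pt [v0, v1] \<longleftrightarrow> u0 * v1 = u1 * v0"
proof
  assume "pt [u0, u1] = pt [v0, v1]"
  then obtain s where "[v0, v1] = map ((*) s) [u0, u1]" by (rule pt_eqD)
  then show "u0 * v1 = u1 * v0" by simp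
next
  assume "u0 * v1 = u1 * v0"
  then obtain s where s: "s \<noteq> 0" "v0 = s * u0" "v1 = s * u1" using proportional[OF assms] by metis
  then have "[v0, v1] = map ((*) s) [u0, u1]" by simp
  then show "pt [u0, u1] = pt [v0, v1]" using pt_scale[OF s(1), of "[u0, u1]"] by simp
qed

lemma EC_memD:
  assumes "Z \<in> EC c" "x \<in> Z"
  shows "x \<in> EC_cone c" "Z = pt x"
proof -
  obtain v where v: "v \<in> EC_cone c" "Z = pt v" using assms(1) by (rule EC_E)
  then obtain s where s: "s \<noteq> 0" "x = map ((*) s) v" using assms(2) ptE by blast
  then show "x \<in> EC_cone c" "Z = pt x" using cone_scale[OF v(1)] pt_scale[of s v] v(2) by simp_all
qed

lemma glue_eqI:
  assumes "x \<in> Z" "h \<in> T" "nonzero (h x)" "\<And>x h. x \<in> Z \<Longrightarrow> h \<in> T \<Longrightarrow> nonzero (h x) \<Longrightarrow> pt (h x) = p"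
  shows "glue T Z = p"
  unfolding glue_def
proof (rule the_equality)
  show "\<forall>x\<in>Z. \<forall>h\<in>T. nonzero (h x) \<longrightarrow> p = pt (h x)" using assms(4) by blast
  fix p' assume "\<forall>x\<in>Z. \<forall>h\<in>T. nonzero (h x) \<longrightarrow> p' = pt (h x)"
  then have "p' = pt (h x)" using assms(1-3) by blast
  then show "p' = p" using assms(4)[OF assms(1-3)] by simp
qed

lemma cone_nonzero_coord: "v \<in> EC_cone c \<Longrightarrow> v!0 \<noteq> 0 \<or> v!1 \<noteq> 0 \<or> v!2 \<noteq> 0 \<or> v!3 \<noteq> 0"
  using coneD(2)[of v] length_4_eq[OF coneD(1), of v] unfolding nonzero_def
  by (metis empty_iff insert_iff list.set(1) list.simps(15))

lemma proj1_eq: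
  assumes q: "q \<in> EC_cone c" and o: "lies_over q u0 u1" and u: "u0 \<noteq> 0 \<or> u1 \<noteq> 0"
  shows "proj1 (pt q) = pt [u0, u1]"
proof -
  let ?T = "{\<lambda>x. [x!0, x!1], \<lambda>x. [x!3, x!2 :: 'a]}"
  have *: "pt (h x) = pt [u0, u1]" if x: "x \<in> pt q" and h: "h \<in> ?T" "nonzero (h x)" for x h
  proof -
    obtain s where s: "s \<noteq> 0" "x = map ((*) s) q" using x by (rule ptE)
    have ox: "lies_over x u0 u1" unfolding s(2) over_scale[OF q s(1)] by (rule o)
    consider "h = (\<lambda>x. [x!0, x!1])" | "h = (\<lambda>x. [x!3, x!2])" using h(1) by blast
    then show ?thesis
    proof cases
      case 1
      then have "pt [x!0, x!1] = pt [u0, u1] \<longleftrightarrow> x!0 * u1 = x!1 * u0"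
        using h(2) u by (intro pt_pair_eq_iff) (simp_all add: nonzero_pair)
      then show ?thesis using ox 1 by (simp add: lies_over_def mult.commute)
    next
      case 2
      then have "pt [x!3, x!2] = pt [u0, u1] \<longleftrightarrow> x!3 * u1 = x!2 * u0"
        using h(2) u by (intro pt_pair_eq_iff) (simp_all add: nonzero_pair)
      then show ?thesis using ox 2 by (simp add: lies_over_def mult.commute)
    qed
  qed
  have "nonzero [q!0, q!1] \<or> nonzero [q!3, q!2]"
    unfolding nonzero_pair using cone_nonzero_coord[OF q] by blast
  then show ?thesis
    unfolding proj1_def
  proof
    assume "nonzero [q!0, q!1]"
    then show "glue ?T (pt q) = pt [u0, u1]"
      by (intro glue_eqI[OF pt_self[of q], of "\<lambda>x. [x!0, x!1]"] *) simp_all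
  next
    assume "nonzero [q!3, q!2]"
    then show "glue ?T (pt q) = pt [u0, u1]"
      by (intro glue_eqI[OF pt_self[of q], of "\<lambda>x. [x!3, x!2]"] *) simp_all
  qed
qed

lemma proj2_eq:
  assumes q: "q \<in> EC_cone c" and o: "lies_over2 q w0 w1" and w: "w0 \<noteq> 0 \<or> w1 \<noteq> 0"
  shows "proj2 (pt q) = pt [w0, w1]"
proof -
  let ?T = "{\<lambda>x. [x!0, x!3], \<lambda>x. [x!1, x!2 :: 'a]}"
  have *: "pt (h x) = pt [w0, w1]" if x: "x \<in> pt q" and h: "h \<in> ?T" "nonzero (h x)" for x h
  proof -
    obtain s where s: "s \<noteq> 0" "x = map ((*) s) q" using x by (rule ptE)
    have ox: "lies_over2 x w0 w1"
      using o coneD(1)[OF q] unfolding s(2) by (simp add: lies_over2_def mult.left_commute[of _ s])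
    consider "h = (\<lambda>x. [x!0, x!3])" | "h = (\<lambda>x. [x!1, x!2])" using h(1) by blast
    then show ?thesis
    proof cases
      case 1
      then have "pt [x!0, x!3] = pt [w0, w1] \<longleftrightarrow> x!0 * w1 = x!3 * w0"
        using h(2) w by (intro pt_pair_eq_iff) (simp_all add: nonzero_pair)
      then show ?thesis using ox 1 by (simp add: lies_over2_def mult.commute)
    next
      case 2
      then have "pt [x!1, x!2] = pt [w0, w1] \<longleftrightarrow> x!1 * w1 = x!2 * w0"
        using h(2) w by (intro pt_pair_eq_iff) (simp_all add: nonzero_pair)
      then show ?thesis using ox 2 by (simp add: lies_over2_def mult.commute)
    qed
  qed
  have "nonzero [q!0, q!3] \<or> nonzero [q!1, q!2]"
    unfolding nonzero_pair using cone_nonzero_coord[OF q] by blast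
  then show ?thesis
    unfolding proj2_def
  proof
    assume "nonzero [q!0, q!3]"
    then show "glue ?T (pt q) = pt [w0, w1]"
      by (intro glue_eqI[OF pt_self[of q], of "\<lambda>x. [x!0, x!3]"] *) simp_all
  next
    assume "nonzero [q!1, q!2]"
    then show "glue ?T (pt q) = pt [w0, w1]"
      by (intro glue_eqI[OF pt_self[of q], of "\<lambda>x. [x!1, x!2]"] *) simp_all
  qed
qed

lemma proj1_eq_imp:
  assumes "Z \<in> EC c" "W \<in> EC c" "proj1 Z = proj1 W"
  shows "Z = W \<or> Z = neg_pt W"
proof -
  obtain z where z: "z \<in> EC_cone c" "Z = pt z" using assms(1) by (rule EC_E)
  obtain w where w: "w \<in> EC_cone c" "W = pt w" using assms(2) by (rule EC_E)
  obtain u0 u1 where u: "u0 \<noteq> 0 \<or> u1 \<noteq> 0" "lies_over z u0 u1" using over_ex[OF z(1)] .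
  obtain v0 v1 where v: "v0 \<noteq> 0 \<or> v1 \<noteq> 0" "lies_over w v0 v1" using over_ex[OF w(1)] .
  have "u0 * v1 = u1 * v0"
    using assms(3) proj1_eq[OF z(1) u(2,1)] proj1_eq[OF w(1) v(2,1)] z(2) w(2) pt_pair_eq_iff[OF u(1) v(1)] by simp
  then obtain s where s: "s \<noteq> 0" "u0 = s * v0" "u1 = s * v1"
    using proportional[OF v(1) u(1)] by (metis mult.commute)
  have "lies_over w u0 u1" by (rule lies_over_proportional[OF v(2) s(2,3)])
  then show ?thesis using same_fibre[OF z(1) w(1) u] neg_pt_pt[OF w(1)] z(2) w(2) by simp
qed

lemma skew_segre_pt:
  fixes a0 a1 b0 b1 :: 'a
  shows "skew_segre (pt [a0, a1]) (pt [b0, b1]) = pt [a0 * b0, a1 * b0, a1 * b1, a0 * b1]" (is "_ = ?Z")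
proof -
  have *: "pt [a!0 * b!0, a!1 * b!0, a!1 * b!1, a!0 * b!1] = ?Z" if ab: "a \<in> pt [a0, a1]" "b \<in> pt [b0, b1]" for a b
  proof -
    obtain r where r: "r \<noteq> 0" "a = map ((*) r) [a0, a1]" using ab(1) by (rule ptE)
    obtain s where s: "s \<noteq> 0" "b = map ((*) s) [b0, b1]" using ab(2) by (rule ptE)
    have "[a!0 * b!0, a!1 * b!0, a!1 * b!1, a!0 * b!1] = map ((*) (r * s)) [a0 * b0, a1 * b0, a1 * b1, a0 * b1]"
      unfolding r(2) s(2) by (simp add: mult_ac)
    then show ?thesis using pt_scale[of "r * s" "[a0 * b0, a1 * b0, a1 * b1, a0 * b1]"] r(1) s(1) by simp
  qed
  show ?thesis
    unfolding skew_segre_def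
  proof (rule the_equality)
    show "\<forall>a\<in>pt [a0, a1]. \<forall>b\<in>pt [b0, b1]. ?Z = pt [a!0 * b!0, a!1 * b!0, a!1 * b!1, a!0 * b!1]"
      using * by blast
    fix Z' assume "\<forall>a\<in>pt [a0, a1]. \<forall>b\<in>pt [b0, b1]. Z' = pt [a!0 * b!0, a!1 * b!0, a!1 * b!1, a!0 * b!1]"
    then show "Z' = ?Z" using * pt_self by blast
  qed
qed

lemma skew_segre_proj:
  assumes Z: "Z \<in> EC c"
  shows "skew_segre (proj1 Z) (proj2 Z) = Z"
proof -
  obtain z where z: "z \<in> EC_cone c" "Z = pt z" using Z by (rule EC_E)
  obtain a0 a1 b0 b1 where p: "z = [a0 * b0, a1 * b0, a1 * b1, a0 * b1]"
    "a0 \<noteq> 0 \<or> a1 \<noteq> 0" "b0 \<noteq> 0 \<or> b1 \<noteq> 0"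
    using z(1) by (rule cone_param)
  have 1: "proj1 Z = pt [a0, a1]"
    unfolding z(2) by (rule proj1_eq[OF z(1) _ p(2)]) (simp add: lies_over_def p(1))
  have 2: "proj2 Z = pt [b0, b1]"
    unfolding z(2) by (rule proj2_eq[OF z(1) _ p(3)]) (simp add: lies_over2_def p(1))
  have "skew_segre (proj1 Z) (proj2 Z) = pt z" unfolding 1 2 p(1) by (rule skew_segre_pt)
  then show ?thesis using z(2) by simp
qed

lemma EC_group_simps: "carrier (EC_group c) = EC c" "\<one>\<^bsub>EC_group c\<^esub> = EC_O" "P \<otimes>\<^bsub>EC_group c\<^esub> Q = EC_add c P Q"
  by (simp_all add: EC_group_def)

lemma Kummer_Delta_eq_image:
  assumes P: "P \<in> EC c"
  shows "Kummer_Delta c P = kappa c P ` EC c"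
proof -
  interpret comm_group "EC_group c" by (rule EC_comm_group)
  have car: "carrier (EC_group c) = EC c" by (rule EC_group_simps)
  have iff: "Q \<otimes>\<^bsub>EC_group c\<^esub> inv\<^bsub>EC_group c\<^esub> R = P \<longleftrightarrow> R = Q \<otimes>\<^bsub>EC_group c\<^esub> inv\<^bsub>EC_group c\<^esub> P"
    if "Q \<in> EC c" "R \<in> EC c" for Q R
  proof -
    have c: "Q \<in> carrier (EC_group c)" "R \<in> carrier (EC_group c)" "P \<in> carrier (EC_group c)"
      using that P car by simp_all
    have "Q \<otimes>\<^bsub>EC_group c\<^esub> inv\<^bsub>EC_group c\<^esub> R = P \<longleftrightarrow> Q = P \<otimes>\<^bsub>EC_group c\<^esub> R"
      using c inv_solve_right[of P Q R] by auto
    also have "\<dots> \<longleftrightarrow> Q = R \<otimes>\<^bsub>EC_group c\<^esub> P" using c m_comm by simp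
    also have "\<dots> \<longleftrightarrow> R = Q \<otimes>\<^bsub>EC_group c\<^esub> inv\<^bsub>EC_group c\<^esub> P"
      using c inv_solve_right[of R Q P] by auto
    finally show ?thesis .
  qed
  have mem: "Q \<otimes>\<^bsub>EC_group c\<^esub> inv\<^bsub>EC_group c\<^esub> P \<in> EC c" if "Q \<in> EC c" for Q
    using that P m_closed inv_closed unfolding car by blast
  show ?thesis
  proof (intro equalityI subsetI)
    fix z assume "z \<in> Kummer_Delta c P"
    then obtain w where w: "w \<in> Delta c P" "z = (\<lambda>(Q, R). (proj1 Q, proj1 R)) w"
      unfolding Kummer_Delta_def by (elim imageE) simp
    obtain Q R where "w = (Q, R)" by (cases w)
    with w have QR: "Q \<in> EC c" "R \<in> EC c" "Q \<otimes>\<^bsub>EC_group c\<^esub> inv\<^bsub>EC_group c\<^esub> R = P" "z = (proj1 Q, proj1 R)"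
      by (simp_all add: Delta_def)
    then have "z = kappa c P Q" using iff[OF QR(1,2)] unfolding kappa_def by simp
    then show "z \<in> kappa c P ` EC c" using QR(1) by blast
  next
    fix z assume "z \<in> kappa c P ` EC c"
    then obtain Q where Q: "Q \<in> EC c" "z = kappa c P Q" by blast
    define R where "R = Q \<otimes>\<^bsub>EC_group c\<^esub> inv\<^bsub>EC_group c\<^esub> P"
    have "(Q, R) \<in> Delta c P"
      unfolding Delta_def using Q(1) mem[OF Q(1)] iff[OF Q(1) mem[OF Q(1)]] R_def by simp
    moreover have "z = (\<lambda>(Q, R). (proj1 Q, proj1 R)) (Q, R)" by (simp add: Q(2) kappa_def R_def)
    ultimately show "z \<in> Kummer_Delta c P" unfolding Kummer_Delta_def by (rule rev_image_eqI)
  qed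
qed

lemma T_neg: "neg_pt pt_T = pt_T"
  using neg_pt_pt[OF special_points(3)] by (simp add: pt_T_def neg_vec_def)

lemma two_torsion_iff:
  assumes "P \<in> EC c"
  shows "EC_add c P P = EC_O \<longleftrightarrow> neg_pt P = P"
proof -
  interpret comm_group "EC_group c" by (rule EC_comm_group)
  have P: "P \<in> carrier (EC_group c)" using assms EC_group_simps by simp
  have "EC_add c P P = EC_O \<longleftrightarrow> inv\<^bsub>EC_group c\<^esub> P = P"
    using inv_equality[OF _ P P] r_inv[OF P] EC_group_simps by metis
  then show ?thesis using EC_inv[OF assms] by simp
qed

text \<open>Inversion multiplies a coordinate vector of a fixed point by some s with s^2 = 1, hence
  s = 1 in characteristic 2 and y = 1. This leaves O and T, which lie over x = 0 and
  infinity.\<close>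

lemma neg_fixed_lies_over:
  assumes q: "q \<in> EC_cone c" and fixed: "neg_pt (pt q) = pt q" and o: "lies_over q u0 u1"
  shows "u0 * u1 = 0"
proof (rule ccontr)
  assume u: "u0 * u1 \<noteq> 0"
  have ne: "pt q \<noteq> EC_O" "pt q \<noteq> pt_T"
  proof -
    show "pt q \<noteq> EC_O"
    proof
      assume "pt q = EC_O"
      then obtain s where "s \<noteq> 0" "q = map ((*) s) [1,0,0,1]" unfolding EC_O_def using pt_eqD by metis
      then show False using o u by (simp add: lies_over_def)
    qed
    show "pt q \<noteq> pt_T"
    proof
      assume "pt q = pt_T"
      then obtain s where "s \<noteq> 0" "q = map ((*) s) [0,1,1,0]" unfolding pt_T_def using pt_eqD by metis
      then show False using o u by (simp add: lies_over_def)
    qed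
  qed
  obtain x p r where p: "q = [p, x * p, x * r, r]" "x \<noteq> 0" "p \<noteq> r" "p \<noteq> 0 \<or> r \<noteq> 0"
    using nonspecial_param[OF q ne] by metis
  have "pt q = pt (neg_vec q)" using fixed neg_pt_pt[OF q] by simp
  then obtain s where s: "s \<noteq> 0" "neg_vec q = map ((*) s) q" by (rule pt_eqD)
  have "neg_vec q = [r, x * r, x * p, p]" "map ((*) s) q = [s * p, s * (x * p), s * (x * r), s * r]"
    by (simp_all add: p(1) neg_vec_def)
  with s(2) have "[r, x * r, x * p, p] = [s * p, s * (x * p), s * (x * r), s * r]" by metis
  then have pr: "r = s * p" "p = s * r" unfolding list.inject by blast+
  have "p \<noteq> 0" using p(4) pr(1) by (metis mult_zero_right)
  moreover have "(s * s) * p = 1 * p" using pr by (metis mult.assoc mult_1_left)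
  ultimately have "s * s = 1" using mult_right_cancel by blast
  then have "(s + 1)\<^sup>2 = 0" unfolding square_add by (simp add: power2_eq_square add_self)
  then have "s = 1" by (simp add: add_eq_0_iff_eq)
  then show False using pr(1) p(3) by simp
qed

lemma kappa_lies_over:
  assumes q: "q \<in> EC_cone c" and t: "t \<in> EC_cone c"
  obtains R where "R \<in> EC_cone c" "kappa c (pt t) (pt q) = (proj1 (pt q), proj1 (pt R))"
    "pt R = pt q \<otimes>\<^bsub>EC_group c\<^esub> inv\<^bsub>EC_group c\<^esub> (pt t)"
    "lies_over R (t!0 * q!0 + t!2 * q!2) (t!3 * q!1 + t!1 * q!3)"
    "lies_over R (t!1 * q!1 + t!3 * q!3) (t!2 * q!0 + t!0 * q!2)"
proof -
  let ?y = "neg_vec t"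
  have y: "?y \<in> EC_cone c" by (rule neg_vec_cone[OF t])
  have diff: "pt q \<otimes>\<^bsub>EC_group c\<^esub> inv\<^bsub>EC_group c\<^esub> (pt t) = EC_add c (pt q) (pt ?y)"
    unfolding EC_inv[OF pt_EC[OF t]] neg_pt_pt[OF t] EC_group_simps ..
  obtain R where R: "R \<in> EC_cone c" "EC_add c (pt q) (pt ?y) = pt R"
    using EC_add_principal(1)[OF pt_EC[OF q] pt_EC[OF y]] by (rule EC_E)
  have comm: "EC_add c (pt ?y) (pt q) = pt R"
  proof -
    interpret comm_group "EC_group c" by (rule EC_comm_group)
    show ?thesis using m_comm[of "pt ?y" "pt q"] pt_EC[OF q] pt_EC[OF y] R(2) unfolding EC_group_simps by simp
  qed
  show ?thesis
  proof (rule that[OF R(1)])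
    show "lies_over R (t!0 * q!0 + t!2 * q!2) (t!3 * q!1 + t!1 * q!3)"
      using EC_add_lies_over[OF q y R] by (simp add: sum_lies_over_def neg_vec_def mult.commute)
    show "lies_over R (t!1 * q!1 + t!3 * q!3) (t!2 * q!0 + t!0 * q!2)"
      using EC_add_lies_over[OF y q R(1) comm] by (simp add: sum_lies_over_def neg_vec_def add.commute)
  qed (use R diff in \<open>simp_all add: kappa_def\<close>)
qed

text \<open>The four entries are two 2x2 linear systems in the coordinates of q, with determinants
  (t0 + t2)^2 and (t1 + t3)^2. These do not both vanish on the curve, and no point has X0 = X2 = 0
  or X1 = X3 = 0.\<close>

lemma difference_tuples_cover:
  assumes q: "q \<in> EC_cone c" and t: "t \<in> EC_cone c"
  shows "t!0 * q!0 + t!2 * q!2 \<noteq> 0 \<or> t!3 * q!1 + t!1 * q!3 \<noteq> 0 \<or>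
    t!1 * q!1 + t!3 * q!3 \<noteq> 0 \<or> t!2 * q!0 + t!0 * q!2 \<noteq> 0"
proof (rule ccontr)
  assume "\<not> ?thesis"
  then have z: "t!0 * q!0 + t!2 * q!2 = 0" "t!3 * q!1 + t!1 * q!3 = 0"
    "t!1 * q!1 + t!3 * q!3 = 0" "t!2 * q!0 + t!0 * q!2 = 0" by simp_all
  obtain n where n: "n < 4" "q!n \<noteq> 0"
    using coneD(1,2)[OF q] unfolding nonzero_def by (auto simp: in_set_conv_nth)
  have "((t!0)\<^sup>2 + (t!2)\<^sup>2) * q!0 = t!0 * (t!0 * q!0 + t!2 * q!2) + t!2 * (t!2 * q!0 + t!0 * q!2)"
    "((t!0)\<^sup>2 + (t!2)\<^sup>2) * q!2 = t!2 * (t!0 * q!0 + t!2 * q!2) + t!0 * (t!2 * q!0 + t!0 * q!2)"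
    "((t!1)\<^sup>2 + (t!3)\<^sup>2) * q!1 = t!3 * (t!3 * q!1 + t!1 * q!3) + t!1 * (t!1 * q!1 + t!3 * q!3)"
    "((t!1)\<^sup>2 + (t!3)\<^sup>2) * q!3 = t!1 * (t!3 * q!1 + t!1 * q!3) + t!3 * (t!1 * q!1 + t!3 * q!3)"
    by (simp_all add: ring2)
  then have k: "(t!0 + t!2)\<^sup>2 * q!0 = 0" "(t!0 + t!2)\<^sup>2 * q!2 = 0" "(t!1 + t!3)\<^sup>2 * q!1 = 0" "(t!1 + t!3)\<^sup>2 * q!3 = 0"
    unfolding z square_add by simp_all
  show False
  proof (cases "t!0 = t!2 \<and> t!1 = t!3")
    case True
    then have e: "t!2 = t!0" "t!3 = t!1" by simp_all
    have "t!0 * t!0 = t!1 * t!1" using coneD(4)[OF t] unfolding e .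
    then have "(t!0 + t!1)\<^sup>2 = 0" unfolding square_add by (simp add: power2_eq_square add_self)
    then have "t!0 = t!1" by (simp add: add_eq_0_iff_eq)
    then have "c\<^sup>2 * t!1 * t!1 = 0" using coneD(3)[OF t] e by (simp add: add_self add_self_left add_ac)
    then have "t!1 = 0" using c_nz by simp
    then show False using cone_nonzero_coord[OF t] e \<open>t!0 = t!1\<close> by simp
  next
    case False
    then consider "q!0 = 0" "q!2 = 0" | "q!1 = 0" "q!3 = 0"
      using k by (auto simp: add_eq_0_iff_eq)
    then show False
    proof cases
      case 1
      then have "q!1 = 0 \<or> q!3 = 0" using coneD(4)[OF q] by auto
      moreover have "(q!1 + q!3)\<^sup>2 = 0" using coneD(3)[OF q] 1 by simp
      ultimately show False using cone_nonzero_coord[OF q] 1 by auto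
    next
      case 2
      then have "q!0 = 0 \<or> q!2 = 0" using coneD(4)[OF q] by auto
      moreover have "(q!0 + q!2)\<^sup>2 = 0" using coneD(3)[OF q] 2 \<open>q!0 = 0 \<or> q!2 = 0\<close> by auto
      ultimately show False using cone_nonzero_coord[OF q] 2 by auto
    qed
  qed
qed

lemma difference_lies_over_ex:
  assumes q: "q \<in> EC_cone c" and t: "t \<in> EC_cone c"
    and R: "lies_over R (t!0 * q!0 + t!2 * q!2) (t!3 * q!1 + t!1 * q!3)"
      "lies_over R (t!1 * q!1 + t!3 * q!3) (t!2 * q!0 + t!0 * q!2)"
  obtains v0 v1 where "v0 \<noteq> 0 \<or> v1 \<noteq> 0" "lies_over R v0 v1"
    "(v0, v1) = (t!0 * q!0 + t!2 * q!2, t!3 * q!1 + t!1 * q!3) \<or>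
     (v0, v1) = (t!1 * q!1 + t!3 * q!3, t!2 * q!0 + t!0 * q!2)"
  using difference_tuples_cover[OF q t] R that by metis

section \<open>The equation of the Kummer-oriented curve\<close>

definition kummer :: "'a \<Rightarrow> 'a \<Rightarrow> 'a \<Rightarrow> 'a \<Rightarrow> 'a \<Rightarrow> 'a \<Rightarrow> 'a" where
  "kummer s0 s1 u0 u1 v0 v1 = s0\<^sup>2 * (u0 * v1 + u1 * v0)\<^sup>2 + s1\<^sup>2 * (u0 * v0 + u1 * v1)\<^sup>2
     + c\<^sup>2 * s0 * s1 * u0 * u1 * v0 * v1"

lemma Kummer_poly_eq: "Kummer_poly c s0 s1 (u, v) = kummer s0 s1 (u!0) (u!1) (v!0) (v!1)"
  by (simp add: Kummer_poly_def kummer_def diff_eq_add)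

lemma kummer_scale: "kummer (r * s0) (r * s1) (a * u0) (a * u1) (b * v0) (b * v1) = r\<^sup>2 * a\<^sup>2 * b\<^sup>2 * kummer s0 s1 u0 u1 v0 v1"
proof -
  have "(a * u0 * (b * v1) + a * u1 * (b * v0)) = a * b * (u0 * v1 + u1 * v0)"
    "(a * u0 * (b * v0) + a * u1 * (b * v1)) = a * b * (u0 * v0 + u1 * v1)"
    by (simp_all add: algebra_simps)
  then show ?thesis unfolding kummer_def by (simp add: power_mult_distrib distrib_left mult_ac power2_eq_square)
qed

text \<open>In characteristic 2 the first two terms of the equation form the square of a single
  expression; the curve equations of q and t identify the third term with the same square.\<close>

lemma kummer_difference_param:
  assumes e: "(a0 + a1)\<^sup>2 * (b0 + b1)\<^sup>2 = c\<^sup>2 * a0 * a1 * b0 * b1"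
    and e': "(s0 + s1)\<^sup>2 * (d0 + d1)\<^sup>2 = c\<^sup>2 * s0 * s1 * d0 * d1"
  shows "kummer s0 s1 a0 a1 (s0 * d0 * (a0 * b0) + s1 * d1 * (a1 * b1)) (s0 * d1 * (a1 * b0) + s1 * d0 * (a0 * b1)) = 0"
proof -
  define f0 f1 where "f0 = s0 * d0 * (a0 * b0) + s1 * d1 * (a1 * b1)"
    and "f1 = s0 * d1 * (a1 * b0) + s1 * d0 * (a0 * b1)"
  have root: "s0 * (a0 * f1 + a1 * f0) + s1 * (a0 * f0 + a1 * f1) =
      a0 * a1 * (s0 + s1) * (d0 + d1) * (s0 * b0 + s1 * b1) + s0 * s1 * (a0 + a1) * (b0 + b1) * (a0 * d0 + a1 * d1)"
    unfolding f0_def f1_def by (simp add: ring2)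
  have "c\<^sup>2 * s0 * s1 * a0 * a1 * f0 * f1 =
      (c\<^sup>2 * s0 * s1 * d0 * d1) * (a0\<^sup>2 * a1\<^sup>2 * (s0\<^sup>2 * b0\<^sup>2 + s1\<^sup>2 * b1\<^sup>2))
      + (c\<^sup>2 * a0 * a1 * b0 * b1) * (s0\<^sup>2 * s1\<^sup>2 * (a0\<^sup>2 * d0\<^sup>2 + a1\<^sup>2 * d1\<^sup>2))"
    unfolding f0_def f1_def by (simp add: algebra_simps power2_eq_square)
  also have "\<dots> = (a0 * a1 * (s0 + s1) * (d0 + d1) * (s0 * b0 + s1 * b1) + s0 * s1 * (a0 + a1) * (b0 + b1) * (a0 * d0 + a1 * d1))\<^sup>2"
    unfolding e[symmetric] e'[symmetric] square_add power_mult_distrib by (simp only: mult_ac)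
  also have "\<dots> = s0\<^sup>2 * (a0 * f1 + a1 * f0)\<^sup>2 + s1\<^sup>2 * (a0 * f0 + a1 * f1)\<^sup>2"
    unfolding root[symmetric] square_add power_mult_distrib by (simp only: mult_ac)
  finally show ?thesis unfolding kummer_def f0_def[symmetric] f1_def[symmetric] by (simp add: add_self)
qed

lemma kummer_difference:
  assumes q: "q \<in> EC_cone c" and t: "t \<in> EC_cone c" and s: "s0 \<noteq> 0 \<or> s1 \<noteq> 0" "lies_over t s0 s1"
    and u: "u0 \<noteq> 0 \<or> u1 \<noteq> 0" "lies_over q u0 u1"
    and v: "(v0, v1) = (t!0 * q!0 + t!2 * q!2, t!3 * q!1 + t!1 * q!3) \<or>
     (v0, v1) = (t!1 * q!1 + t!3 * q!3, t!2 * q!0 + t!0 * q!2)"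
  shows "kummer s0 s1 u0 u1 v0 v1 = 0"
proof -
  obtain a0 a1 b0 b1 where p: "q = [a0 * b0, a1 * b0, a1 * b1, a0 * b1]"
    "a0 \<noteq> 0 \<or> a1 \<noteq> 0" "b0 \<noteq> 0 \<or> b1 \<noteq> 0" "(a0 + a1)\<^sup>2 * (b0 + b1)\<^sup>2 = c\<^sup>2 * a0 * a1 * b0 * b1"
    using q by (rule cone_param)
  obtain e0 e1 d0 d1 where p': "t = [e0 * d0, e1 * d0, e1 * d1, e0 * d1]"
    "e0 \<noteq> 0 \<or> e1 \<noteq> 0" "d0 \<noteq> 0 \<or> d1 \<noteq> 0" "(e0 + e1)\<^sup>2 * (d0 + d1)\<^sup>2 = c\<^sup>2 * e0 * e1 * d0 * d1"
    using t by (rule cone_param)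
  have "u1 * a0 = u0 * a1" using u(2) unfolding p(1) over_param[OF p(3)] .
  then have "a0 * u1 = a1 * u0" by (simp only: mult.commute)
  then obtain m where m: "m \<noteq> 0" "u0 = m * a0" "u1 = m * a1" using proportional[OF p(2) u(1)] by metis
  have "s1 * e0 = s0 * e1" using s(2) unfolding p'(1) over_param[OF p'(3)] .
  then have "e0 * s1 = e1 * s0" by (simp only: mult.commute)
  then obtain n where n: "n \<noteq> 0" "s0 = n * e0" "s1 = n * e1" using proportional[OF p'(2) s(1)] by metis
  have "kummer e0 e1 a0 a1 v0 v1 = 0"
    using v
  proof
    assume "(v0, v1) = (t!0 * q!0 + t!2 * q!2, t!3 * q!1 + t!1 * q!3)"
    then show ?thesis using kummer_difference_param[OF p(4) p'(4)] by (simp add: p(1) p'(1))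
  next
    assume "(v0, v1) = (t!1 * q!1 + t!3 * q!3, t!2 * q!0 + t!0 * q!2)"
    \<comment> \<open>The second tuple is the first one for -q and -t: inversion exchanges b0 with
      b1 and d0 with d1.\<close>
    moreover have "(a0 + a1)\<^sup>2 * (b1 + b0)\<^sup>2 = c\<^sup>2 * a0 * a1 * b1 * b0" "(e0 + e1)\<^sup>2 * (d1 + d0)\<^sup>2 = c\<^sup>2 * e0 * e1 * d1 * d0"
      using p(4) p'(4) by (simp_all add: add_ac mult_ac)
    ultimately show ?thesis using kummer_difference_param[of a0 a1 b1 b0 e0 e1 d1 d0] by (simp add: p(1) p'(1) add.commute)
  qed
  then show ?thesis using kummer_scale[of n e0 e1 m a0 a1 1 v0 v1] unfolding m n by simp
qed

text \<open>In characteristic \<open>2\<close> the polar form of a binary quadratic form is \<open>B\<close> times the determinant.\<close>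

lemma binary_quadratic_roots:
  fixes A B C :: 'a
  defines "Q \<equiv> \<lambda>x y. A * x\<^sup>2 + B * x * y + C * y\<^sup>2"
  assumes "Q p0 p1 = 0" "Q q0 q1 = 0" "Q v0 v1 = 0" "p0 * q1 \<noteq> p1 * q0" "v0 * p1 \<noteq> v1 * p0" "v0 * q1 \<noteq> v1 * q0"
  shows "A = 0 \<and> B = 0 \<and> C = 0"
proof -
  define D l m where "D = p0 * q1 + p1 * q0" and "l = v0 * q1 + v1 * q0" and "m = v0 * p1 + v1 * p0"
  have nz: "D \<noteq> 0" "l \<noteq> 0" "m \<noteq> 0" using assms(5-7) by (simp_all add: D_def l_def m_def add_eq_0_iff_eq)
  have "D\<^sup>2 * Q v0 v1 = l\<^sup>2 * Q p0 p1 + m\<^sup>2 * Q q0 q1 + B * D * l * m"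
    unfolding Q_def D_def l_def m_def by (simp add: ring2)
  then have B: "B = 0" using assms(2-4) nz by simp
  have "A * D\<^sup>2 = q1\<^sup>2 * Q p0 p1 + p1\<^sup>2 * Q q0 q1" "C * D\<^sup>2 = q0\<^sup>2 * Q p0 p1 + p0\<^sup>2 * Q q0 q1"
    unfolding Q_def D_def B square_add by (simp_all add: ring2)
  then show ?thesis using assms(2,3) nz(1) B by simp
qed

lemma kummer_as_quadratic:
  "kummer s0 s1 u0 u1 v0 v1 = (s0 * u1 + s1 * u0)\<^sup>2 * v0\<^sup>2 + (c\<^sup>2 * s0 * s1 * u0 * u1) * v0 * v1 + (s0 * u0 + s1 * u1)\<^sup>2 * v1\<^sup>2"
  unfolding kummer_def by (simp add: ring2)

lemma kummer_quadratic_nonzero: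
  assumes "s0 \<noteq> 0 \<or> s1 \<noteq> 0" "u0 \<noteq> 0 \<or> u1 \<noteq> 0"
  shows "(s0 * u1 + s1 * u0)\<^sup>2 \<noteq> 0 \<or> c\<^sup>2 * s0 * s1 * u0 * u1 \<noteq> 0 \<or> (s0 * u0 + s1 * u1)\<^sup>2 \<noteq> 0"
proof (rule ccontr)
  assume "\<not> ?thesis"
  then have "s0 * u1 + s1 * u0 = 0" "s0 * u0 + s1 * u1 = 0" "s0 = 0 \<or> s1 = 0 \<or> u0 = 0 \<or> u1 = 0"
    using c_nz by auto
  then show False using assms by auto
qed

lemma zero_locus_Kummer_iff:
  assumes "u0 \<noteq> 0 \<or> u1 \<noteq> 0" "v0 \<noteq> 0 \<or> v1 \<noteq> 0"
  shows "(pt [u0, u1], pt [v0, v1]) \<in> zero_locus (Kummer_poly c s0 s1) \<longleftrightarrow> kummer s0 s1 u0 u1 v0 v1 = 0"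
proof -
  have ps: "pt [x, y] \<in> proj_space 1" if "x \<noteq> 0 \<or> y \<noteq> 0" for x y :: 'a
    unfolding proj_space_def using that nonzero_pair by (auto intro!: exI[of _ "[x, y]"])
  have "Kummer_poly c s0 s1 (u, v) = 0"
    if uv: "kummer s0 s1 u0 u1 v0 v1 = 0" "u \<in> pt [u0, u1]" "v \<in> pt [v0, v1]" for u v
  proof -
    obtain a where a: "u = map ((*) a) [u0, u1]" using uv(2) by (rule ptE)
    obtain b where b: "v = map ((*) b) [v0, v1]" using uv(3) by (rule ptE)
    show ?thesis
      using uv(1) kummer_scale[of 1 s0 s1 a u0 u1 b v0 v1] unfolding Kummer_poly_eq a b by simp
  qed
  moreover have "kummer s0 s1 u0 u1 v0 v1 = 0" if "\<forall>u\<in>pt [u0, u1]. \<forall>v\<in>pt [v0, v1]. Kummer_poly c s0 s1 (u, v) = 0"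
    using that pt_self[of "[u0, u1]"] pt_self[of "[v0, v1]"] Kummer_poly_eq[of s0 s1 "[u0, u1]" "[v0, v1]"] by force
  ultimately show ?thesis
    unfolding zero_locus_def using ps[OF assms(1)] ps[OF assms(2)] by auto
qed

lemma Kummer_Delta_eq_zero_locus:
  assumes t: "t \<in> EC_cone c" and s: "s0 \<noteq> 0 \<or> s1 \<noteq> 0" "lies_over t s0 s1"
  shows "Kummer_Delta c (pt t) = zero_locus (Kummer_poly c s0 s1)"
proof -
  interpret comm_group "EC_group c" by (rule EC_comm_group)
  have P: "pt t \<in> EC c" by (rule pt_EC[OF t])
  show ?thesis
    unfolding Kummer_Delta_eq_image[OF P]
  proof (intro equalityI subsetI)
    fix z assume "z \<in> kappa c (pt t) ` EC c"
    then obtain q where q: "q \<in> EC_cone c" "z = kappa c (pt t) (pt q)" by (auto simp: EC_def)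
    obtain R where R: "R \<in> EC_cone c" "kappa c (pt t) (pt q) = (proj1 (pt q), proj1 (pt R))"
      "lies_over R (t!0 * q!0 + t!2 * q!2) (t!3 * q!1 + t!1 * q!3)"
      "lies_over R (t!1 * q!1 + t!3 * q!3) (t!2 * q!0 + t!0 * q!2)"
      using kappa_lies_over[OF q(1) t] by metis
    obtain v0 v1 where v: "v0 \<noteq> 0 \<or> v1 \<noteq> 0" "lies_over R v0 v1"
      "(v0, v1) = (t!0 * q!0 + t!2 * q!2, t!3 * q!1 + t!1 * q!3) \<or>
       (v0, v1) = (t!1 * q!1 + t!3 * q!3, t!2 * q!0 + t!0 * q!2)"
      using difference_lies_over_ex[OF q(1) t R(3,4)] .
    obtain u0 u1 where u: "u0 \<noteq> 0 \<or> u1 \<noteq> 0" "lies_over q u0 u1" using over_ex[OF q(1)] .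
    show "z \<in> zero_locus (Kummer_poly c s0 s1)"
      unfolding q(2) R(2) proj1_eq[OF q(1) u(2,1)] proj1_eq[OF R(1) v(2,1)] zero_locus_Kummer_iff[OF u(1) v(1)]
      by (rule kummer_difference[OF q(1) t s u v(3)])
  next
    fix z assume z: "z \<in> zero_locus (Kummer_poly c s0 s1)"
    then obtain x y where xy: "z = (pt x, pt y)" "length x = 2" "nonzero x" "length y = 2" "nonzero y"
      by (auto simp: zero_locus_def proj_space_def)
    obtain u0 u1 where x: "x = [u0, u1]" using xy(2) by (auto simp: length_Suc_conv numeral_eq_Suc)
    obtain v0 v1 where y: "y = [v0, v1]" using xy(4) by (auto simp: length_Suc_conv numeral_eq_Suc)
    have u: "u0 \<noteq> 0 \<or> u1 \<noteq> 0" and v: "v0 \<noteq> 0 \<or> v1 \<noteq> 0" using xy(3,5) nonzero_pair unfolding x y by auto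
    have k0: "kummer s0 s1 u0 u1 v0 v1 = 0"
      using z zero_locus_Kummer_iff[OF u v] unfolding xy(1) x y by blast
    obtain q where q: "q \<in> EC_cone c" "lies_over q u0 u1" using fibre_point_ex[OF u] .
    have nq: "neg_vec q \<in> EC_cone c" "lies_over (neg_vec q) u0 u1"
      using neg_vec_cone[OF q(1)] q(2) over_neg_vec by blast+
    have val: "\<exists>w0 w1. (w0 \<noteq> 0 \<or> w1 \<noteq> 0) \<and> kummer s0 s1 u0 u1 w0 w1 = 0 \<and>
        proj1 (pt r \<otimes>\<^bsub>EC_group c\<^esub> inv\<^bsub>EC_group c\<^esub> (pt t)) = pt [w0, w1] \<and>
        kappa c (pt t) (pt r) = (pt [u0, u1], pt [w0, w1])"
      if r: "r \<in> EC_cone c" "lies_over r u0 u1" for r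
    proof -
      obtain R where R: "R \<in> EC_cone c" "kappa c (pt t) (pt r) = (proj1 (pt r), proj1 (pt R))"
        "pt R = pt r \<otimes>\<^bsub>EC_group c\<^esub> inv\<^bsub>EC_group c\<^esub> (pt t)"
        "lies_over R (t!0 * r!0 + t!2 * r!2) (t!3 * r!1 + t!1 * r!3)"
        "lies_over R (t!1 * r!1 + t!3 * r!3) (t!2 * r!0 + t!0 * r!2)"
        using kappa_lies_over[OF r(1) t] .
      obtain w0 w1 where w: "w0 \<noteq> 0 \<or> w1 \<noteq> 0" "lies_over R w0 w1"
        "(w0, w1) = (t!0 * r!0 + t!2 * r!2, t!3 * r!1 + t!1 * r!3) \<or>
         (w0, w1) = (t!1 * r!1 + t!3 * r!3, t!2 * r!0 + t!0 * r!2)"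
        using difference_lies_over_ex[OF r(1) t R(4,5)] .
      show ?thesis
        using w(1) kummer_difference[OF r(1) t s u r(2) w(3)] R(2,3) proj1_eq[OF r(1,2) u] proj1_eq[OF R(1) w(2,1)]
        by metis
    qed
    obtain p0 p1 where p: "p0 \<noteq> 0 \<or> p1 \<noteq> 0" "kummer s0 s1 u0 u1 p0 p1 = 0"
      "proj1 (pt q \<otimes>\<^bsub>EC_group c\<^esub> inv\<^bsub>EC_group c\<^esub> (pt t)) = pt [p0, p1]"
      "kappa c (pt t) (pt q) = (pt [u0, u1], pt [p0, p1])"
      using val[OF q] by blast
    obtain n0 n1 where n: "n0 \<noteq> 0 \<or> n1 \<noteq> 0" "kummer s0 s1 u0 u1 n0 n1 = 0"
      "proj1 (pt (neg_vec q) \<otimes>\<^bsub>EC_group c\<^esub> inv\<^bsub>EC_group c\<^esub> (pt t)) = pt [n0, n1]"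
      "kappa c (pt t) (pt (neg_vec q)) = (pt [u0, u1], pt [n0, n1])"
      using val[OF nq] by blast
    \<comment> \<open>For fixed u the equation is a quadratic in v that is not identically zero, so
      it has no third root.\<close>
    have "v0 * p1 = v1 * p0 \<or> v0 * n1 = v1 * n0"
    proof (rule ccontr)
      assume ne: "\<not> ?thesis"
      define A B C where "A = (s0 * u1 + s1 * u0)\<^sup>2" and "B = c\<^sup>2 * s0 * s1 * u0 * u1" and "C = (s0 * u0 + s1 * u1)\<^sup>2"
      have k: "kummer s0 s1 u0 u1 w0 w1 = A * w0\<^sup>2 + B * w0 * w1 + C * w1\<^sup>2" for w0 w1
        unfolding A_def B_def C_def by (rule kummer_as_quadratic)
      have ABC: "A \<noteq> 0 \<or> B \<noteq> 0 \<or> C \<noteq> 0" unfolding A_def B_def C_def by (rule kummer_quadratic_nonzero[OF s(1) u])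
      show False
      proof (cases "p0 * n1 = p1 * n0")
        case False
        then show False using binary_quadratic_roots[of A p0 B p1 C n0 n1 v0 v1] p(2) n(2) k0 k ne ABC by simp
      next
        case True
        \<comment> \<open>If the roots from q and -q coincide, then q or P is fixed by inversion.
          The mixed coefficient B is then zero, and the quadratic is the square of a linear form,
          with only one root.\<close>
        then have "pt [p0, p1] = pt [n0, n1]" using pt_pair_eq_iff[OF p(1) n(1)] by simp
        moreover have car: "pt q \<in> carrier (EC_group c)" "pt t \<in> carrier (EC_group c)"
          using pt_EC[OF q(1)] P EC_group_simps by simp_all
        have nQ: "pt (neg_vec q) = inv\<^bsub>EC_group c\<^esub> (pt q)" using EC_inv[OF pt_EC[OF q(1)]] neg_pt_pt[OF q(1)] by simp
        ultimately have "proj1 (pt q \<otimes>\<^bsub>EC_group c\<^esub> inv\<^bsub>EC_group c\<^esub> (pt t)) =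
            proj1 (inv\<^bsub>EC_group c\<^esub> (pt q) \<otimes>\<^bsub>EC_group c\<^esub> inv\<^bsub>EC_group c\<^esub> (pt t))" using p(3) n(3) by simp
        moreover have E: "pt q \<otimes>\<^bsub>EC_group c\<^esub> inv\<^bsub>EC_group c\<^esub> (pt t) \<in> EC c"
          "inv\<^bsub>EC_group c\<^esub> (pt q) \<otimes>\<^bsub>EC_group c\<^esub> inv\<^bsub>EC_group c\<^esub> (pt t) \<in> EC c"
          using car m_closed inv_closed EC_group_simps(1) by blast+
        ultimately have "pt q \<otimes>\<^bsub>EC_group c\<^esub> inv\<^bsub>EC_group c\<^esub> (pt t) = inv\<^bsub>EC_group c\<^esub> (pt q) \<otimes>\<^bsub>EC_group c\<^esub> inv\<^bsub>EC_group c\<^esub> (pt t) \<or>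
            pt q \<otimes>\<^bsub>EC_group c\<^esub> inv\<^bsub>EC_group c\<^esub> (pt t) = inv\<^bsub>EC_group c\<^esub> (inv\<^bsub>EC_group c\<^esub> (pt q) \<otimes>\<^bsub>EC_group c\<^esub> inv\<^bsub>EC_group c\<^esub> (pt t))"
          using proj1_eq_imp EC_inv by metis
        then have "pt q = inv\<^bsub>EC_group c\<^esub> (pt q) \<or> inv\<^bsub>EC_group c\<^esub> (pt t) = pt t"
          using car by (simp add: inv_mult)
        then have "u0 * u1 = 0 \<or> s0 * s1 = 0"
          using neg_fixed_lies_over[OF q(1) _ q(2)] neg_fixed_lies_over[OF t _ s(2)] EC_inv[OF pt_EC[OF q(1)]] EC_inv[OF P] by metis
        then have B: "B = 0" unfolding B_def by auto
        have lin: "(s0 * u1 + s1 * u0) * w0 = (s0 * u0 + s1 * u1) * w1" if "kummer s0 s1 u0 u1 w0 w1 = 0" for w0 w1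
        proof -
          have "((s0 * u1 + s1 * u0) * w0 + (s0 * u0 + s1 * u1) * w1)\<^sup>2 = kummer s0 s1 u0 u1 w0 w1"
            unfolding k B unfolding A_def C_def square_add[of "(s0 * u1 + s1 * u0) * w0"] power_mult_distrib by simp
          then show ?thesis using that by (simp add: add_eq_0_iff_eq)
        qed
        define \<alpha> \<beta> where "\<alpha> = s0 * u1 + s1 * u0" and "\<beta> = s0 * u0 + s1 * u1"
        have ab: "\<alpha> \<noteq> 0 \<or> \<beta> \<noteq> 0" using ABC B unfolding A_def C_def \<alpha>_def \<beta>_def by auto
        have "\<alpha> * v0 = \<beta> * v1" "\<alpha> * p0 = \<beta> * p1" using lin[OF k0] lin[OF p(2)] unfolding \<alpha>_def \<beta>_def by simp_all
        then have "\<alpha> * (v0 * p1) = \<alpha> * (v1 * p0)" "\<beta> * (v0 * p1) = \<beta> * (v1 * p0)"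
          by (metis mult.assoc mult.left_commute mult.commute)+
        then show False using ab ne by auto
      qed
    qed
    then show "z \<in> kappa c (pt t) ` EC c"
    proof
      assume "v0 * p1 = v1 * p0"
      then have "z = kappa c (pt t) (pt q)" unfolding xy(1) x y p(4) using pt_pair_eq_iff[OF v p(1)] by simp
      then show ?thesis using pt_EC[OF q(1)] by blast
    next
      assume "v0 * n1 = v1 * n0"
      then have "z = kappa c (pt t) (pt (neg_vec q))" unfolding xy(1) x y n(4) using pt_pair_eq_iff[OF v n(1)] by simp
      then show ?thesis using pt_EC[OF nq(1)] by blast
    qed
  qed
qed

end

section \<open>The ideal of the Kummer-oriented curve\<close>

lemma prime_elem_linear: "prime_elem [:- x, 1 :: 'a::field:]"
  by (rule prime_elemI) (auto simp: is_unit_iff_degree simp flip: poly_eq_0_iff_dvd)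

text \<open>Exchanges the roles of the variables: the coefficient of a power of the inner variable
  is a polynomial in the outer one.\<close>

lemma coeff_poly_const:
  fixes q :: "'a::comm_ring_1 poly poly"
  shows "coeff (poly q [:y:]) i = poly (map_poly (\<lambda>p. coeff p i) q) y"
proof (induction q)
  case (pCons a q)
  have "map_poly (\<lambda>p. coeff p i) (pCons a q) = pCons (coeff a i) (map_poly (\<lambda>p. coeff p i) q)"
    by (rule map_poly_pCons) simp
  moreover have "coeff ([:y:] * poly q [:y:]) i = y * coeff (poly q [:y:]) i" by simp
  ultimately show ?case using pCons.IH by simp
qed simp

context char2_curve
begin

text \<open>The Kummer polynomial at u1 = v1 = 1; the outer variable is v and the coefficients are
  polynomials in u.\<close>

definition kummer_pp :: "'a \<Rightarrow> 'a \<Rightarrow> 'a poly poly" where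
  "kummer_pp s0 s1 = [:[:s1\<^sup>2, 0, s0\<^sup>2:], [:0, c\<^sup>2 * s0 * s1:], [:s0\<^sup>2, 0, s1\<^sup>2:]:]"

lemma kummer_pp_eval: "poly (poly (kummer_pp s0 s1) [:v:]) u = kummer s0 s1 u 1 v 1"
  unfolding kummer_pp_def kummer_def by (simp add: ring2)

text \<open>A Gauss lemma: the linear factors of a are prime and are removed one at a time. None
  divides the Kummer polynomial, since its middle coefficient vanishes only at u = 0, where the
  constant one is s1^2.\<close>

lemma kummer_pp_dvd_smult:
  assumes s: "s0 \<noteq> 0" "s1 \<noteq> 0" and "a \<noteq> 0" "smult a p = kummer_pp s0 s1 * q"
  shows "kummer_pp s0 s1 dvd p"
  using assms(3,4)
proof (induction "degree a" arbitrary: a q)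
  case 0
  then obtain \<alpha> where a: "a = [:\<alpha>:]" "\<alpha> \<noteq> 0" by (metis degree_eq_zeroE pCons_0_0)
  have "p = smult [:1 / \<alpha>:] (smult a p)" using a by (simp flip: one_pCons)
  also have "\<dots> = kummer_pp s0 s1 * smult [:1 / \<alpha>:] q" unfolding 0(3) by simp
  finally show ?case by (rule dvdI)
next
  case (Suc n)
  obtain x where "poly a x = 0" using alg_closed_imp_poly_has_root[of a] Suc.hyps(2) by auto
  then obtain a' where a': "a = [:- x, 1:] * a'" unfolding poly_eq_0_iff_dvd by (rule dvdE)
  let ?l = "[:[:- x, 1:]:]"
  have "?l dvd kummer_pp s0 s1 * q"
    unfolding Suc.prems(2)[symmetric] a' const_poly_dvd_iff coeff_smult mult.assoc by (intro allI dvd_triv_left)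
  then have "?l dvd kummer_pp s0 s1 \<or> ?l dvd q"
    using lift_prime_elem_poly[OF prime_elem_linear] by (metis prime_elem_dvd_mult_iff)
  moreover have "\<not> ?l dvd kummer_pp s0 s1"
  proof
    assume "?l dvd kummer_pp s0 s1"
    then have "\<forall>m. poly (coeff (kummer_pp s0 s1) m) x = 0"
      unfolding const_poly_dvd_iff poly_eq_0_iff_dvd .
    from spec[OF this, of 0] spec[OF this, of 1] show False
      using s c_nz by (auto simp: kummer_pp_def)
  qed
  ultimately obtain q' where q': "q = ?l * q'" by (auto elim: dvdE)
  have "?l * smult a' p = smult ([:- x, 1:] * a') p" by (simp only: mult_pCons_left smult_smult mult_zero_left pCons_0_0 add_0_right)
  also have "\<dots> = ?l * (kummer_pp s0 s1 * q')"
    using Suc.prems(2) unfolding a' q' by (simp only: mult.left_commute)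
  finally have eq: "smult a' p = kummer_pp s0 s1 * q'" by (subst (asm) mult_left_cancel) simp_all
  have "a' \<noteq> 0" using Suc.prems(1) a' by auto
  moreover have "degree a = 1 + degree a'" unfolding a' using \<open>a' \<noteq> 0\<close> by (subst degree_mult_eq) simp_all
  ultimately show ?case using Suc.hyps(1)[OF _ _ eq] Suc.hyps(2) by simp
qed

text \<open>For almost every \<open>u\<close> the quadratic \<open>f(u, v)\<close> has two distinct roots \<open>v\<close>, so the remainder of
  a pseudo-division by it, linear in \<open>v\<close>, vanishes.\<close>

lemma kummer_pp_dvd:
  assumes s: "s0 \<noteq> 0" "s1 \<noteq> 0"
    and zero: "\<And>u v. kummer s0 s1 u 1 v 1 = 0 \<Longrightarrow> poly (poly p [:v:]) u = 0"
  shows "kummer_pp s0 s1 dvd p"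
proof -
  have nz: "kummer_pp s0 s1 \<noteq> 0" using s by (simp add: kummer_pp_def)
  have deg: "degree (kummer_pp s0 s1) = 2" using s by (simp add: kummer_pp_def)
  define r where "r = pseudo_mod p (kummer_pp s0 s1)"
  obtain a q where a: "a \<noteq> 0" "smult a p = kummer_pp s0 s1 * q + r"
    using pseudo_mod(1)[OF nz, of p] unfolding r_def by blast
  have "r = 0 \<or> degree r < 2" using pseudo_mod(2)[OF nz, of p] deg unfolding r_def by simp
  then have "degree r \<le> 1" by auto
  define r0 r1 where "r0 = coeff r 0" and "r1 = coeff r 1"
  have r: "r = [:r0, r1:]"
  proof (rule poly_eqI)
    fix n show "coeff r n = coeff [:r0, r1:] n"
      using coeff_eq_0[of r n] \<open>degree r \<le> 1\<close> by (auto simp: r0_def r1_def coeff_pCons split: nat.splits)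
  qed
  have r_zero: "poly r0 u + v * poly r1 u = 0" if "kummer s0 s1 u 1 v 1 = 0" for u v
  proof -
    have "poly (poly (smult a p) [:v:]) u = poly (poly (kummer_pp s0 s1 * q + r) [:v:]) u" unfolding a(2) ..
    then have "poly (poly r [:v:]) u = 0" using zero[OF that] that by (simp add: kummer_pp_eval)
    then show ?thesis unfolding r by simp
  qed
  \<comment> \<open>The leading coefficient A vanishes only at u = s0 / s1 and the middle one B only
    at u = 0. For other u the roots v and v + B / A are distinct.\<close>
  have "poly r0 u = 0 \<and> poly r1 u = 0" if "u \<notin> {0, s0 / s1}" for u
  proof -
    define A B C where "A = s0\<^sup>2 + u\<^sup>2 * s1\<^sup>2" and "B = c\<^sup>2 * s0 * s1 * u" and "C = s1\<^sup>2 + u\<^sup>2 * s0\<^sup>2"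
    have k: "kummer s0 s1 u 1 v 1 = A * v\<^sup>2 + B * v + C" for v
      unfolding kummer_def A_def B_def C_def by (simp add: ring2)
    have "A = (s0 + u * s1)\<^sup>2" unfolding A_def square_add by (simp add: power_mult_distrib)
    moreover have "s0 + u * s1 \<noteq> 0" using that s by (auto simp: add_eq_0_iff_eq field_simps)
    ultimately have A: "A \<noteq> 0" by simp
    have B: "B \<noteq> 0" using that s c_nz by (simp add: B_def)
    have "degree [:C, B, A:] > 0" using A by simp
    then obtain v where "poly [:C, B, A:] v = 0" using alg_closed_imp_poly_has_root by blast
    then have v: "A * v\<^sup>2 + B * v + C = 0" by (simp add: algebra_simps power2_eq_square)
    have "A * (v + B / A)\<^sup>2 + B * (v + B / A) + C = (A * v\<^sup>2 + B * v + C) + (B\<^sup>2 / A + B\<^sup>2 / A)"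
      unfolding square_add using A by (simp add: field_simps power2_eq_square)
    then have v': "A * (v + B / A)\<^sup>2 + B * (v + B / A) + C = 0" unfolding v by (simp add: add_self)
    have 1: "poly r0 u + v * poly r1 u = 0" using r_zero k v by metis
    have 2: "poly r0 u + (v + B / A) * poly r1 u = 0" using r_zero k v' by metis
    have "B / A * poly r1 u = (poly r0 u + v * poly r1 u) + (poly r0 u + (v + B / A) * poly r1 u)"
      by (simp add: ring2)
    then have "poly r1 u = 0" unfolding 1 2 using A B by simp
    then show ?thesis using 1 by simp
  qed
  then have "r0 = 0" "r1 = 0"
    by (auto intro!: poly_eq_0_if_cofinitely_zero[of "{0, s0 / s1}"])
  then have "smult a p = kummer_pp s0 s1 * q" using a(2) r by simp
  then show ?thesis by (rule kummer_pp_dvd_smult[OF s a(1)])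
qed

section \<open>Bihomogeneous forms and their dehomogenization\<close>

definition biform :: "nat \<Rightarrow> nat \<Rightarrow> (nat \<Rightarrow> nat \<Rightarrow> 'a) \<Rightarrow> 'a list \<times> 'a list \<Rightarrow> 'a" where
  "biform d e a = (\<lambda>(u, v). \<Sum>i\<le>d. \<Sum>j\<le>e. a i j * (u!0 ^ i * u!1 ^ (d - i)) * (v!0 ^ j * v!1 ^ (e - j)))"

lemma biform_scale:
  assumes "x \<noteq> 0" "y \<noteq> 0"
  shows "biform d e a ([u0, x], [v0, y]) = x ^ d * y ^ e * (\<Sum>i\<le>d. \<Sum>j\<le>e. a i j * (u0 / x) ^ i * (v0 / y) ^ j)"
proof -
  have t: "a i j * (u0 ^ i * x ^ (d - i)) * (v0 ^ j * y ^ (e - j)) = x ^ d * y ^ e * (a i j * (u0 / x) ^ i * (v0 / y) ^ j)"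
    if "i \<le> d" "j \<le> e" for i j
    using that assms by (simp add: power_diff power_divide)
  then have "biform d e a ([u0, x], [v0, y]) = (\<Sum>i\<le>d. \<Sum>j\<le>e. x ^ d * y ^ e * (a i j * (u0 / x) ^ i * (v0 / y) ^ j))"
    unfolding biform_def prod.case
    by (intro sum.cong refl) (simp only: nth_Cons_0 nth_Cons_Suc One_nat_def t atMost_iff)
  then show ?thesis by (simp add: sum_distrib_left)
qed

lemma biform_poly_left: "\<exists>p. \<forall>x. biform d e a ([u0, x], v) = poly p x"
  by (rule exI[of _ "\<Sum>i\<le>d. \<Sum>j\<le>e. monom (a i j * u0 ^ i * (v!0 ^ j * v!1 ^ (e - j))) (d - i)"])
    (simp add: biform_def poly_sum poly_monom mult_ac)

lemma biform_poly_right: "\<exists>p. \<forall>y. biform d e a (u, [v0, y]) = poly p y"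
  by (rule exI[of _ "\<Sum>i\<le>d. \<Sum>j\<le>e. monom (a i j * (u!0 ^ i * u!1 ^ (d - i)) * v0 ^ j) (e - j)"])
    (simp add: biform_def poly_sum poly_monom mult_ac)

lemma poly_eq_if_nonzero_eq:
  assumes "\<And>x. x \<noteq> 0 \<Longrightarrow> poly p x = poly q (x :: 'a)"
  shows "poly p x = poly q x"
proof -
  have "p - q = 0"
    by (rule poly_eq_0_if_cofinitely_zero[of "{0}"]) (use assms in auto)
  then show ?thesis by simp
qed

lemma poly_poly_eq_sum:
  fixes q :: "'a poly poly"
  assumes "\<And>i j. i > d \<or> j > e \<Longrightarrow> coeff (coeff q j) i = 0"
  shows "poly (poly q [:y:]) x = (\<Sum>i\<le>d. \<Sum>j\<le>e. coeff (coeff q j) i * x ^ i * y ^ j)"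
proof -
  have cq: "coeff q j = 0" if "j > e" for j using assms that by (intro poly_eqI) simp
  have "poly q [:y:] = (\<Sum>j\<le>e. coeff q j * [:y:] ^ j)"
    unfolding poly_altdef
  proof (rule sum.mono_neutral_cong)
    show "coeff q j * [:y:] ^ j = 0" if "j \<in> {..e} - {..degree q}" for j using that by (simp add: coeff_eq_0)
    show "coeff q j * [:y:] ^ j = 0" if "j \<in> {..degree q} - {..e}" for j using that by (simp add: cq)
  qed simp_all
  then have "poly (poly q [:y:]) x = (\<Sum>j\<le>e. poly (coeff q j) x * y ^ j)"
    by (simp add: poly_sum)
  also have "\<dots> = (\<Sum>j\<le>e. \<Sum>i\<le>d. coeff (coeff q j) i * x ^ i * y ^ j)"
  proof (rule sum.cong[OF refl])
    fix j
    have "degree (coeff q j) \<le> d" using assms by (intro degree_le) simp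
    then show "poly (coeff q j) x * y ^ j = (\<Sum>i\<le>d. coeff (coeff q j) i * x ^ i * y ^ j)"
      by (simp add: poly_eq_sum_atMost sum_distrib_right)
  qed
  finally show ?thesis by (subst sum.swap)
qed

lemma kummer_generates_ideal:
  assumes s: "s0 \<noteq> 0" "s1 \<noteq> 0"
  shows "generates_ideal (Kummer_poly c s0 s1) (zero_locus (Kummer_poly c s0 s1))"
  unfolding generates_ideal_def
proof (intro allI ballI impI)
  fix d e G
  assume G: "G \<in> biforms UNIV d e"
    and vanish: "\<forall>(p, q)\<in>zero_locus (Kummer_poly c s0 s1). \<forall>u\<in>p. \<forall>v\<in>q. G (u, v) = 0"
  obtain a where a: "G = biform d e a" using G unfolding biforms_def biform_def by blast
  define p where "p = (\<Sum>j\<le>e. monom (\<Sum>i\<le>d. monom (a i j) i) j)"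
  have coeff_p: "coeff (coeff p j) i = (if i \<le> d \<and> j \<le> e then a i j else 0)" for i j
    by (simp add: p_def coeff_sum sum.delta' if_distrib[of "\<lambda>q. coeff q i"] cong: if_cong)
  have eval_p: "poly (poly p [:v:]) u = (\<Sum>i\<le>d. \<Sum>j\<le>e. a i j * u ^ i * v ^ j)" for u v
    by (subst poly_poly_eq_sum[of d e]) (auto simp: coeff_p intro!: sum.cong)
  have Gp: "G ([u0, x], [v0, y]) = x ^ d * y ^ e * poly (poly p [:v0 / y:]) (u0 / x)" if "x \<noteq> 0" "y \<noteq> 0" for u0 v0 x y
    unfolding a eval_p by (rule biform_scale[OF that])
  have "kummer_pp s0 s1 dvd p"
  proof (rule kummer_pp_dvd[OF s])
    fix u v assume "kummer s0 s1 u 1 v 1 = 0"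
    then have "(pt [u, 1], pt [v, 1]) \<in> zero_locus (Kummer_poly c s0 s1)"
      by (subst zero_locus_Kummer_iff) simp_all
    then have "G ([u, 1], [v, 1]) = 0" using vanish pt_self by fast
    then show "poly (poly p [:v:]) u = 0" using Gp[of 1 1 u v] by simp
  qed
  then obtain q where q: "p = kummer_pp s0 s1 * q" by (rule dvdE)
  have kdeg: "degree (kummer_pp s0 s1) = 2" "kummer_pp s0 s1 \<noteq> 0" using s by (simp_all add: kummer_pp_def)
  \<comment> \<open>The quotient q must be homogenized again, so its degree has to be bounded in
    each variable separately.\<close>
  have bound_v: "coeff q j = 0" if "j + 2 > e" for j
  proof (cases "q = 0")
    case False
    have "degree p \<le> e"
    proof (rule degree_le, intro allI impI)
      fix i assume "e < i" then show "coeff p i = 0" by (intro poly_eqI) (simp add: coeff_p)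
    qed
    moreover have "degree p = 2 + degree q" unfolding q using kdeg False by (simp add: degree_mult_eq)
    ultimately show ?thesis using that by (intro coeff_eq_0) simp
  qed simp
  \<comment> \<open>Specializing v to y outside s0 / s1 keeps the degree 2 of the Kummer polynomial
    in u, so the degree of q in u can be read off for almost every y.\<close>
  have bound_u: "coeff (coeff q j) i = 0" if i: "i + 2 > d" for i j
  proof -
    have "map_poly (\<lambda>p. coeff p i) q = 0"
    proof (rule poly_eq_0_if_cofinitely_zero[of "{s0 / s1}"])
      fix y assume y: "y \<notin> {s0 / s1}"
      define K where "K = poly (kummer_pp s0 s1) [:y:]"
      have K: "K = [:s1\<^sup>2 + y\<^sup>2 * s0\<^sup>2, y * (c\<^sup>2 * s0 * s1), s0\<^sup>2 + y\<^sup>2 * s1\<^sup>2:]"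
        unfolding K_def kummer_pp_def by (simp add: power2_eq_square)
      have "s0\<^sup>2 + y\<^sup>2 * s1\<^sup>2 = (s0 + y * s1)\<^sup>2" unfolding square_add by (simp add: power_mult_distrib)
      moreover have "s0 + y * s1 \<noteq> 0" using y s by (auto simp: add_eq_0_iff_eq field_simps)
      ultimately have Kd: "degree K = 2" "K \<noteq> 0" unfolding K by simp_all
      have "coeff (poly q [:y:]) i = 0"
      proof (cases "poly q [:y:] = 0")
        case False
        have "degree (poly p [:y:]) \<le> d"
        proof (rule degree_le, intro allI impI)
          fix m assume m: "d < m"
          have "map_poly (\<lambda>p. coeff p m) p = 0" by (rule poly_eqI) (use m in \<open>simp add: coeff_map_poly coeff_p\<close>)
          then show "coeff (poly p [:y:]) m = 0" unfolding coeff_poly_const by simp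
        qed
        moreover have "poly p [:y:] = K * poly q [:y:]" unfolding q K_def by simp
        ultimately have "2 + degree (poly q [:y:]) \<le> d" using Kd False by (simp add: degree_mult_eq)
        then show ?thesis using i by (intro coeff_eq_0) simp
      qed simp
      then show "poly (map_poly (\<lambda>p. coeff p i) q) y = 0" unfolding coeff_poly_const .
    qed simp
    then have "coeff (map_poly (\<lambda>p. coeff p i) q) j = 0" by simp
    then show ?thesis by (simp add: coeff_map_poly)
  qed
  define b where "b = (\<lambda>i j. coeff (coeff q j) i)"
  have eval_q: "poly (poly q [:v:]) u = (\<Sum>i\<le>d - 2. \<Sum>j\<le>e - 2. b i j * u ^ i * v ^ j)" for u v
    unfolding b_def by (rule poly_poly_eq_sum) (use bound_u bound_v in auto)
  \<comment> \<open>If d < 2 or e < 2, the two bounds force q = 0, so the truncated subtraction is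
    harmless.\<close>
  let ?A = "biform (d - 2) (e - 2) b"
  have main: "G ([u0, x], [v0, y]) = ?A ([u0, x], [v0, y]) * kummer s0 s1 u0 x v0 y" if xy: "x \<noteq> 0" "y \<noteq> 0" for u0 v0 x y
  proof (cases "q = 0")
    case True
    then have "poly (poly p [:v:]) u = 0" for u v unfolding q by simp
    moreover have "b i j = 0" for i j using True by (simp add: b_def)
    ultimately show ?thesis unfolding Gp[OF xy] biform_scale[OF xy] by simp
  next
    case False
    then obtain j where "coeff q j \<noteq> 0" by (metis leading_coeff_0_iff)
    moreover then obtain i where "coeff (coeff q j) i \<noteq> 0" by (metis leading_coeff_0_iff)
    ultimately have "i + 2 \<le> d" "j + 2 \<le> e" using bound_u bound_v by (metis not_le)+
    then have de: "d = d - 2 + 2" "e = e - 2 + 2" by simp_all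
    have K: "kummer s0 s1 u0 x v0 y = x\<^sup>2 * y\<^sup>2 * kummer s0 s1 (u0 / x) 1 (v0 / y) 1"
      using kummer_scale[of 1 s0 s1 x "u0 / x" 1 y "v0 / y" 1] xy by simp
    have "G ([u0, x], [v0, y]) = x ^ d * y ^ e * (kummer s0 s1 (u0 / x) 1 (v0 / y) 1 * poly (poly q [:v0 / y:]) (u0 / x))"
      unfolding Gp[OF xy] q by (simp add: kummer_pp_eval)
    also have "x ^ d * y ^ e = x ^ (d - 2) * y ^ (e - 2) * (x\<^sup>2 * y\<^sup>2)"
      using de by (metis (no_types, opaque_lifting) mult.assoc mult.left_commute power_add)
    finally show ?thesis unfolding biform_scale[OF xy] eval_q K by (simp only: mult_ac)
  qed
  \<comment> \<open>The identity is known for nonzero second coordinates. Both sides are polynomial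
    in each of these, so it extends to zero in one of them after the other.\<close>
  have "G (u, v) = ?A (u, v) * Kummer_poly c s0 s1 (u, v)" if len: "length u = 2" "length v = 2" for u v
  proof -
    obtain u0 x where u: "u = [u0, x]" using len(1) by (auto simp: length_Suc_conv numeral_eq_Suc)
    obtain v0 y where v: "v = [v0, y]" using len(2) by (auto simp: length_Suc_conv numeral_eq_Suc)
    have 1: "G ([u0, x], [v0, y]) = ?A ([u0, x], [v0, y]) * kummer s0 s1 u0 x v0 y" if y: "y \<noteq> 0" for x y
    proof -
      obtain g where g: "\<And>x. G ([u0, x], [v0, y]) = poly g x" using biform_poly_left unfolding a by metis
      obtain h where h: "\<And>x. ?A ([u0, x], [v0, y]) = poly h x" using biform_poly_left by metis
      let ?k = "[:s0\<^sup>2 * (u0 * y)\<^sup>2 + s1\<^sup>2 * (u0 * v0)\<^sup>2, c\<^sup>2 * s0 * s1 * u0 * v0 * y, s0\<^sup>2 * v0\<^sup>2 + s1\<^sup>2 * y\<^sup>2:]"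
      have k: "kummer s0 s1 u0 x v0 y = poly ?k x" for x
        unfolding kummer_def by (simp add: ring2)
      have "poly g x = poly (h * ?k) x"
        by (rule poly_eq_if_nonzero_eq) (simp only: poly_mult g[symmetric] h[symmetric] k[symmetric] main y not_False_eq_True)
      then show ?thesis by (simp only: poly_mult g h k)
    qed
    obtain g where g: "\<And>y. G ([u0, x], [v0, y]) = poly g y" using biform_poly_right unfolding a by metis
    obtain h where h: "\<And>y. ?A ([u0, x], [v0, y]) = poly h y" using biform_poly_right by metis
    let ?k = "[:s0\<^sup>2 * (x * v0)\<^sup>2 + s1\<^sup>2 * (u0 * v0)\<^sup>2, c\<^sup>2 * s0 * s1 * u0 * x * v0, s0\<^sup>2 * u0\<^sup>2 + s1\<^sup>2 * x\<^sup>2:]"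
    have k: "kummer s0 s1 u0 x v0 y = poly ?k y" for y
      unfolding kummer_def by (simp add: ring2)
    have "poly g y = poly (h * ?k) y"
      by (rule poly_eq_if_nonzero_eq) (simp only: poly_mult g[symmetric] h[symmetric] k[symmetric] 1 not_False_eq_True)
    then have "G ([u0, x], [v0, y]) = ?A ([u0, x], [v0, y]) * kummer s0 s1 u0 x v0 y"
      by (simp only: poly_mult g h k)
    then show ?thesis unfolding u v Kummer_poly_eq by simp
  qed
  moreover have "?A \<in> biforms UNIV (d - 2) (e - 2)"
    unfolding biforms_def biform_def by blast
  ultimately show "\<exists>d' e'. \<exists>A\<in>biforms UNIV d' e'. \<forall>u v. length u = 2 \<and> length v = 2 \<longrightarrow>
      G (u, v) = A (u, v) * Kummer_poly c s0 s1 (u, v)" by blast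
qed

end

section \<open>The isomorphism\<close>

context char2_curve
begin

lemma lies_over_unique:
  assumes "R \<in> EC_cone c" "lies_over R f0 f1" "lies_over R v0 v1"
  shows "f0 * v1 = f1 * v0"
proof -
  obtain a0 a1 b0 b1 where p: "R = [a0 * b0, a1 * b0, a1 * b1, a0 * b1]"
    "a0 \<noteq> 0 \<or> a1 \<noteq> 0" "b0 \<noteq> 0 \<or> b1 \<noteq> 0"
    using assms(1) by (rule cone_param)
  have f: "f1 * a0 = f0 * a1" and v: "v1 * a0 = v0 * a1"
    using assms(2,3) unfolding p(1) over_param[OF p(3)] .
  have "a0 * (f0 * v1) = f0 * (v1 * a0)" by (simp only: mult_ac)
  also have "\<dots> = (f0 * a1) * v0" unfolding v by (simp only: mult_ac)
  finally have 0: "a0 * (f0 * v1) = a0 * (f1 * v0)" unfolding f[symmetric] by (simp only: mult_ac)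
  have "a1 * (f0 * v1) = (f0 * a1) * v1" by (simp only: mult_ac)
  also have "\<dots> = f1 * (v1 * a0)" unfolding f[symmetric] by (simp only: mult_ac)
  finally have "a1 * (f0 * v1) = a1 * (f1 * v0)" unfolding v by (simp only: mult_ac)
  then show ?thesis using 0 p(2) by auto
qed

lemma kappa_coords:
  assumes q: "q \<in> EC_cone c" and t: "t \<in> EC_cone c"
    and u: "u \<in> fst (kappa c (pt t) (pt q))" and v: "v \<in> snd (kappa c (pt t) (pt q))"
  shows "lies_over q (u!0) (u!1)" "u!0 \<noteq> 0 \<or> u!1 \<noteq> 0" "v!0 \<noteq> 0 \<or> v!1 \<noteq> 0"
    "(t!0 * q!0 + t!2 * q!2) * v!1 = (t!3 * q!1 + t!1 * q!3) * v!0"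
    "(t!1 * q!1 + t!3 * q!3) * v!1 = (t!2 * q!0 + t!0 * q!2) * v!0"
proof -
  obtain R where R: "R \<in> EC_cone c" "kappa c (pt t) (pt q) = (proj1 (pt q), proj1 (pt R))"
    "lies_over R (t!0 * q!0 + t!2 * q!2) (t!3 * q!1 + t!1 * q!3)"
    "lies_over R (t!1 * q!1 + t!3 * q!3) (t!2 * q!0 + t!0 * q!2)"
    using kappa_lies_over[OF q t] by metis
  have coords: "lies_over r (x!0) (x!1) \<and> (x!0 \<noteq> 0 \<or> x!1 \<noteq> 0)"
    if r: "r \<in> EC_cone c" and x: "x \<in> proj1 (pt r)" for r x
  proof -
    obtain w0 w1 where w: "w0 \<noteq> 0 \<or> w1 \<noteq> 0" "lies_over r w0 w1" using over_ex[OF r] .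
    obtain s where s: "s \<noteq> 0" "x = map ((*) s) [w0, w1]"
      using x unfolding proj1_eq[OF r w(2,1)] by (rule ptE)
    then show ?thesis using lies_over_proportional[OF w(2), of "x!0" s "x!1"] w(1) by simp
  qed
  show "lies_over q (u!0) (u!1)" "u!0 \<noteq> 0 \<or> u!1 \<noteq> 0"
    using coords[OF q, of u] u R(2) by simp_all
  have v': "lies_over R (v!0) (v!1)" "v!0 \<noteq> 0 \<or> v!1 \<noteq> 0"
    using coords[OF R(1), of v] v R(2) by simp_all
  then show "v!0 \<noteq> 0 \<or> v!1 \<noteq> 0" by simp
  show "(t!0 * q!0 + t!2 * q!2) * v!1 = (t!3 * q!1 + t!1 * q!3) * v!0"
    "(t!1 * q!1 + t!3 * q!3) * v!1 = (t!2 * q!0 + t!0 * q!2) * v!0"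
    using lies_over_unique[OF R(1) R(3) v'(1)] lies_over_unique[OF R(1) R(4) v'(1)] by simp_all
qed

text \<open>The incidence of v with a tuple for x(Q - P) is linear also in y(Q) = (b0:b1); read as
  an equation for this ratio it gives the entries of the inverse tuple.\<close>

lemma inverse_tuples:
  assumes q: "q \<in> EC_cone c" and o: "lies_over q u0 u1" and u: "u0 \<noteq> 0 \<or> u1 \<noteq> 0"
    and f: "(t0 * q!0 + t2 * q!2) * v1 = (t3 * q!1 + t1 * q!3) * v0"
    and g: "(t1 * q!1 + t3 * q!3) * v1 = (t2 * q!0 + t0 * q!2) * v0"
  shows "lies_over2 q (t1 * u0 * v0 + t2 * u1 * v1) (t0 * u0 * v1 + t3 * u1 * v0)"
    "lies_over2 q (t3 * u0 * v1 + t0 * u1 * v0) (t2 * u0 * v0 + t1 * u1 * v1)"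
proof -
  obtain a0 a1 b0 b1 where p: "q = [a0 * b0, a1 * b0, a1 * b1, a0 * b1]"
    "a0 \<noteq> 0 \<or> a1 \<noteq> 0" "b0 \<noteq> 0 \<or> b1 \<noteq> 0"
    using q by (rule cone_param)
  have "u1 * a0 = u0 * a1" using o unfolding p(1) over_param[OF p(3)] .
  then have "a0 * u1 = a1 * u0" by (simp only: mult.commute)
  then obtain m where m: "u0 = m * a0" "u1 = m * a1" using proportional[OF p(2) u] by metis
  have over2: "lies_over2 q w0 w1" if "b0 * w1 + b1 * w0 = 0" for w0 w1
  proof -
    have "b0 * w1 = b1 * w0" using that by (simp only: add_eq_0_iff_eq)
    then have "w1 * (a0 * b0) = w0 * (a0 * b1)" "w1 * (a1 * b0) = w0 * (a1 * b1)"
      by (metis mult.assoc mult.commute)+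
    then show ?thesis by (simp add: lies_over2_def p(1))
  qed
  have "b0 * (t0 * u0 * v1 + t3 * u1 * v0) + b1 * (t1 * u0 * v0 + t2 * u1 * v1) =
      m * ((t0 * q!0 + t2 * q!2) * v1 + (t3 * q!1 + t1 * q!3) * v0)"
    unfolding m p(1) by (simp add: algebra_simps)
  then show "lies_over2 q (t1 * u0 * v0 + t2 * u1 * v1) (t0 * u0 * v1 + t3 * u1 * v0)"
    unfolding f by (intro over2) (simp add: add_self)
  have "b0 * (t2 * u0 * v0 + t1 * u1 * v1) + b1 * (t3 * u0 * v1 + t0 * u1 * v0) =
      m * ((t1 * q!1 + t3 * q!3) * v1 + (t2 * q!0 + t0 * q!2) * v0)"
    unfolding m p(1) by (simp add: algebra_simps)
  then show "lies_over2 q (t3 * u0 * v1 + t0 * u1 * v0) (t2 * u0 * v0 + t1 * u1 * v1)"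
    unfolding g by (intro over2) (simp add: add_self)
qed

lemmas neg_special = EC_O_neg T_neg

text \<open>The entries are two linear systems in the products u_i v_j, with determinants (p + r)^2
  up to powers of x. They are invertible because p and r differ for P not 2-torsion, so common zeros
  would make all four products vanish.\<close>

lemma inverse_tuples_cover:
  assumes t: "[t0, t1, t2, t3] \<in> EC_cone c" and ne: "neg_pt (pt [t0, t1, t2, t3]) \<noteq> pt [t0, t1, t2, t3]"
    and u: "u0 \<noteq> 0 \<or> u1 \<noteq> 0" and v: "v0 \<noteq> 0 \<or> v1 \<noteq> 0"
  shows "(t1 * u0 * v0 + t2 * u1 * v1 \<noteq> 0 \<or> t0 * u0 * v1 + t3 * u1 * v0 \<noteq> 0) \<or>
    (t3 * u0 * v1 + t0 * u1 * v0 \<noteq> 0 \<or> t2 * u0 * v0 + t1 * u1 * v1 \<noteq> 0)"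
proof (rule ccontr)
  assume "\<not> ?thesis"
  then have z: "t1 * u0 * v0 + t2 * u1 * v1 = 0" "t0 * u0 * v1 + t3 * u1 * v0 = 0"
    "t3 * u0 * v1 + t0 * u1 * v0 = 0" "t2 * u0 * v0 + t1 * u1 * v1 = 0" by simp_all
  have "pt [t0, t1, t2, t3] \<noteq> EC_O" "pt [t0, t1, t2, t3] \<noteq> pt_T" using ne neg_special by metis+
  then obtain x p r where p: "[t0, t1, t2, t3] = [p, x * p, x * r, r]" "x \<noteq> 0" "p \<noteq> r"
    using nonspecial_param[OF t] by metis
  then have tt: "t0 = p" "t1 = x * p" "t2 = x * r" "t3 = r" by simp_all
  have pr: "(p + r)\<^sup>2 \<noteq> 0" using p(3) by (simp add: add_eq_0_iff_eq)
  have "x * ((p + r)\<^sup>2 * (u0 * v0)) = p * (t1 * u0 * v0 + t2 * u1 * v1) + r * (t2 * u0 * v0 + t1 * u1 * v1)"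
    "x * ((p + r)\<^sup>2 * (u1 * v1)) = r * (t1 * u0 * v0 + t2 * u1 * v1) + p * (t2 * u0 * v0 + t1 * u1 * v1)"
    "(p + r)\<^sup>2 * (u0 * v1) = p * (t0 * u0 * v1 + t3 * u1 * v0) + r * (t3 * u0 * v1 + t0 * u1 * v0)"
    "(p + r)\<^sup>2 * (u1 * v0) = r * (t0 * u0 * v1 + t3 * u1 * v0) + p * (t3 * u0 * v1 + t0 * u1 * v0)"
    unfolding tt square_add by (simp_all add: ring2)
  then have "u0 * v0 = 0" "u1 * v1 = 0" "u0 * v1 = 0" "u1 * v0 = 0"
    unfolding z using p(2) pr by simp_all
  then show False using u v by auto
qed

end

lemma tuplesI: "(\<And>x. h x = map (\<lambda>f. f x) fs) \<Longrightarrow> length fs = m \<Longrightarrow> set fs \<subseteq> F \<Longrightarrow> h \<in> tuples F m"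
  unfolding tuples_def by (auto intro!: exI[of _ fs] simp: fun_eq_iff)

text \<open>Bidegree (2, 1) arises when an entry of an inverse tuple, of bidegree (1, 1), is
  multiplied by u0 or u1 in the skew-Segre embedding.\<close>

lemma (in subring_set) biforms_2_1I:
  assumes "A \<in> k" "B \<in> k" "C \<in> k" "D \<in> k" "E \<in> k" "F \<in> k"
    and "\<And>u v. f (u, v) = A * (u!0)\<^sup>2 * v!0 + B * u!0 * u!1 * v!0 + C * (u!1)\<^sup>2 * v!0
      + D * (u!0)\<^sup>2 * v!1 + E * u!0 * u!1 * v!1 + F * (u!1)\<^sup>2 * v!1"
  shows "f \<in> biforms k 2 1"
proof -
  define a where "a i j = (if i = 2 \<and> j = 1 then A else if i = 1 \<and> j = 1 then B else if i = 0 \<and> j = 1 then C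
    else if i = 2 \<and> j = 0 then D else if i = 1 \<and> j = 0 then E else if i = 0 \<and> j = 0 then F else 0)" for i j :: nat
  have "f = (\<lambda>(u, v). \<Sum>i\<le>2. \<Sum>j\<le>1. a i j * (u!0 ^ i * u!1 ^ (2 - i)) * (v!0 ^ j * v!1 ^ (1 - j)))"
    by (rule ext) (auto simp: assms(7) a_def numeral_2_eq_2 algebra_simps)
  moreover have "a i j \<in> k" for i j using assms(1-6) zero_mem by (simp add: a_def)
  ultimately show ?thesis unfolding biforms_def by blast
qed

theorem theorem23:
  fixes c t0 t1 t2 t3 :: "'k::field alg_closure"
    and k :: "'k alg_closure set"
    and P :: "'k alg_closure list set"
  assumes k_def: "k = range to_ac"
    and char: "CHAR('k) = 2"
    and c: "c \<in> k" "c \<noteq> 0"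
    and t: "{t0, t1, t2, t3} \<subseteq> k"
    and P_def: "P = pt [t0, t1, t2, t3]"
    and P: "P \<in> EC c"
  shows
    "(\<forall>(s0, s1) \<in> {(t0, t1), (t3, t2)}. (s0, s1) \<noteq> (0, 0) \<longrightarrow>
        Kummer_Delta c P = zero_locus (Kummer_poly c s0 s1)
        \<and> (P \<otimes>\<^bsub>EC_group c\<^esub> P \<noteq> \<one>\<^bsub>EC_group c\<^esub> \<longrightarrow>
              generates_ideal (Kummer_poly c s0 s1) (Kummer_Delta c P)))
     \<and> (P \<otimes>\<^bsub>EC_group c\<^esub> P \<noteq> \<one>\<^bsub>EC_group c\<^esub> \<longrightarrow>
        isomorphism k (EC c) (Kummer_Delta c P) (kappa c P)
        \<and> given_by coords1 {\<lambda>x. [x!0, x!1], \<lambda>x. [x!3, x!2]} (EC c) (fst \<circ> kappa c P)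
        \<and> given_by coords1
            {\<lambda>x. [t0 * x!0 + t2 * x!2, t3 * x!1 + t1 * x!3],
             \<lambda>x. [t1 * x!1 + t3 * x!3, t2 * x!0 + t0 * x!2]}
            (EC c) (snd \<circ> kappa c P)
        \<and> given_by coords2 {\<lambda>(u, v). [u!0, u!1]}
            (Kummer_Delta c P) (proj1 \<circ> the_inv_into (EC c) (kappa c P))
        \<and> given_by coords2
            {\<lambda>(u, v). [t1 * u!0 * v!0 + t2 * u!1 * v!1, t0 * u!0 * v!1 + t3 * u!1 * v!0],
             \<lambda>(u, v). [t3 * u!0 * v!1 + t0 * u!1 * v!0, t2 * u!0 * v!0 + t1 * u!1 * v!1]}
            (Kummer_Delta c P) (proj2 \<circ> the_inv_into (EC c) (kappa c P))
        \<and> (\<forall>z \<in> Kummer_Delta c P.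
             the_inv_into (EC c) (kappa c P) z =
               skew_segre (proj1 (the_inv_into (EC c) (kappa c P) z))
                          (proj2 (the_inv_into (EC c) (kappa c P) z))))"
proof -
  have "of_nat CHAR('k alg_closure) = (0 :: 'k alg_closure)" by (rule of_nat_CHAR)
  then have two: "(1 :: 'k alg_closure) + 1 = 0" using char by simp
  interpret char2_curve c by unfold_locales (fact c(2), fact two)
  interpret K: subring_set k
  proof
    show "0 \<in> k" "1 \<in> k"
      using rangeI[of to_ac "0 :: 'k"] rangeI[of to_ac "1 :: 'k"] by (simp_all add: k_def)
    fix a b assume "a \<in> k" "b \<in> k"
    then obtain x y :: 'k where "a = to_ac x" "b = to_ac y" unfolding k_def by blast
    then show "a + b \<in> k" "a * b \<in> k"
      using rangeI[of to_ac "x + y"] rangeI[of to_ac "x * y"] by (simp_all add: k_def)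
  qed
  let ?t = "[t0, t1, t2, t3]"
  have tc: "?t \<in> EC_cone c" using EC_memD(1)[OF P] pt_self P_def by blast
  have tk: "t0 \<in> k" "t1 \<in> k" "t2 \<in> k" "t3 \<in> k" using t by simp_all
  have t_prod: "t0 * t2 = t1 * t3" using coneD(4)[OF tc] by simp
  have two_tors: "P \<otimes>\<^bsub>EC_group c\<^esub> P = \<one>\<^bsub>EC_group c\<^esub> \<longleftrightarrow> neg_pt P = P"
    unfolding EC_group_simps by (rule two_torsion_iff[OF P])
  have image: "Kummer_Delta c P = kappa c P ` EC c" by (rule Kummer_Delta_eq_image[OF P])
  have part1: "Kummer_Delta c P = zero_locus (Kummer_poly c s0 s1)
        \<and> (P \<otimes>\<^bsub>EC_group c\<^esub> P \<noteq> \<one>\<^bsub>EC_group c\<^esub> \<longrightarrow> generates_ideal (Kummer_poly c s0 s1) (Kummer_Delta c P))"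
    if s: "(s0, s1) \<in> {(t0, t1), (t3, t2)}" "(s0, s1) \<noteq> (0, 0)" for s0 s1
  proof -
    \<comment> \<open>Both pairs represent x(P), by t0 t2 = t1 t3.\<close>
    have over_t: "lies_over ?t s0 s1" and s_nz: "s0 \<noteq> 0 \<or> s1 \<noteq> 0"
      using s t_prod by (auto simp: lies_over_def mult.commute)
    have eq: "Kummer_Delta c P = zero_locus (Kummer_poly c s0 s1)"
      unfolding P_def by (rule Kummer_Delta_eq_zero_locus[OF tc s_nz over_t])
    moreover have "generates_ideal (Kummer_poly c s0 s1) (Kummer_Delta c P)" if "neg_pt P \<noteq> P"
    proof -
      have "pt ?t \<noteq> EC_O" "pt ?t \<noteq> pt_T" using that neg_special unfolding P_def by metis+
      then obtain x p r where p: "?t = [p, x * p, x * r, r]" "x \<noteq> 0"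
        using nonspecial_param[OF tc] by metis
      \<comment> \<open>As P is neither O nor T, x(P) is neither 0 nor infinity, so both s0 and s1
        are nonzero.\<close>
      then have "s1 = x * s0" using s(1) by auto
      then have "s0 \<noteq> 0" "s1 \<noteq> 0" using s_nz p(2) by auto
      then show ?thesis unfolding eq by (rule kummer_generates_ideal)
    qed
    ultimately show ?thesis unfolding two_tors by blast
  qed
  have part2: "isomorphism k (EC c) (Kummer_Delta c P) (kappa c P)
        \<and> given_by coords1 {\<lambda>x. [x!0, x!1], \<lambda>x. [x!3, x!2]} (EC c) (fst \<circ> kappa c P)
        \<and> given_by coords1
            {\<lambda>x. [t0 * x!0 + t2 * x!2, t3 * x!1 + t1 * x!3],
             \<lambda>x. [t1 * x!1 + t3 * x!3, t2 * x!0 + t0 * x!2]}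
            (EC c) (snd \<circ> kappa c P)
        \<and> given_by coords2 {\<lambda>(u, v). [u!0, u!1]}
            (Kummer_Delta c P) (proj1 \<circ> the_inv_into (EC c) (kappa c P))
        \<and> given_by coords2
            {\<lambda>(u, v). [t1 * u!0 * v!0 + t2 * u!1 * v!1, t0 * u!0 * v!1 + t3 * u!1 * v!0],
             \<lambda>(u, v). [t3 * u!0 * v!1 + t0 * u!1 * v!0, t2 * u!0 * v!0 + t1 * u!1 * v!1]}
            (Kummer_Delta c P) (proj2 \<circ> the_inv_into (EC c) (kappa c P))
        \<and> (\<forall>z \<in> Kummer_Delta c P.
             the_inv_into (EC c) (kappa c P) z =
               skew_segre (proj1 (the_inv_into (EC c) (kappa c P) z))
                          (proj2 (the_inv_into (EC c) (kappa c P) z)))"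
    if ne: "neg_pt P \<noteq> P"
  proof -
    define W0 W1 V0 V1 where
      "W0 = (\<lambda>u v. t1 * u!0 * v!0 + t2 * u!1 * v!1)" and "W1 = (\<lambda>u v. t0 * u!0 * v!1 + t3 * u!1 * v!0)" and
      "V0 = (\<lambda>u v. t3 * u!0 * v!1 + t0 * u!1 * v!0)" and "V1 = (\<lambda>u v. t2 * u!0 * v!0 + t1 * u!1 * v!1)"
    have inv_coords: "proj1 (pt q) = pt [u!0, u!1]" "u!0 \<noteq> 0 \<or> u!1 \<noteq> 0"
      "W0 u v \<noteq> 0 \<or> W1 u v \<noteq> 0 \<Longrightarrow> proj2 (pt q) = pt [W0 u v, W1 u v]"
      "V0 u v \<noteq> 0 \<or> V1 u v \<noteq> 0 \<Longrightarrow> proj2 (pt q) = pt [V0 u v, V1 u v]"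
      "(W0 u v \<noteq> 0 \<or> W1 u v \<noteq> 0) \<or> (V0 u v \<noteq> 0 \<or> V1 u v \<noteq> 0)"
      if q: "q \<in> EC_cone c" and uv: "u \<in> fst (kappa c P (pt q))" "v \<in> snd (kappa c P (pt q))" for q u v
    proof -
      note k = kappa_coords[OF q tc uv[unfolded P_def]]
      have k4: "(t0 * q!0 + t2 * q!2) * v!1 = (t3 * q!1 + t1 * q!3) * v!0"
        "(t1 * q!1 + t3 * q!3) * v!1 = (t2 * q!0 + t0 * q!2) * v!0" using k(4,5) by simp_all
      note i = inverse_tuples[OF q k(1,2) k4]
      show "proj1 (pt q) = pt [u!0, u!1]" by (rule proj1_eq[OF q k(1,2)])
      show "u!0 \<noteq> 0 \<or> u!1 \<noteq> 0" by (rule k(2))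
      show "W0 u v \<noteq> 0 \<or> W1 u v \<noteq> 0 \<Longrightarrow> proj2 (pt q) = pt [W0 u v, W1 u v]"
        unfolding W0_def W1_def by (rule proj2_eq[OF q i(1)])
      show "V0 u v \<noteq> 0 \<or> V1 u v \<noteq> 0 \<Longrightarrow> proj2 (pt q) = pt [V0 u v, V1 u v]"
        unfolding V0_def V1_def by (rule proj2_eq[OF q i(2)])
      show "(W0 u v \<noteq> 0 \<or> W1 u v \<noteq> 0) \<or> (V0 u v \<noteq> 0 \<or> V1 u v \<noteq> 0)"
        unfolding W0_def W1_def V0_def V1_def
        by (rule inverse_tuples_cover[OF tc ne[unfolded P_def] k(2,3)])
    qed
    have coords_ex: "\<exists>u v. u \<in> fst (kappa c P Q) \<and> v \<in> snd (kappa c P Q)" if Q: "Q \<in> EC c" for Q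
    proof -
      obtain q where q: "q \<in> EC_cone c" "Q = pt q" using Q by (rule EC_E)
      obtain R where R: "R \<in> EC_cone c" "kappa c P Q = (proj1 (pt q), proj1 (pt R))"
        using kappa_lies_over[OF q(1) tc] unfolding P_def q(2) by metis
      have "\<exists>x. x \<in> proj1 (pt r)" if "r \<in> EC_cone c" for r
        using over_ex[OF that] proj1_eq[OF that] pt_self by metis
      then show ?thesis using q(1) R by simp
    qed
    \<comment> \<open>Both x(Q) and y(Q) are computed from the coordinates of kappa(Q) alone, and
      they determine Q.\<close>
    have inj: "inj_on (kappa c P) (EC c)"
    proof (rule inj_onI)
      fix Q Q' assume Q: "Q \<in> EC c" "Q' \<in> EC c" and eq: "kappa c P Q = kappa c P Q'"
      obtain q where q: "q \<in> EC_cone c" "Q = pt q" using Q(1) by (rule EC_E)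
      obtain q' where q': "q' \<in> EC_cone c" "Q' = pt q'" using Q(2) by (rule EC_E)
      obtain u v where uv: "u \<in> fst (kappa c P Q)" "v \<in> snd (kappa c P Q)" using coords_ex[OF Q(1)] by blast
      note i = inv_coords[OF q(1), folded q(2), OF uv] and i' = inv_coords[OF q'(1), folded q'(2), OF uv[unfolded eq]]
      have pr: "proj1 Q = proj1 Q'" "proj2 Q = proj2 Q'" using i(1,3-5) i'(1,3,4) by metis+
      have "Q = skew_segre (proj1 Q) (proj2 Q)" by (rule skew_segre_proj[OF Q(1), symmetric])
      also have "\<dots> = Q'" unfolding pr by (rule skew_segre_proj[OF Q(2)])
      finally show "Q = Q'" .
    qed
    have bij: "bij_betw (kappa c P) (EC c) (Kummer_Delta c P)"
      unfolding bij_betw_def using inj image by simp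
    have inv: "\<exists>q. q \<in> EC_cone c \<and> the_inv_into (EC c) (kappa c P) Z = pt q \<and> Z = kappa c P (pt q)"
      if Z: "Z \<in> Kummer_Delta c P" for Z
    proof -
      obtain Q where Q: "Q \<in> EC c" "Z = kappa c P Q" using Z unfolding image by blast
      obtain q where q: "q \<in> EC_cone c" "Q = pt q" using Q(1) by (rule EC_E)
      have "the_inv_into (EC c) (kappa c P) Z = Q" using the_inv_into_f_f[OF inj Q(1)] Q(2) by simp
      then show ?thesis using Q(2) q by (intro exI[of _ q]) simp
    qed
    have g1: "given_by coords1 {\<lambda>x. [x!0, x!1], \<lambda>x. [x!3, x!2]} (EC c) (fst \<circ> kappa c P)"
      unfolding given_by_def coords1_def
    proof (intro ballI)
      fix Z x assume Z: "Z \<in> EC c" and x: "x \<in> Z"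
      note m = EC_memD[OF Z x]
      have "nonzero [x!0, x!1] \<or> nonzero [x!3, x!2]"
        unfolding nonzero_pair using cone_nonzero_coord[OF m(1)] by blast
      moreover have "proj1 Z = pt [x!0, x!1]" if "nonzero [x!0, x!1]"
        using that coneD(4)[OF m(1)] unfolding m(2) nonzero_pair
        by (intro proj1_eq[OF m(1)]) (simp_all add: lies_over_def mult.commute)
      moreover have "proj1 Z = pt [x!3, x!2]" if "nonzero [x!3, x!2]"
        using that coneD(4)[OF m(1)] unfolding m(2) nonzero_pair
        by (intro proj1_eq[OF m(1)]) (simp_all add: lies_over_def mult.commute)
      ultimately show "(\<exists>h\<in>{\<lambda>x. [x!0, x!1], \<lambda>x. [x!3, x!2]}. nonzero (h x)) \<and>
          (\<forall>h\<in>{\<lambda>x. [x!0, x!1], \<lambda>x. [x!3, x!2]}. nonzero (h x) \<longrightarrow> (fst \<circ> kappa c P) Z = pt (h x))"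
        by (auto simp: kappa_def)
    qed
    let ?F = "\<lambda>x. [t0 * x!0 + t2 * x!2, t3 * x!1 + t1 * x!3]" and ?G = "\<lambda>x. [t1 * x!1 + t3 * x!3, t2 * x!0 + t0 * x!2]"
    have g2: "given_by coords1 {?F, ?G} (EC c) (snd \<circ> kappa c P)"
      unfolding given_by_def coords1_def
    proof (intro ballI)
      fix Z x assume Z: "Z \<in> EC c" and x: "x \<in> Z"
      note m = EC_memD[OF Z x]
      obtain R where R: "R \<in> EC_cone c" "kappa c P Z = (proj1 (pt x), proj1 (pt R))"
        "lies_over R (?t!0 * x!0 + ?t!2 * x!2) (?t!3 * x!1 + ?t!1 * x!3)"
        "lies_over R (?t!1 * x!1 + ?t!3 * x!3) (?t!2 * x!0 + ?t!0 * x!2)"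
        using kappa_lies_over[OF m(1) tc] unfolding P_def m(2) by metis
      then have R': "lies_over R (t0 * x!0 + t2 * x!2) (t3 * x!1 + t1 * x!3)"
        "lies_over R (t1 * x!1 + t3 * x!3) (t2 * x!0 + t0 * x!2)" by simp_all
      have "nonzero (?F x) \<or> nonzero (?G x)"
        unfolding nonzero_pair using difference_tuples_cover[OF m(1) tc] by simp
      moreover have "snd (kappa c P Z) = pt (?F x)" if "nonzero (?F x)"
        using that unfolding R(2) nonzero_pair by (simp add: proj1_eq[OF R(1) R'(1)])
      moreover have "snd (kappa c P Z) = pt (?G x)" if "nonzero (?G x)"
        using that unfolding R(2) nonzero_pair by (simp add: proj1_eq[OF R(1) R'(2)])
      ultimately show "(\<exists>h\<in>{?F, ?G}. nonzero (h x)) \<and>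
          (\<forall>h\<in>{?F, ?G}. nonzero (h x) \<longrightarrow> (snd \<circ> kappa c P) Z = pt (h x))"
        by auto
    qed
    have g3: "given_by coords2 {\<lambda>(u, v). [u!0, u!1]} (Kummer_Delta c P) (proj1 \<circ> the_inv_into (EC c) (kappa c P))"
      unfolding given_by_def
    proof (intro ballI)
      fix Z x assume Z: "Z \<in> Kummer_Delta c P" and x: "x \<in> coords2 Z"
      obtain q where q: "q \<in> EC_cone c" "the_inv_into (EC c) (kappa c P) Z = pt q" "Z = kappa c P (pt q)"
        using inv[OF Z] by blast
      obtain u v where uv: "x = (u, v)" by (cases x)
      have "u \<in> fst (kappa c P (pt q))" "v \<in> snd (kappa c P (pt q))"
        using x unfolding uv q(3) coords2_def by (auto simp: case_prod_unfold)
      note i = inv_coords[OF q(1) this]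
      show "(\<exists>h\<in>{\<lambda>(u, v). [u!0, u!1]}. nonzero (h x)) \<and>
          (\<forall>h\<in>{\<lambda>(u, v). [u!0, u!1]}. nonzero (h x) \<longrightarrow> (proj1 \<circ> the_inv_into (EC c) (kappa c P)) Z = pt (h x))"
        using i(1,2) by (simp add: uv q(2) nonzero_pair)
    qed
    let ?W = "\<lambda>(u, v). [W0 u v, W1 u v]" and ?V = "\<lambda>(u, v). [V0 u v, V1 u v]"
    have g4: "given_by coords2 {?W, ?V} (Kummer_Delta c P) (proj2 \<circ> the_inv_into (EC c) (kappa c P))"
      unfolding given_by_def
    proof (intro ballI)
      fix Z x assume Z: "Z \<in> Kummer_Delta c P" and x: "x \<in> coords2 Z"
      obtain q where q: "q \<in> EC_cone c" "the_inv_into (EC c) (kappa c P) Z = pt q" "Z = kappa c P (pt q)"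
        using inv[OF Z] by blast
      obtain u v where uv: "x = (u, v)" by (cases x)
      have "u \<in> fst (kappa c P (pt q))" "v \<in> snd (kappa c P (pt q))"
        using x unfolding uv q(3) coords2_def by (auto simp: case_prod_unfold)
      note i = inv_coords[OF q(1) this]
      show "(\<exists>h\<in>{?W, ?V}. nonzero (h x)) \<and>
          (\<forall>h\<in>{?W, ?V}. nonzero (h x) \<longrightarrow> (proj2 \<circ> the_inv_into (EC c) (kappa c P)) Z = pt (h x))"
        using i(3-5) by (simp add: uv q(2) nonzero_pair)
    qed
    \<comment> \<open>Skew-Segre products of (u0:u1) with the two tuples for y, which describe the
      inverse as a map into projective 3-space.\<close>
    let ?W4 = "\<lambda>(u, v). [u!0 * W0 u v, u!1 * W0 u v, u!1 * W1 u v, u!0 * W1 u v]"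
    let ?V4 = "\<lambda>(u, v). [u!0 * V0 u v, u!1 * V0 u v, u!1 * V1 u v, u!0 * V1 u v]"
    have g5: "given_by coords2 {?W4, ?V4} (Kummer_Delta c P) (the_inv_into (EC c) (kappa c P))"
      unfolding given_by_def
    proof (intro ballI)
      fix Z x assume Z: "Z \<in> Kummer_Delta c P" and x: "x \<in> coords2 Z"
      obtain q where q: "q \<in> EC_cone c" "the_inv_into (EC c) (kappa c P) Z = pt q" "Z = kappa c P (pt q)"
        using inv[OF Z] by blast
      obtain u v where uv: "x = (u, v)" by (cases x)
      have "u \<in> fst (kappa c P (pt q))" "v \<in> snd (kappa c P (pt q))"
        using x unfolding uv q(3) coords2_def by (auto simp: case_prod_unfold)
      note i = inv_coords[OF q(1) this]
      have nz4: "nonzero [u!0 * w0, u!1 * w0, u!1 * w1, u!0 * w1] \<longleftrightarrow> w0 \<noteq> 0 \<or> w1 \<noteq> 0" for w0 w1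
        using i(2) by (auto simp: nonzero_def)
      have "pt q = pt [u!0 * w0, u!1 * w0, u!1 * w1, u!0 * w1]" if "proj2 (pt q) = pt [w0, w1]" for w0 w1
        using skew_segre_proj[OF pt_EC[OF q(1)]] unfolding i(1) that skew_segre_pt by simp
      then show "(\<exists>h\<in>{?W4, ?V4}. nonzero (h x)) \<and>
          (\<forall>h\<in>{?W4, ?V4}. nonzero (h x) \<longrightarrow> the_inv_into (EC c) (kappa c P) Z = pt (h x))"
        using i(3-5) nz4 by (simp add: uv q(2))
    qed
    have "morphism k 3 1 (EC c) (fst \<circ> kappa c P)"
      unfolding morphism_def
    proof (intro exI conjI)
      have "(\<lambda>x. [x!0, x!1]) \<in> tuples (forms k 4 1) 2"
        by (rule tuplesI[of _ "[\<lambda>x. x!0, \<lambda>x. x!1]"]) (auto intro!: K.forms_coord[simplified])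
      moreover have "(\<lambda>x. [x!3, x!2]) \<in> tuples (forms k 4 1) 2"
        by (rule tuplesI[of _ "[\<lambda>x. x!3, \<lambda>x. x!2]"]) (auto intro!: K.forms_coord[simplified])
      ultimately show "{\<lambda>x. [x!0, x!1], \<lambda>x. [x!3, x!2]} \<subseteq> (\<Union>d. tuples (forms k (Suc 3) d) (Suc 1))"
        by (auto simp: numeral_eq_Suc)
    qed (rule g1)
    moreover have "morphism k 3 1 (EC c) (snd \<circ> kappa c P)"
      unfolding morphism_def
    proof (intro exI conjI)
      have lin: "(\<lambda>x. a * x!m + b * x!n) \<in> forms k 4 1" if "a \<in> k" "b \<in> k" "m < 4" "n < 4" for a b m n
        using that by (intro K.forms_add K.forms_scale K.forms_coord)
      have "?F \<in> tuples (forms k 4 1) 2"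
        by (rule tuplesI[of _ "[\<lambda>x. t0 * x!0 + t2 * x!2, \<lambda>x. t3 * x!1 + t1 * x!3]"]) (use tk in \<open>simp_all add: lin[simplified]\<close>)
      moreover have "?G \<in> tuples (forms k 4 1) 2"
        by (rule tuplesI[of _ "[\<lambda>x. t1 * x!1 + t3 * x!3, \<lambda>x. t2 * x!0 + t0 * x!2]"]) (use tk in \<open>simp_all add: lin[simplified]\<close>)
      ultimately show "{?F, ?G} \<subseteq> (\<Union>d. tuples (forms k (Suc 3) d) (Suc 1))"
        by (auto simp: numeral_eq_Suc)
    qed (rule g2)
    moreover have "bimorphism k 3 (Kummer_Delta c P) (the_inv_into (EC c) (kappa c P))"
      unfolding bimorphism_def
    proof (intro exI conjI)
      have z: "0 \<in> k" by (rule K.zero_mem)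
      have w1: "(\<lambda>(u, v). u!0 * W0 u v) \<in> biforms k 2 1"
        by (rule K.biforms_2_1I[of t1 0 0 0 t2 0]) (use tk z in \<open>simp_all add: W0_def algebra_simps power2_eq_square\<close>)
      have w2: "(\<lambda>(u, v). u!1 * W0 u v) \<in> biforms k 2 1"
        by (rule K.biforms_2_1I[of 0 t1 0 0 0 t2]) (use tk z in \<open>simp_all add: W0_def algebra_simps power2_eq_square\<close>)
      have w3: "(\<lambda>(u, v). u!1 * W1 u v) \<in> biforms k 2 1"
        by (rule K.biforms_2_1I[of 0 0 t3 0 t0 0]) (use tk z in \<open>simp_all add: W1_def algebra_simps power2_eq_square\<close>)
      have w4: "(\<lambda>(u, v). u!0 * W1 u v) \<in> biforms k 2 1"
        by (rule K.biforms_2_1I[of 0 t3 0 t0 0 0]) (use tk z in \<open>simp_all add: W1_def algebra_simps power2_eq_square\<close>)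
      have v1: "(\<lambda>(u, v). u!0 * V0 u v) \<in> biforms k 2 1"
        by (rule K.biforms_2_1I[of 0 t0 0 t3 0 0]) (use tk z in \<open>simp_all add: V0_def algebra_simps power2_eq_square\<close>)
      have v2: "(\<lambda>(u, v). u!1 * V0 u v) \<in> biforms k 2 1"
        by (rule K.biforms_2_1I[of 0 0 t0 0 t3 0]) (use tk z in \<open>simp_all add: V0_def algebra_simps power2_eq_square\<close>)
      have v3: "(\<lambda>(u, v). u!1 * V1 u v) \<in> biforms k 2 1"
        by (rule K.biforms_2_1I[of 0 t2 0 0 0 t1]) (use tk z in \<open>simp_all add: V1_def algebra_simps power2_eq_square\<close>)
      have v4: "(\<lambda>(u, v). u!0 * V1 u v) \<in> biforms k 2 1"
        by (rule K.biforms_2_1I[of t2 0 0 0 t1 0]) (use tk z in \<open>simp_all add: V1_def algebra_simps power2_eq_square\<close>)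
      have "?W4 \<in> tuples (biforms k 2 1) 4"
        by (rule tuplesI[of _ "[\<lambda>(u, v). u!0 * W0 u v, \<lambda>(u, v). u!1 * W0 u v, \<lambda>(u, v). u!1 * W1 u v, \<lambda>(u, v). u!0 * W1 u v]"])
          (use w1 w2 w3 w4 in \<open>auto simp: case_prod_unfold\<close>)
      moreover have "?V4 \<in> tuples (biforms k 2 1) 4"
        by (rule tuplesI[of _ "[\<lambda>(u, v). u!0 * V0 u v, \<lambda>(u, v). u!1 * V0 u v, \<lambda>(u, v). u!1 * V1 u v, \<lambda>(u, v). u!0 * V1 u v]"])
          (use v1 v2 v3 v4 in \<open>auto simp: case_prod_unfold\<close>)
      ultimately have "{?W4, ?V4} \<subseteq> tuples (biforms k 2 1) (Suc 3)" by simp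
      then show "{?W4, ?V4} \<subseteq> (\<Union>d e. tuples (biforms k d e) (Suc 3))" by blast
    qed (rule g5)
    ultimately have "isomorphism k (EC c) (Kummer_Delta c P) (kappa c P)"
      unfolding isomorphism_def using bij by simp
    moreover have "\<forall>z \<in> Kummer_Delta c P. the_inv_into (EC c) (kappa c P) z =
        skew_segre (proj1 (the_inv_into (EC c) (kappa c P) z)) (proj2 (the_inv_into (EC c) (kappa c P) z))"
    proof
      fix z assume "z \<in> Kummer_Delta c P"
      then obtain q where "q \<in> EC_cone c" "the_inv_into (EC c) (kappa c P) z = pt q" using inv by blast
      then show "the_inv_into (EC c) (kappa c P) z =
          skew_segre (proj1 (the_inv_into (EC c) (kappa c P) z)) (proj2 (the_inv_into (EC c) (kappa c P) z))"
        using skew_segre_proj pt_EC by simp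
    qed
    ultimately show ?thesis using g1 g2 g3 g4[unfolded W0_def W1_def V0_def V1_def] by blast
  qed
  show ?thesis using part1 part2 unfolding two_tors by blast
qed

end
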